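(* Let $X$ be any of the algebras $\mathcal{S}$, $\mathrm{Sym}^\odot(\mathcal{S})$ and $\mathcal{T}$. Then $X$ is \begin{itemize} \item quasimodular; \item closed under the pointwise product; \item closed under the induced product if $X\neq \mathcal{S}$. \end{itemize} Moreover, the three algebras are related by $\mathcal{S}\subsetneq \mathrm{Sym}^\odot(\mathcal{S}) \subsetneq \mathcal{T}$.
   Context: $\mathscr{P}$ is the set of integer partitions; for $\lambda\in\mathscr{P}$, $r_m(\lambda)$ is the number of parts of $\lambda$ equal to $m$. The $q$-bracket of $f:\mathscr{P}\to\mathbb{Q}$ is $\langle f\rangle_q=\sum_\lambda f(\lambda)q^{|\lambda|}/\sum_\lambda q^{|\lambda|}$. A graded subalgebra $A$ of $\mathbb{Q}^{\mathscr{P}}$ is called a quasimodular algebra if the $q$-bracket of every homogeneous $f\in A$ is a quasimodular form (for $\mathrm{SL}_2(\mathbb{Z})$) of the same weight as $f$. The Faulhaber polynomial $F_l$ ($l\ge1$) is the polynomial with vanishing constant term such that $F_l(n)=\sum_{i=1}^n i^{l-1}$ for all $n\in\mathbb{Z}_{>0}$. For $k\ge0$, $l\ge1$, $k+l$ even, the double moment function is $T_{k,l}(\lambda)=-\frac{B_{k+l}}{2(k+l)}(\delta_{l,1}+\delta_{k,0})+\sum_{m\ge1}m^kF_l(r_m(\lambda))$ ($B_j$ the Bernoulli numbers). The moment functions are $S_k(\lambda)=-\frac{B_k}{2k}+\sum_i\lambda_i^{k-1}$ for even $k\ge2$ (so $S_k=T_{k-1,1}$). The $\vec u$-bracket is $\langle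 f\rangle_{\vec u}=\sum_\lambda f(\lambda)u_\lambda/\sum_\lambda u_\lambda$ with $u_\lambda=u_{\lambda_1}u_{\lambda_2}\cdots$ formal variables; the induced product $f\odot g$ is defined by $\langle f\odot g\rangle_{\vec u}=\langle f\rangle_{\vec u}\langle g\rangle_{\vec u}$. $\mathcal{S}$ is the algebra generated by the $S_k$ under the pointwise product; $\mathrm{Sym}^\odot(\mathcal{S})$ is generated by the elements of $\mathcal{S}$ under the induced product; $\mathcal{T}$ is generated by the $T_{k,l}$ under the pointwise product. The weight grading: $S_k$ has weight $k$; on $\mathcal{T}$, $T_{k,l}$ is assigned weight $k+l$ and the grading is extended under the induced product (the $T_{k_1,l_1}\odot\cdots\odot T_{k_n,l_n}$ form a basis of $\mathcal{T}$). *)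

theory Defs
  imports "HOL-Library.Multiset" "HOL-Computational_Algebra.Formal_Power_Series"
begin

typedef partition = "{M :: nat multiset. 0 \<notin># M}"
  by (rule exI[of _ "{#}"]) simp

definition parts :: "partition \<Rightarrow> nat multiset" where
  "parts p = Rep_partition p"

definition psize :: "partition \<Rightarrow> nat" where
  "psize p = sum_mset (parts p)"

definition mult_r :: "nat \<Rightarrow> partition \<Rightarrow> nat" where
  "mult_r m p = count (parts p) m"

text \<open>Bernoulli numbers via the generating function x/(e^x - 1) (so B_1 = -1/2;
  only even indices are used below).\<close>
definition bernoulli :: "nat \<Rightarrow> rat" where
  "bernoulli n = fact n * fps_nth (fps_X / (fps_exp 1 - 1)) n"

text \<open>Value of the Faulhaber polynomial F_l at a nonnegative integer n:
  F_l(n) = sum_{i=1}^n i^(l-1) (and F_l(0)=0, the vanishing constant term).\<close>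
definition faulhaber :: "nat \<Rightarrow> nat \<Rightarrow> rat" where
  "faulhaber l n = (\<Sum>i=1..n. of_nat i ^ (l - 1))"

definition kdelta :: "nat \<Rightarrow> nat \<Rightarrow> rat" where
  "kdelta a b = (if a = b then 1 else 0)"

definition Smom :: "nat \<Rightarrow> partition \<Rightarrow> rat" where
  "Smom k p = - bernoulli k / (2 * of_nat k) + sum_mset (image_mset (\<lambda>x. of_nat x ^ (k - 1)) (parts p))"

text \<open>T_{k,l}(lambda) = -B_{k+l}/(2(k+l)) (delta_{l,1} + delta_{k,0}) + sum_{m>=1} m^k F_l(r_m(lambda));
  the sum is over the distinct parts m since F_l(0) = 0.\<close>
definition Tmom :: "nat \<Rightarrow> nat \<Rightarrow> partition \<Rightarrow> rat" where
  "Tmom k l p = - bernoulli (k + l) / (2 * of_nat (k + l)) * (kdelta l 1 + kdelta k 0)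
     + (\<Sum>m \<in> set_mset (parts p). of_nat m ^ k * faulhaber l (mult_r m p))"

definition qbracket :: "(partition \<Rightarrow> rat) \<Rightarrow> rat fps" where
  "qbracket f = Abs_fps (\<lambda>n. \<Sum>p \<in> {p. psize p = n}. f p)
              / Abs_fps (\<lambda>n. of_nat (card {p. psize p = n}))"

text \<open>A function f on partitions is identified with the formal series
  sum_lambda f(lambda) u_lambda in the variables u_1, u_2, ...; since
  u_lambda u_mu = u_(lambda + mu) (union of parts), the product of two such
  series is the following convolution.\<close>
definition useries_mult :: "(partition \<Rightarrow> rat) \<Rightarrow> (partition \<Rightarrow> rat) \<Rightarrow> partition \<Rightarrow> rat" where
  "useries_mult f g p = (\<Sum>(a, b) \<in> {(a, b). parts a + parts b = parts p}. f a * g b)"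

definition one_fun :: "partition \<Rightarrow> rat" where
  "one_fun = (\<lambda>_. 1)"

text \<open>Induced product: <f . g>_u = <f>_u <g>_u, i.e.
  (sum (f.g) u)/(sum u) = (sum f u)(sum g u)/(sum u)^2, i.e.
  (sum (f.g) u) * (sum u) = (sum f u) * (sum g u).\<close>
definition odot :: "(partition \<Rightarrow> rat) \<Rightarrow> (partition \<Rightarrow> rat) \<Rightarrow> partition \<Rightarrow> rat" where
  "odot f g = (THE h. useries_mult h one_fun = useries_mult f g)"

definition qlin_span :: "(partition \<Rightarrow> rat) set \<Rightarrow> (partition \<Rightarrow> rat) set" where
  "qlin_span X = {f. \<exists>(n::nat) c g. (\<forall>i<n. g i \<in> X) \<and> f = (\<lambda>p. \<Sum>i<n. c i * g i p)}"

text \<open>Products (pointwise, resp. induced) of finite lists of weighted generators,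
  of total weight w; the empty product is the constant function 1 (the unit
  for both products).\<close>
definition ptw_monos :: "(nat \<times> (partition \<Rightarrow> rat)) set \<Rightarrow> nat \<Rightarrow> (partition \<Rightarrow> rat) set" where
  "ptw_monos G w = {(\<lambda>p. prod_list (map (\<lambda>x. snd x p) xs)) | xs.
      set xs \<subseteq> G \<and> sum_list (map fst xs) = w}"

definition odot_monos :: "(nat \<times> (partition \<Rightarrow> rat)) set \<Rightarrow> nat \<Rightarrow> (partition \<Rightarrow> rat) set" where
  "odot_monos G w = {foldr (\<lambda>x acc. odot (snd x) acc) xs one_fun | xs.
      set xs \<subseteq> G \<and> sum_list (map fst xs) = w}"

definition S_gens :: "(nat \<times> (partition \<Rightarrow> rat)) set" where
  "S_gens = {(k, Smom k) | k. even k \<and> k \<ge> 2}"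

definition S_hom :: "nat \<Rightarrow> (partition \<Rightarrow> rat) set" where
  "S_hom w = qlin_span (ptw_monos S_gens w)"

definition S_alg :: "(partition \<Rightarrow> rat) set" where
  "S_alg = qlin_span (\<Union>w. ptw_monos S_gens w)"

definition SymS_gens :: "(nat \<times> (partition \<Rightarrow> rat)) set" where
  "SymS_gens = {(w, f) | w f. f \<in> S_hom w}"

definition SymS_hom :: "nat \<Rightarrow> (partition \<Rightarrow> rat) set" where
  "SymS_hom w = qlin_span (odot_monos SymS_gens w)"

definition SymS_alg :: "(partition \<Rightarrow> rat) set" where
  "SymS_alg = qlin_span (\<Union>w. odot_monos SymS_gens w)"

definition T_gens :: "(nat \<times> (partition \<Rightarrow> rat)) set" where
  "T_gens = {(k + l, Tmom k l) | k l. l \<ge> 1 \<and> even (k + l)}"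

text \<open>T is generated by the T_{k,l} under the pointwise product; its grading is
  given by the induced products of the T_{k,l}.\<close>
definition T_alg :: "(partition \<Rightarrow> rat) set" where
  "T_alg = qlin_span (\<Union>w. ptw_monos T_gens w)"

definition T_hom :: "nat \<Rightarrow> (partition \<Rightarrow> rat) set" where
  "T_hom w = qlin_span (odot_monos T_gens w)"

definition divisor_sigma :: "nat \<Rightarrow> nat \<Rightarrow> rat" where
  "divisor_sigma k n = (\<Sum>d | d dvd n. of_nat d ^ k)"

definition E2 :: "rat fps" where
  "E2 = Abs_fps (\<lambda>n. if n = 0 then 1 else -24 * divisor_sigma 1 n)"
definition E4 :: "rat fps" where
  "E4 = Abs_fps (\<lambda>n. if n = 0 then 1 else 240 * divisor_sigma 3 n)"
definition E6 :: "rat fps" where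
  "E6 = Abs_fps (\<lambda>n. if n = 0 then 1 else -504 * divisor_sigma 5 n)"

text \<open>Quasimodular forms of weight w for SL_2(Z) (with rational q-expansion):
  the weight-w part of Q[E2,E4,E6].\<close>
definition is_qmf :: "nat \<Rightarrow> rat fps \<Rightarrow> bool" where
  "is_qmf w F \<longleftrightarrow> (\<exists>(n::nat) c a b d. (\<forall>i<n. 2 * a i + 4 * b i + 6 * d i = w) \<and>
      F = (\<Sum>i<n. fps_const (c i) * E2 ^ a i * E4 ^ b i * E6 ^ d i))"

definition quasimodular_alg :: "(partition \<Rightarrow> rat) set \<Rightarrow> (nat \<Rightarrow> (partition \<Rightarrow> rat) set) \<Rightarrow> bool" where
  "quasimodular_alg A W \<longleftrightarrow> (\<forall>w. W w \<subseteq> A) \<and> A \<subseteq> qlin_span (\<Union>w. W w) \<and>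
     (\<forall>w f. f \<in> W w \<longrightarrow> is_qmf w (qbracket f))"

definition closed_pointwise :: "(partition \<Rightarrow> rat) set \<Rightarrow> bool" where
  "closed_pointwise A \<longleftrightarrow> (\<forall>f\<in>A. \<forall>g\<in>A. (\<lambda>p. f p * g p) \<in> A)"

definition closed_odot :: "(partition \<Rightarrow> rat) set \<Rightarrow> bool" where
  "closed_odot A \<longleftrightarrow> (\<forall>f\<in>A. \<forall>g\<in>A. odot f g \<in> A)"

end

theory Submission
  imports Defs "HOL-Computational_Algebra.Polynomial"
begin

text \<open>The u-bracket turns the induced product into multiplication of series. It sends T_{k,l} to a
  constant plus the sum of m^k r^(l-1) u_m^r, so specializing u_m to q^m gives derivatives of
  Eisenstein series, and induced products of the T_{k,l} are quasimodular of the right weight.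
  Pointwise multiplication by the number of parts m becomes the first-order operator
  u_m d/du_m + u_m/(1 - u_m). Hence multiplying an induced product of the T_{k,l} pointwise by T_{k,l} gives
  their induced product plus induced products of fewer factors, where a parity argument under
  u_m to 1/u_m ensures that only T_{k,l} with k + l even occur. By induction, pointwise and induced
  products generate the same algebra. The same holds for the T_{k,l} with l at most k,
  which generate the symmetric algebra of S. Multiplication by S_k is a homogeneous operation for the induced grading,
  so elements of S are quasimodular of the expected weight, too.\<close>

section \<open>The ring of series in the variables u\<close>

text \<open>The obstacle is that the sum over the part sizes m is infinite. Multiplication by r_m +
  1/2 acts on brackets as u_m d/du_m + \<open>psi m\<close>, and \<open>psi m\<close> has constant
  term 1/2, so families of its powers cannot be summed over m. For l > 1 the polynomial F_l vanishes
  at r = 0 and r = -1, that is, where r + 1/2 is 1/2 or -1/2; the resulting factor (r + 1/2)^2 - 1/4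
  makes every term divisible by \<open>phi 2 m\<close>, hence by u_m. The condition l <= k survives
  because differentiating T_{k,l} gives m^k times a polynomial of degree l + 1 in
  \<open>psi m\<close>: each differentiation adds one to the degree allowed beyond the power of m,
  and F_l(r_m) amounts to at most l such operations, which the factor m^k in T_{k,l} absorbs.
  Quasimodularity uses no analysis. Ramanujan's differential equations and a recursion for the
  higher Eisenstein series come from Liouville's counting of solutions of a x + b y = n; their
  constant terms come from the differential equation of (x/2) coth(x/2). Only E_8 = E_4^2 needs a
  separate count.\<close>

lemma zero_notin_parts [simp]: "0 \<notin># parts p"
  using Rep_partition[of p] by (simp add: parts_def)

lemma parts_inject [simp]: "parts p = parts q \<longleftrightarrow> p = q"
  by (simp add: parts_def Rep_partition_inject)

lemma parts_Abs_partition [simp]: "0 \<notin># M \<Longrightarrow> parts (Abs_partition M) = M"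
  by (simp add: parts_def Abs_partition_inverse)

lemma count_parts_zero [simp]: "count (parts p) 0 = 0"
  by (simp add: count_eq_zero_iff)

instantiation partition :: cancel_comm_monoid_add
begin

definition zero_partition :: partition where "0 = Abs_partition {#}"
definition plus_partition :: "partition \<Rightarrow> partition \<Rightarrow> partition" where
  "p + q = Abs_partition (parts p + parts q)"
definition minus_partition :: "partition \<Rightarrow> partition \<Rightarrow> partition" where
  "p - q = Abs_partition (parts p - parts q)"

lemma parts_zero [simp]: "parts 0 = {#}"
  by (simp add: zero_partition_def)

lemma parts_plus [simp]: "parts (p + q) = parts p + parts q"
  by (simp add: plus_partition_def)

lemma parts_minus [simp]: "parts (p - q) = parts p - parts q"
  by (metis minus_partition_def parts_Abs_partition in_diffD zero_notin_parts)

instance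
proof
  fix a b c :: partition
  show "a + b + c = a + (b + c)" by (simp flip: parts_inject add: add.assoc)
  show "a + b = b + a" by (simp flip: parts_inject add: add.commute)
  show "0 + a = a" by (simp flip: parts_inject)
  show "a + b - a = b" by (simp flip: parts_inject)
  show "a - b - c = a - (b + c)" by (simp flip: parts_inject add: diff_diff_eq)
qed

end

definition splits :: "partition \<Rightarrow> (partition \<times> partition) set" where
  "splits p = {(a, b). a + b = p}"

lemma splits_iff [simp]: "(a, b) \<in> splits p \<longleftrightarrow> a + b = p"
  by (simp add: splits_def)


lemma finite_submultisets: "finite {A. A \<subseteq># (M :: 'a multiset)}"
proof (induction M)
  case (add x M)
  have "{A. A \<subseteq># add_mset x M} \<subseteq> {A. A \<subseteq># M} \<union> add_mset x ` {A. A \<subseteq># M}"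
  proof
    fix A assume A: "A \<in> {A. A \<subseteq># add_mset x M}"
    show "A \<in> {A. A \<subseteq># M} \<union> add_mset x ` {A. A \<subseteq># M}"
    proof (cases "x \<in># A")
      case True
      then obtain B where "A = add_mset x B" by (meson multi_member_split)
      with A show ?thesis by auto
    next
      case False
      with A have "A \<subseteq># M"
        unfolding subseteq_mset_def
        by (metis (no_types, lifting) count_add_mset le0 mem_Collect_eq not_in_iff subseteq_mset_def)
      then show ?thesis by auto
    qed
  qed
  with add show ?case by (meson finite_UnI finite_imageI finite_subset)
qed auto

lemma finite_splits [simp]: "finite (splits p)"
proof -
  have "splits p \<subseteq> (Abs_partition ` {A. A \<subseteq># parts p}) \<times> (Abs_partition ` {A. A \<subseteq># parts p})"
  proof clarify
    fix a b assume "(a, b) \<in> splits p"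
    then have "parts p = parts a + parts b" by auto
    then have "parts a \<in> {A. A \<subseteq># parts p}" "parts b \<in> {A. A \<subseteq># parts p}" by auto
    moreover have "a = Abs_partition (parts a)" "b = Abs_partition (parts b)"
      by (simp_all add: parts_def Rep_partition_inverse)
    ultimately show "a \<in> Abs_partition ` {A. A \<subseteq># parts p} \<and> b \<in> Abs_partition ` {A. A \<subseteq># parts p}"
      by blast
  qed
  then show ?thesis
    by (rule finite_subset) (auto intro: finite_submultisets)
qed

lemma useries_mult_splits: "useries_mult f g p = (\<Sum>(a, b)\<in>splits p. f a * g b)"
proof -
  have "{(a, b). parts a + parts b = parts p} = splits p"
    by (auto simp: splits_def simp flip: parts_inject)
  then show ?thesis by (simp add: useries_mult_def)
qed

text \<open>A copy of the function type, so that the convolution can be the multiplication of a ring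
  instance.\<close>

typedef useries = "UNIV :: (partition \<Rightarrow> rat) set"
  morphisms coeff_u useries ..

setup_lifting type_definition_useries

lemma coeff_useries [simp]: "coeff_u (useries f) = f"
  by (simp add: useries_inverse)

lemma useries_coeff [simp]: "useries (coeff_u f) = f"
  by (simp add: coeff_u_inverse)

lemma useries_eqI: "(\<And>p. coeff_u f p = coeff_u g p) \<Longrightarrow> f = g"
  by (metis ext useries_coeff)

lemma useries_mult_assoc:
  "useries_mult (useries_mult f g) h = useries_mult f (useries_mult g h)"
proof
  fix p
  have "useries_mult (useries_mult f g) h p =
      (\<Sum>((d, c), (a, b))\<in>Sigma (splits p) (\<lambda>(d, c). splits d). f a * g b * h c)"
    by (simp add: useries_mult_splits sum.Sigma split_def sum_distrib_right)
  also have "\<dots> = (\<Sum>((a, d), (b, c))\<in>Sigma (splits p) (\<lambda>(a, d). splits d). f a * (g b * h c))"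
    by (rule sum.reindex_bij_witness[of _ "\<lambda>((a, d), (b, c)). ((a + b, c), (a, b))" "\<lambda>((d, c), (a, b)). ((a, b + c), (b, c))"])
       (auto simp: add.assoc)
  also have "\<dots> = useries_mult f (useries_mult g h) p"
    by (simp add: useries_mult_splits sum.Sigma split_def sum_distrib_left)
  finally show "useries_mult (useries_mult f g) h p = useries_mult f (useries_mult g h) p" .
qed

lemma useries_mult_commute: "useries_mult f g = useries_mult g f"
  unfolding useries_mult_splits fun_eq_iff
  by (intro allI sum.reindex_bij_witness[of _ prod.swap prod.swap]) (auto simp: add.commute)

lemma useries_mult_unit: "useries_mult (\<lambda>p. if p = 0 then 1 else 0) g = g"
proof
  fix p
  have "(\<Sum>(a, b)\<in>splits p. (if a = 0 then 1 else 0) * g b)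
      = (\<Sum>(a, b)\<in>{(0 :: partition, p)}. (if a = 0 then 1 else 0) * g b)"
    by (rule sum.mono_neutral_right) (auto split: if_splits)
  then show "useries_mult (\<lambda>p. if p = 0 then 1 else 0) g p = g p"
    by (simp add: useries_mult_splits)
qed

instantiation useries :: comm_ring_1
begin

lift_definition zero_useries :: useries is "\<lambda>_. 0" .
lift_definition one_useries :: useries is "\<lambda>p. if p = 0 then 1 else 0" .
lift_definition plus_useries :: "useries \<Rightarrow> useries \<Rightarrow> useries" is "\<lambda>f g p. f p + g p" .
lift_definition minus_useries :: "useries \<Rightarrow> useries \<Rightarrow> useries" is "\<lambda>f g p. f p - g p" .
lift_definition uminus_useries :: "useries \<Rightarrow> useries" is "\<lambda>f p. - f p" .
lift_definition times_useries :: "useries \<Rightarrow> useries \<Rightarrow> useries" is useries_mult .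

instance
proof
  fix a b c :: useries
  show "a * b * c = a * (b * c)" by transfer (rule useries_mult_assoc)
  show "a * b = b * a" by transfer (rule useries_mult_commute)
  show "1 * a = a" by transfer (rule useries_mult_unit)
  show "(a + b) * c = a * c + b * c"
    by transfer (simp add: useries_mult_splits fun_eq_iff split_def algebra_simps sum.distrib)
  show "(0 :: useries) \<noteq> 1" by transfer (auto simp: fun_eq_iff)
qed (transfer; auto simp: algebra_simps fun_eq_iff)+

end

lemma coeff_u_simps [simp]:
  "coeff_u 0 p = 0" "coeff_u 1 p = (if p = 0 then 1 else 0)"
  "coeff_u (f + g) p = coeff_u f p + coeff_u g p"
  "coeff_u (f - g) p = coeff_u f p - coeff_u g p"
  "coeff_u (- f) p = - coeff_u f p"
  by (transfer; simp)+

lemma coeff_u_mult: "coeff_u (f * g) p = (\<Sum>(a, b)\<in>splits p. coeff_u f a * coeff_u g b)"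
  by transfer (rule useries_mult_splits)

lemma coeff_u_sum [simp]: "coeff_u (sum f A) p = (\<Sum>x\<in>A. coeff_u (f x) p)"
  by (induction A rule: infinite_finite_induct) auto

lift_definition cst :: "rat \<Rightarrow> useries" is "\<lambda>c p. if p = 0 then c else 0" .

lemma coeff_u_cst_mult [simp]: "coeff_u (cst c * f) p = c * coeff_u f p"
proof -
  have "(\<Sum>(a, b)\<in>splits p. (if a = 0 then c else 0) * coeff_u f b)
      = (\<Sum>(a, b)\<in>{(0 :: partition, p)}. (if a = 0 then c else 0) * coeff_u f b)"
    by (rule sum.mono_neutral_right) (auto split: if_splits)
  then show ?thesis by (simp add: coeff_u_mult cst.rep_eq)
qed

lemma cst_add: "cst (a + b) = cst a + cst b"
  and cst_mult: "cst (a * b) = cst a * cst b"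
  and cst_minus: "cst (- a) = - cst a"
  and cst_0 [simp]: "cst 0 = 0" and cst_1 [simp]: "cst 1 = 1"
  by (rule useries_eqI; simp add: cst.rep_eq)+

lemma cst_of_nat: "cst (of_nat n) = of_nat n"
  by (induction n) (auto simp: cst_add)

lemma cst_power: "cst (a ^ n) = cst a ^ n"
  by (induction n) (auto simp: cst_mult)

lemma coeff_u_of_nat_power_mult [simp]: "coeff_u (of_nat m ^ k * f) p = of_nat m ^ k * coeff_u f p"
  using coeff_u_cst_mult[of "of_nat m ^ k" f p] by (simp only: cst_power cst_of_nat)

section \<open>The u-bracket\<close>

definition ones :: useries where "ones = useries one_fun"

lemma coeff_ones [simp]: "coeff_u ones p = 1"
  by (simp add: ones_def one_fun_def)

text \<open>Combines restriction to the support \<open>P\<close> with a bijective reindexing. It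
  serves the sums over splittings or partitions in which only sets of distinct parts, or partitions
  with a single part size, contribute.\<close>

lemma sum_reindex_supported:
  assumes "finite S" and "\<And>a. a \<in> S \<Longrightarrow> \<not> P a \<Longrightarrow> g a = 0"
    and "\<And>a. a \<in> S \<Longrightarrow> P a \<Longrightarrow> i (j a) = a" and "\<And>a. a \<in> S \<Longrightarrow> P a \<Longrightarrow> j a \<in> T"
    and "\<And>a. a \<in> S \<Longrightarrow> P a \<Longrightarrow> h (j a) = g a"
    and "\<And>b. b \<in> T \<Longrightarrow> j (i b) = b" and "\<And>b. b \<in> T \<Longrightarrow> i b \<in> S" and "\<And>b. b \<in> T \<Longrightarrow> P (i b)"
  shows "sum g S = (sum h T :: 'c :: comm_monoid_add)"
proof -
  have "sum g S = sum g {a \<in> S. P a}"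
    using assms(1,2) by (intro sum.mono_neutral_right) auto
  also have "\<dots> = sum h T"
    using assms(3-8) by (intro sum.reindex_bij_witness[of _ i j]) auto
  finally show ?thesis .
qed

lemma sum_Pow_neg_one_power_card:
  assumes "finite A" "A \<noteq> {}"
  shows "(\<Sum>B\<in>Pow A. (- 1) ^ card B) = (0 :: rat)"
proof -
  have "(\<Prod>x\<in>A. (- 1 :: rat) + 1) = (\<Sum>B\<in>Pow A. (\<Prod>x\<in>B. - 1) * (\<Prod>x\<in>A - B. 1))"
    by (rule prod_add[OF assms(1)])
  with assms show ?thesis by (simp add: power_0_left)
qed

text \<open>The inverse of the sum of all monomials, i.e. the product of the factors 1 - u_m.\<close>

definition moebius_u :: useries where
  "moebius_u = useries (\<lambda>p. if parts p = mset_set (set_mset (parts p))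
     then (- 1) ^ card (set_mset (parts p)) else 0)"

text \<open>A splitting of p whose first component has distinct parts is a subset of the part sizes
  of p, so the coefficient at p is an alternating sum over subsets, which vanishes unless p is
  empty.\<close>

lemma ones_moebius: "moebius_u * ones = 1"
proof (rule useries_eqI)
  fix p
  let ?i = "\<lambda>B. (Abs_partition (mset_set B), p - Abs_partition (mset_set B))"
  have "coeff_u (moebius_u * ones) p = (\<Sum>x\<in>splits p. coeff_u moebius_u (fst x))"
    by (simp add: coeff_u_mult split_def)
  also have "\<dots> = (\<Sum>B\<in>Pow (set_mset (parts p)). (- 1) ^ card B)"
  proof (rule sum_reindex_supported[where P = "\<lambda>x. parts (fst x) = mset_set (set_mset (parts (fst x)))"
        and i = ?i and j = "\<lambda>x. set_mset (parts (fst x))"], goal_cases)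
    case (3 x)
    then have "parts (fst x) = mset_set (set_mset (parts (fst x)))" "fst x + snd x = p"
      by (auto simp: splits_def)
    then have "fst x = Abs_partition (mset_set (set_mset (parts (fst x))))" "snd x = p - fst x"
      by (metis parts_def Rep_partition_inverse) (metis add_diff_cancel_left' \<open>fst x + snd x = p\<close>)
    then show ?case by (metis prod.collapse)
  next
    case (4 x)
    then have "p = fst x + snd x" by (auto simp: splits_def)
    then show ?case by simp
  next
    case (5 x)
    then show ?case by (simp add: moebius_u_def)
  next
    case (6 B)
    then have "B \<subseteq> set_mset (parts p)" by auto
    then have "finite B" "0 \<notin> B" by (auto intro: finite_subset)
    then show ?case by simp
  next
    case (7 B)
    then have B: "B \<subseteq> set_mset (parts p)" by auto
    then have fin: "finite B" "0 \<notin> B" by (auto intro: finite_subset)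
    have "mset_set B \<subseteq># parts p"
      unfolding subseteq_mset_def using B fin(1) by (auto simp: count_mset_set' Suc_le_eq)
    with fin show ?case by (simp flip: parts_inject)
  next
    case (8 B)
    then have "B \<subseteq> set_mset (parts p)" by auto
    then have "finite B" "0 \<notin> B" by (auto intro: finite_subset)
    then show ?case by simp
  qed (auto simp: moebius_u_def)
  also have "\<dots> = coeff_u 1 p"
  proof (cases "p = 0")
    case False
    then have "parts p \<noteq> {#}" by (metis parts_inject parts_zero)
    with False show ?thesis by (simp add: sum_Pow_neg_one_power_card)
  qed auto
  finally show "coeff_u (moebius_u * ones) p = coeff_u 1 p" .
qed

lemma ones_cancel: "ones * f = ones * g \<longleftrightarrow> f = g"
  by (metis ones_moebius mult.assoc mult_1)

definition ubracket :: "(partition \<Rightarrow> rat) \<Rightarrow> useries" where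
  "ubracket f = moebius_u * useries f"

lemma ones_ubracket [simp]: "ones * ubracket f = useries f"
  by (metis ubracket_def mult.assoc mult_1 mult.commute ones_moebius)

lemma ubracketI: "ones * x = useries f \<Longrightarrow> ubracket f = x"
  by (metis ones_cancel ones_ubracket)

lemma ubracket_inject: "ubracket f = ubracket g \<longleftrightarrow> f = g"
  by (metis coeff_useries ones_ubracket)

text \<open>Every series is the bracket of a function, so the inductions below may run over series
  and be read back as statements about functions.\<close>

lemma ubracket_surj: "ubracket (coeff_u (ones * x)) = x"
  by (rule ubracketI) simp

text \<open>Invertibility of \<open>ones\<close> makes the description in \<open>odot\<close> have
  exactly one solution.\<close>

lemma useries_odot: "useries (odot f g) = moebius_u * (useries f * useries g)"
proof -
  define h where "h = coeff_u (moebius_u * (useries f * useries g))"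
  have iff: "useries_mult k one_fun = useries_mult f g \<longleftrightarrow> k = h" for k
  proof -
    have "useries_mult k one_fun = useries_mult f g \<longleftrightarrow> useries k * ones = useries f * useries g"
      by (metis coeff_useries ones_def times_useries.rep_eq useries_coeff)
    also have "\<dots> \<longleftrightarrow> useries k = moebius_u * (useries f * useries g)"
      by (metis mult.commute mult.left_commute mult_1 ones_moebius)
    also have "\<dots> \<longleftrightarrow> k = h" by (metis coeff_useries h_def useries_coeff)
    finally show ?thesis .
  qed
  have "odot f g = h" unfolding odot_def iff by simp
  then show ?thesis by (simp add: h_def)
qed

lemma ubracket_odot: "ubracket (odot f g) = ubracket f * ubracket g"
  by (simp add: ubracket_def useries_odot mult_ac)

lemma ubracket_one_fun [simp]: "ubracket one_fun = 1"
  by (rule ubracketI) (simp add: ones_def)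

lemma ubracket_add: "ubracket (\<lambda>p. f p + g p) = ubracket f + ubracket g"
proof (rule ubracketI)
  show "ones * (ubracket f + ubracket g) = useries (\<lambda>p. f p + g p)"
    by (simp add: distrib_left) (rule useries_eqI, simp)
qed

lemma ubracket_scale: "ubracket (\<lambda>p. c * f p) = cst c * ubracket f"
proof (rule ubracketI)
  show "ones * (cst c * ubracket f) = useries (\<lambda>p. c * f p)"
    by (simp add: mult.left_commute[of ones]) (rule useries_eqI, simp)
qed

section \<open>Derivations and one-variable series\<close>

text \<open>The derivation u_m d/du_m, that is, pointwise multiplication by the number of parts equal to m.\<close>

lift_definition part_deriv :: "nat \<Rightarrow> useries \<Rightarrow> useries" is "\<lambda>m f p. of_nat (mult_r m p) * f p" .

lemma coeff_part_deriv [simp]: "coeff_u (part_deriv m f) p = of_nat (mult_r m p) * coeff_u f p"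
  by (simp add: part_deriv.rep_eq)

lemma mult_r_0 [simp]: "mult_r m 0 = 0" and mult_r_plus [simp]: "mult_r m (p + q) = mult_r m p + mult_r m q"
  by (simp_all add: mult_r_def)

lemma part_deriv_add: "part_deriv m (f + g) = part_deriv m f + part_deriv m g" and part_deriv_diff: "part_deriv m (f - g) = part_deriv m f - part_deriv m g"
  and part_deriv_0 [simp]: "part_deriv m 0 = 0"
  and part_deriv_cst [simp]: "part_deriv m (cst c) = 0"
  by (rule useries_eqI; simp add: algebra_simps cst.rep_eq)+

lemma part_deriv_cst_mult: "part_deriv m (cst c * f) = cst c * part_deriv m f"
  and part_deriv_of_nat_power_mult: "part_deriv m (of_nat a ^ k * f) = of_nat a ^ k * part_deriv m f"
  by (rule useries_eqI; simp)+

lemma part_deriv_1 [simp]: "part_deriv m 1 = 0"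
  using part_deriv_cst[of m 1] by simp

lemma part_deriv_mult: "part_deriv m (f * g) = part_deriv m f * g + f * part_deriv m g"
proof (rule useries_eqI)
  fix p
  have "(\<Sum>x\<in>splits p. of_nat (mult_r m p) * (coeff_u f (fst x) * coeff_u g (snd x)))
    = (\<Sum>x\<in>splits p. of_nat (mult_r m (fst x)) * coeff_u f (fst x) * coeff_u g (snd x)
      + coeff_u f (fst x) * (of_nat (mult_r m (snd x)) * coeff_u g (snd x)))"
    by (rule sum.cong) (auto simp: algebra_simps splits_def)
  then show "coeff_u (part_deriv m (f * g)) p = coeff_u (part_deriv m f * g + f * part_deriv m g) p"
    by (simp add: coeff_u_mult split_def sum_distrib_left sum.distrib)
qed

text \<open>The sum of r^(l - 1) u_m^r over r > 0; summed over m with weights m^k it is the bracket of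
  T_{k,l} without its constant term (see part_sum and tau below).\<close>

definition phi :: "nat \<Rightarrow> nat \<Rightarrow> useries" where
  "phi l m = useries (\<lambda>p. if set_mset (parts p) = {m} then of_nat (mult_r m p) ^ (l - 1) else 0)"

lemma coeff_phi: "coeff_u (phi l m) p = (if set_mset (parts p) = {m} then of_nat (mult_r m p) ^ (l - 1) else 0)"
  by (simp add: phi_def)

text \<open>The partitions with one part size are the support of \<open>phi\<close>. For
  \<open>m = 0\<close> and \<open>r > 0\<close> the value is unspecified.\<close>

definition rect :: "nat \<Rightarrow> nat \<Rightarrow> partition" where
  "rect r m = Abs_partition (replicate_mset r m)"

lemma parts_rect [simp]: "m \<noteq> 0 \<Longrightarrow> parts (rect r m) = replicate_mset r m"
  by (simp add: rect_def)

lemma eq_rect: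
  assumes "set_mset (parts p) = {m}"
  shows "p = rect (mult_r m p) m"
proof -
  have "parts p = replicate_mset (mult_r m p) m"
  proof (rule multiset_eqI)
    fix x
    have "count (parts p) x = 0" if "x \<noteq> m"
      using that assms by (simp add: count_eq_zero_iff)
    then show "count (parts p) x = count (replicate_mset (mult_r m p) m) x"
      by (simp add: mult_r_def)
  qed
  then have "rect (mult_r m p) m = Abs_partition (Rep_partition p)"
    by (simp add: rect_def parts_def)
  then show ?thesis by (simp add: Rep_partition_inverse)
qed

text \<open>In a splitting of p that contributes, the first component consists of r copies of m with
  r between 1 and the multiplicity of m in p.\<close>

lemma coeff_phi_mult:
  "coeff_u (phi l m * f) p = (\<Sum>r = 1..mult_r m p. of_nat r ^ (l - 1) * coeff_u f (p - rect r m))"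
proof -
  have eq: "a = rect (mult_r m a) m" if "set_mset (parts a) = {m}" for a
    using eq_rect[OF that] .
  \<comment> \<open>A nonempty range for r excludes m = 0, since 0 is never a part.\<close>
  have m: "m \<noteq> 0" if "r \<in> {1..mult_r m p}" for r
    using that by (cases "m = 0") (auto simp: mult_r_def)
  have "coeff_u (phi l m * f) p = (\<Sum>x\<in>splits p. coeff_u (phi l m) (fst x) * coeff_u f (snd x))"
    by (simp add: coeff_u_mult split_def)
  also have "\<dots> = (\<Sum>r = 1..mult_r m p. of_nat r ^ (l - 1) * coeff_u f (p - rect r m))"
  proof (rule sum_reindex_supported[where P = "\<lambda>x. set_mset (parts (fst x)) = {m}"
        and i = "\<lambda>r. (rect r m, p - rect r m)" and j = "\<lambda>x. mult_r m (fst x)"], goal_cases)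
    case (3 x)
    then have "fst x = rect (mult_r m (fst x)) m" "fst x + snd x = p"
      using eq[of "fst x"] by (auto simp: splits_def)
    then show ?case by (metis add_diff_cancel_left' prod.collapse)
  next
    case (4 x)
    then have "set_mset (parts (fst x)) = {m}" "fst x + snd x = p" by (auto simp: splits_def)
    then show ?case by (auto simp: mult_r_def Suc_le_eq)
  next
    case (5 x)
    then have "fst x = rect (mult_r m (fst x)) m" "fst x + snd x = p"
      using eq[of "fst x"] by (auto simp: splits_def)
    then have "snd x = p - rect (mult_r m (fst x)) m" by (metis add_diff_cancel_left')
    with 5 show ?case by (simp add: coeff_phi)
  next
    case (6 r)
    with m[of r] show ?case by (simp add: mult_r_def)
  next
    case (7 r)
    with m[of r] have "replicate_mset r m \<subseteq># parts p"
      by (simp add: mult_r_def flip: count_le_replicate_mset_subset_eq)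
    with m[of r] 7 show ?case by (simp flip: parts_inject)
  next
    case (8 r)
    with m[of r] show ?case by simp
  qed (auto simp: coeff_phi)
  finally show ?thesis .
qed

text \<open>The factor 1/(1 - u_m) of \<open>ones\<close> replaces the coefficients of u_m^r by
  their partial sums; this is where the Faulhaber polynomials enter.\<close>

lemma coeff_phi_mult_ones: "coeff_u (ones * phi l m) p = faulhaber l (mult_r m p)"
  by (simp add: mult.commute[of ones] coeff_phi_mult faulhaber_def)

text \<open>The logarithmic derivative of 1/(1 - u_m) under u_m d/du_m is u_m/(1 - u_m).\<close>

lemma part_deriv_ones: "part_deriv m ones = ones * phi 1 m"
  by (rule useries_eqI) (simp add: coeff_phi_mult_ones faulhaber_def)

lemma part_deriv_phi: "l \<ge> 1 \<Longrightarrow> part_deriv m (phi l m) = phi (Suc l) m"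
  by (rule useries_eqI) (auto simp: coeff_phi mult_r_def simp flip: power_Suc)

text \<open>This is u/(1 - u)^2 = u/(1 - u) + (u/(1 - u))^2: at u_m^r the square counts the r - 1
  ways to write r as a sum of two positive integers.\<close>

lemma phi_2: "phi 2 m = phi 1 m + phi 1 m ^ 2"
proof (cases "m = 0")
  case True
  have "set_mset (parts p) \<noteq> {0}" for p
    using zero_notin_parts[of p] by (metis insertI1)
  then have "phi l 0 = 0" for l
    by (intro useries_eqI) (simp add: coeff_phi)
  with True show ?thesis by simp
next
  case False
  show ?thesis
  proof (rule useries_eqI)
    fix p
    have 1: "coeff_u (phi 1 m ^ 2) p = (\<Sum>r = 1..mult_r m p. coeff_u (phi 1 m) (p - rect r m))"
      by (simp add: power2_eq_square coeff_phi_mult)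
    show "coeff_u (phi 2 m) p = coeff_u (phi 1 m + phi 1 m ^ 2) p"
    proof (cases "set_mset (parts p) = {m}")
      case True
      then have p: "parts p = replicate_mset (mult_r m p) m"
        using False eq_rect parts_rect by metis
      have n: "mult_r m p \<ge> 1" using True by (auto simp: mult_r_def Suc_le_eq)
      have "set_mset (parts (p - rect r m)) = {m} \<longleftrightarrow> r < mult_r m p" for r
      proof -
        have "parts (p - rect r m) = replicate_mset (mult_r m p - r) m"
          using False by (subst parts_minus, subst p) (auto intro!: multiset_eqI)
        then show ?thesis by auto
      qed
      then have "coeff_u (phi 1 m ^ 2) p = (\<Sum>r = 1..mult_r m p. if r < mult_r m p then 1 else 0)"
        unfolding 1 by (intro sum.cong) (auto simp: coeff_phi)
      also have "\<dots> = of_nat (card {r \<in> {1..mult_r m p}. r < mult_r m p})"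
        by (simp add: sum.If_cases Int_def)
      also have "{r \<in> {1..mult_r m p}. r < mult_r m p} = {1..<mult_r m p}" by auto
      finally show ?thesis using n True by (simp add: coeff_phi of_nat_diff)
    next
      case False
      have "set_mset (parts (p - rect r m)) \<noteq> {m}" if r: "r \<in> {1..mult_r m p}" for r
      proof
        assume *: "set_mset (parts (p - rect r m)) = {m}"
        have "m \<noteq> 0" using r by (cases "m = 0") (auto simp: mult_r_def)
        then have "parts (p - rect r m) = parts p - replicate_mset r m" "replicate_mset r m \<subseteq># parts p"
          using r by (auto simp: mult_r_def simp flip: count_le_replicate_mset_subset_eq)
        then have "parts p = parts (p - rect r m) + replicate_mset r m"
          by (metis subset_mset.diff_add)
        then have "set_mset (parts p) = {m} \<union> set_mset (replicate_mset r m)"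
          using * by (metis set_mset_union)
        then have "set_mset (parts p) = {m}" by simp
        with False show False by simp
      qed
      with False show ?thesis by (simp add: 1 coeff_phi del: One_nat_def parts_minus)
    qed
  qed
qed

text \<open>The formal sum of m^k \<open>\<Phi> m\<close> over all m, truncated in each coefficient
  to the part sizes that occur. For families with \<open>supported m (\<Phi> m)\<close> the omitted
  terms vanish, so it is the honest sum.\<close>

definition part_sum :: "nat \<Rightarrow> (nat \<Rightarrow> useries) \<Rightarrow> useries" where
  "part_sum k \<Phi> = useries (\<lambda>p. \<Sum>m\<in>set_mset (parts p). of_nat m ^ k * coeff_u (\<Phi> m) p)"

lemma coeff_part_sum: "coeff_u (part_sum k \<Phi>) p = (\<Sum>m\<in>set_mset (parts p). of_nat m ^ k * coeff_u (\<Phi> m) p)"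
  by (simp add: part_sum_def)

lemma part_sum_add: "part_sum k (\<lambda>m. \<Phi> m + \<Psi> m) = part_sum k \<Phi> + part_sum k \<Psi>"
  and part_sum_0 [simp]: "part_sum k (\<lambda>m. 0) = 0"
  by (rule useries_eqI; simp add: coeff_part_sum distrib_left sum.distrib)+

lemma part_sum_of_nat_power: "part_sum k (\<lambda>m. of_nat m ^ j * \<Phi> m) = part_sum (k + j) \<Phi>"
  by (rule useries_eqI) (simp add: coeff_part_sum power_add mult.assoc)

definition supported :: "nat \<Rightarrow> useries \<Rightarrow> bool" where
  "supported m f \<longleftrightarrow> (\<forall>p. m \<notin># parts p \<longrightarrow> coeff_u f p = 0)"

lemma supported_0 [simp]: "supported m 0"
  and supported_add: "supported m f \<Longrightarrow> supported m g \<Longrightarrow> supported m (f + g)"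
  and supported_part_deriv [simp]: "supported m (part_deriv m f)"
  and supported_phi [simp]: "supported m (phi l m)"
  by (auto simp: supported_def coeff_phi mult_r_def count_eq_zero_iff)

lemma supported_mult: "supported m f \<Longrightarrow> supported m (f * g)"
  unfolding supported_def coeff_u_mult
  by (auto intro!: sum.neutral)

text \<open>By support, the sum over the part sizes of p may be narrowed to those of the first
  component of each splitting, after which f factors out.\<close>

lemma part_sum_mult:
  assumes "\<And>m. supported m (\<Phi> m)"
  shows "part_sum k (\<lambda>m. \<Phi> m * f) = part_sum k \<Phi> * f"
proof (rule useries_eqI)
  fix p
  have "coeff_u (part_sum k (\<lambda>m. \<Phi> m * f)) p
      = (\<Sum>m\<in>set_mset (parts p). \<Sum>x\<in>splits p. of_nat m ^ k * coeff_u (\<Phi> m) (fst x) * coeff_u f (snd x))"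
    by (simp add: coeff_part_sum coeff_u_mult split_def sum_distrib_left mult.assoc)
  also have "\<dots> = (\<Sum>x\<in>splits p. \<Sum>m\<in>set_mset (parts p). of_nat m ^ k * coeff_u (\<Phi> m) (fst x) * coeff_u f (snd x))"
    by (rule sum.swap)
  also have "\<dots> = (\<Sum>x\<in>splits p. \<Sum>m\<in>set_mset (parts (fst x)). of_nat m ^ k * coeff_u (\<Phi> m) (fst x) * coeff_u f (snd x))"
  proof (rule sum.cong[OF refl], rule sum.mono_neutral_right)
    fix x assume x: "x \<in> splits p"
    then have "parts p = parts (fst x) + parts (snd x)" by (auto simp: splits_def)
    then show "set_mset (parts (fst x)) \<subseteq> set_mset (parts p)" by simp
    show "\<forall>m\<in>set_mset (parts p) - set_mset (parts (fst x)).
        of_nat m ^ k * coeff_u (\<Phi> m) (fst x) * coeff_u f (snd x) = 0"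
      using assms by (simp add: supported_def)
  qed simp
  also have "\<dots> = coeff_u (part_sum k \<Phi> * f) p"
    by (simp add: coeff_part_sum coeff_u_mult split_def sum_distrib_right)
  finally show "coeff_u (part_sum k (\<lambda>m. \<Phi> m * f)) p = coeff_u (part_sum k \<Phi> * f) p" .
qed

definition tau :: "nat \<Rightarrow> nat \<Rightarrow> useries" where
  "tau k l = part_sum k (phi l)"

text \<open>Only the summand for the part size m involves u_m, and the operator multiplies its
  coefficient r^(l - 1) by r.\<close>

lemma part_deriv_tau:
  assumes "l \<ge> 1"
  shows "part_deriv m (tau k l) = of_nat m ^ k * phi (Suc l) m"
proof (rule useries_eqI)
  fix p
  show "coeff_u (part_deriv m (tau k l)) p = coeff_u (of_nat m ^ k * phi (Suc l) m) p"
  proof (cases "\<exists>a. set_mset (parts p) = {a}")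
    case True
    then obtain a where a: "set_mset (parts p) = {a}" ..
    have "mult_r m p = 0" if "m \<noteq> a"
      using a that by (simp add: mult_r_def count_eq_zero_iff)
    then show ?thesis
      using assms a by (cases "m = a"; cases l) (simp_all add: tau_def coeff_part_sum coeff_phi)
  next
    case False
    then show ?thesis by (simp add: tau_def coeff_part_sum coeff_phi)
  qed
qed

lemma part_sum_phi_mult: "part_sum k (\<lambda>m. phi l m * f) = tau k l * f"
  by (simp add: part_sum_mult tau_def)

text \<open>The double moment without its Bernoulli constant. Constants lie in every algebra here,
  so it generates the same algebra as \<open>Tmom k l\<close>; the constant matters for weights and
  quasimodularity.\<close>

definition Pfun :: "nat \<Rightarrow> nat \<Rightarrow> partition \<Rightarrow> rat" where
  "Pfun k l p = (\<Sum>m\<in>set_mset (parts p). of_nat m ^ k * faulhaber l (mult_r m p))"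

lemma ubracket_Pfun: "ubracket (Pfun k l) = tau k l"
proof (rule ubracketI)
  have "ones * tau k l = part_sum k (\<lambda>m. phi l m * ones)"
    using part_sum_phi_mult[of k l ones] by (simp add: mult.commute)
  also have "\<dots> = useries (Pfun k l)"
    by (rule useries_eqI) (simp add: coeff_part_sum Pfun_def mult.commute[of _ ones] coeff_phi_mult_ones)
  finally show "ones * tau k l = useries (Pfun k l)" .
qed

text \<open>Under the substitution of 1/u_m for u_m the series psi m changes sign, as does part_deriv m.
  The resulting notion of parity is what selects the T_{k,l} with k + l even.\<close>

definition psi :: "nat \<Rightarrow> useries" where "psi m = phi 1 m + cst (1 / 2)"

lemma cst_simps: "cst (1 / 2) + cst (1 / 2) = 1" "cst (1/2) * cst (1/2) = cst (1/4)"
  by (simp_all flip: cst_add cst_mult)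

lemma phi_2_psi: "phi 2 m = psi m ^ 2 - cst (1 / 4)"
proof -
  have "psi m ^ 2 = phi 1 m ^ 2 + phi 1 m * (cst (1/2) + cst (1/2)) + cst (1/2) * cst (1/2)"
    by (simp only: psi_def power2_eq_square) (simp add: algebra_simps)
  then show ?thesis by (simp only: phi_2 cst_simps) simp
qed

lemma part_deriv_psi: "part_deriv m (psi m) = phi 2 m"
  by (simp add: psi_def part_deriv_add part_deriv_phi numeral_2_eq_2)

lemma part_deriv_psi_power: "part_deriv m (psi m ^ i) = of_nat i * psi m ^ (i - 1) * phi 2 m"
proof (induction i)
  case (Suc i)
  then show ?case by (cases i) (simp_all add: part_deriv_mult part_deriv_psi algebra_simps)
qed simp

text \<open>Multiples of \<open>phi 2 m\<close> are divisible by u_m and may be summed over m,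
  whereas bare powers of \<open>psi m\<close> have nonzero constant terms.\<close>

definition psi_phi :: "nat \<Rightarrow> nat \<Rightarrow> useries" where
  "psi_phi i m = psi m ^ i * phi 2 m"

text \<open>From D psi = phi_2 = psi^2 - 1/4 and D phi_2 = 2 psi phi_2, where D is
  \<open>part_deriv m\<close>. For \<open>i = 0\<close> the truncated index \<open>i - 1\<close>
  occurs with coefficient 0.\<close>

lemma part_deriv_psi_phi: "part_deriv m (psi_phi i m) = of_nat (i + 2) * psi_phi (i + 1) m - cst (of_nat i / 4) * psi_phi (i - 1) m"
proof -
  have 4: "cst (of_nat i / 4) = of_nat i * cst (1 / 4)"
    by (simp flip: cst_mult cst_of_nat)
  have D2: "part_deriv m (phi 2 m) = 2 * psi m * phi 2 m"
    unfolding phi_2_psi[of m] by (simp add: part_deriv_diff part_deriv_psi_power[of m 2, simplified] phi_2_psi)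
  have sq: "phi 2 m * phi 2 m = (psi m * psi m - cst (1 / 4)) * phi 2 m"
    by (simp add: phi_2_psi power2_eq_square)
  show ?thesis
  proof (cases i)
    case 0
    then show ?thesis by (simp add: psi_phi_def D2)
  next
    case (Suc j)
    have "part_deriv m (psi_phi i m) = of_nat i * psi m ^ j * (phi 2 m * phi 2 m) + psi m ^ i * (2 * psi m * phi 2 m)"
      unfolding psi_phi_def part_deriv_mult part_deriv_psi_power D2 by (simp add: Suc mult.assoc)
    also have "\<dots> = of_nat (i + 2) * psi_phi (i + 1) m - of_nat i * cst (1 / 4) * psi_phi (i - 1) m"
      unfolding sq by (simp add: psi_phi_def Suc algebra_simps)
    finally show ?thesis by (simp only: 4)
  qed
qed

section \<open>Pointwise multiplication and induced products\<close>

text \<open>With b = False these are all the indices of the T_{k,l}; with b = True only those with l at most k,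
  whose T_{k,l} generate the symmetric algebra of S.\<close>

definition tau_index :: "bool \<Rightarrow> (nat \<times> nat) set" where
  "tau_index b = {(k, l). 1 \<le> l \<and> even (k + l) \<and> (b \<longrightarrow> l \<le> k)}"

text \<open>The index bounds one plus the number of factors: level 0 is zero and level 1 the constants.\<close>

inductive tau_filt :: "bool \<Rightarrow> nat \<Rightarrow> useries \<Rightarrow> bool" for b where
  tau_filt_0: "tau_filt b n 0"
| tau_filt_cst: "tau_filt b (Suc n) (cst c)"
| tau_filt_add: "tau_filt b n X \<Longrightarrow> tau_filt b n Y \<Longrightarrow> tau_filt b n (X + Y)"
| tau_filt_scale: "tau_filt b n X \<Longrightarrow> tau_filt b n (cst c * X)"
| tau_filt_tau: "(k, l) \<in> tau_index b \<Longrightarrow> tau_filt b n X \<Longrightarrow> tau_filt b (Suc n) (tau k l * X)"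

lemma tau_filt_eq_0: "tau_filt b n X \<Longrightarrow> n = 0 \<Longrightarrow> X = 0"
  by (induction rule: tau_filt.induct) auto

lemma tau_filt_eq_cst: "tau_filt b n X \<Longrightarrow> n = 1 \<Longrightarrow> \<exists>c. X = cst c"
proof (induction rule: tau_filt.induct)
  case (tau_filt_0 n)
  then show ?case by (metis cst_0)
next
  case (tau_filt_tau k l n X)
  then show ?case using tau_filt_eq_0 by (metis One_nat_def Suc_inject cst_0 mult_zero_right)
qed (auto simp flip: cst_add cst_mult)

lemma tau_filt_Suc: "tau_filt b n X \<Longrightarrow> tau_filt b (Suc n) X"
  by (induction rule: tau_filt.induct) (auto intro: tau_filt.intros)

lemma tau_filt_mono: "n \<le> n' \<Longrightarrow> tau_filt b n X \<Longrightarrow> tau_filt b n' X"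
  by (induction rule: dec_induct) (auto intro: tau_filt_Suc)

text \<open>Families indexed by the part size m. The evenness condition ties the parity of the one-variable factor
  h i m to the power of m, so that summing the family against m^k again involves only tau k l with k + l even.
  If b holds, the degree in psi is bounded as well.\<close>

inductive fam_span :: "(nat \<Rightarrow> nat \<Rightarrow> useries) \<Rightarrow> nat \<Rightarrow> bool \<Rightarrow> nat \<Rightarrow> nat \<Rightarrow> (nat \<Rightarrow> useries) \<Rightarrow> bool"
  for h d b j n where
  fam_span_0: "fam_span h d b j n (\<lambda>m. 0)"
| fam_span_step: "fam_span h d b j n \<Phi> \<Longrightarrow> even (i + j + \<kappa>) \<Longrightarrow> (b \<Longrightarrow> i + d \<le> j + \<kappa>) \<Longrightarrow> tau_filt b n Y
    \<Longrightarrow> fam_span h d b j n (\<lambda>m. \<Phi> m + of_nat m ^ \<kappa> * (h i m * Y))"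

lemma fam_span_single:
  "even (i + j + \<kappa>) \<Longrightarrow> (b \<Longrightarrow> i + d \<le> j + \<kappa>) \<Longrightarrow> tau_filt b n Y \<Longrightarrow> fam_span h d b j n (\<lambda>m. of_nat m ^ \<kappa> * (h i m * Y))"
  using fam_span_step[OF fam_span_0] by auto

lemma fam_span_add:
  assumes "fam_span h d b j n \<Phi>" "fam_span h d b j n \<Psi>"
  shows "fam_span h d b j n (\<lambda>m. \<Phi> m + \<Psi> m)"
  using assms(2)
proof (induction rule: fam_span.induct)
  case (fam_span_step \<Psi> i \<kappa> Y)
  then show ?case using fam_span.fam_span_step[of h d b j n "\<lambda>m. \<Phi> m + \<Psi> m" i \<kappa> Y]
    by (simp add: add.assoc)
qed (simp add: assms)

text \<open>Additive maps need to be checked only on a single generating term; nearly all closure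
  statements below are instances.\<close>

lemma fam_span_map:
  assumes "fam_span h d b j n \<Phi>"
    and "\<And>m. t m 0 = 0" and "\<And>m x y. t m (x + y) = t m x + t m y"
    and "\<And>i \<kappa> Y. even (i + j + \<kappa>) \<Longrightarrow> (b \<Longrightarrow> i + d \<le> j + \<kappa>) \<Longrightarrow> tau_filt b n Y
      \<Longrightarrow> fam_span h' d' b' j' n' (\<lambda>m. t m (of_nat m ^ \<kappa> * (h i m * Y)))"
  shows "fam_span h' d' b' j' n' (\<lambda>m. t m (\<Phi> m))"
  using assms(1)
proof (induction rule: fam_span.induct)
  case fam_span_0
  show ?case by (simp add: assms(2) fam_span.fam_span_0)
next
  case (fam_span_step \<Phi> i \<kappa> Y)
  show ?case unfolding assms(3)
    by (intro fam_span_add fam_span_step.IH assms(4) fam_span_step.hyps)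
qed

lemma fam_span_cst: "fam_span h d b j n \<Phi> \<Longrightarrow> fam_span h d b j n (\<lambda>m. cst c * \<Phi> m)"
  by (erule fam_span_map) (auto simp: distrib_left mult.left_commute[of "cst c"] intro!: fam_span_single tau_filt_scale)

lemma fam_span_diff: "fam_span h d b j n \<Phi> \<Longrightarrow> fam_span h d b j n \<Psi> \<Longrightarrow> fam_span h d b j n (\<lambda>m. \<Phi> m - \<Psi> m)"
  using fam_span_add[OF _ fam_span_cst[of _ _ _ _ _ _ "- 1"]] by (simp add: cst_minus)

lemma fam_span_sum: "(\<And>x. x \<in> A \<Longrightarrow> fam_span h d b j n (\<Phi> x)) \<Longrightarrow> fam_span h d b j n (\<lambda>m. \<Sum>x\<in>A. \<Phi> x m)"
  by (induction A rule: infinite_finite_induct) (auto intro: fam_span_0 fam_span_add)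

lemma fam_span_mono: "fam_span h d b j n \<Phi> \<Longrightarrow> n \<le> n' \<Longrightarrow> fam_span h d b j n' \<Phi>"
  by (erule fam_span_map[where t = "\<lambda>m x. x"]) (auto intro!: fam_span_single tau_filt_mono[of n n'])

lemma fam_span_tau: "fam_span h d b j n \<Phi> \<Longrightarrow> (k, l) \<in> tau_index b \<Longrightarrow> fam_span h d b j (Suc n) (\<lambda>m. tau k l * \<Phi> m)"
  by (erule fam_span_map) (auto simp: distrib_left mult.left_commute[of "tau k l"] intro!: fam_span_single tau_filt_tau)

text \<open>The numbers 0 and 2 are the degree in \<open>psi m\<close> of the factor common to the
  family: none for bare powers, that of \<open>phi 2 m\<close> otherwise.\<close>

abbreviation "psi_span \<equiv> fam_span (\<lambda>i m. psi m ^ i) 0"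
abbreviation "psi_phi_span \<equiv> fam_span psi_phi 2"

lemma fam_span_psi_mult:
  assumes "psi_phi_span b j n \<Phi>" "even (i + j' + \<kappa>)" "b \<Longrightarrow> i \<le> j' + \<kappa>"
  shows "psi_phi_span b (j + j') n (\<lambda>m. of_nat m ^ \<kappa> * (psi m ^ i * \<Phi> m))"
  using assms(1)
proof (rule fam_span_map[where t = "\<lambda>m x. of_nat m ^ \<kappa> * (psi m ^ i * x)"])
  fix i' \<kappa>' Y assume *: "even (i' + j + \<kappa>')" "b \<Longrightarrow> i' + 2 \<le> j + \<kappa>'" "tau_filt b n Y"
  have "psi_phi_span b (j + j') n (\<lambda>m. of_nat m ^ (\<kappa> + \<kappa>') * (psi_phi (i + i') m * Y))"
  proof (rule fam_span_single)
    show "even (i + i' + (j + j') + (\<kappa> + \<kappa>'))" using *(1) assms(2) by presburger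
    show "i + i' + 2 \<le> j + j' + (\<kappa> + \<kappa>')" if b using *(2) assms(3) that by linarith
  qed fact
  then show "psi_phi_span b (j + j') n (\<lambda>m. of_nat m ^ \<kappa> * (psi m ^ i * (of_nat m ^ \<kappa>' * (psi_phi i' m * Y))))"
    by (simp add: psi_phi_def power_add mult_ac)
qed (simp_all add: algebra_simps)

lemma psi_span_psi:
  assumes "psi_span b j n \<Phi>"
  shows "psi_span b (Suc j) n (\<lambda>m. psi m * \<Phi> m)"
  using assms
proof (rule fam_span_map[where t = "\<lambda>m x. psi m * x"])
  fix i \<kappa> Y assume *: "even (i + j + \<kappa>)" "b \<Longrightarrow> i + 0 \<le> j + \<kappa>" "tau_filt b n Y"
  have "psi_span b (Suc j) n (\<lambda>m. of_nat m ^ \<kappa> * (psi m ^ Suc i * Y))"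
    by (rule fam_span_single) (use * in auto)
  then show "psi_span b (Suc j) n (\<lambda>m. psi m * (of_nat m ^ \<kappa> * (psi m ^ i * Y)))"
    by (simp add: mult_ac)
qed (simp_all add: algebra_simps)

lemma psi_span_phi_2:
  assumes "psi_span b j n \<Phi>"
  shows "psi_phi_span b (Suc (Suc j)) n (\<lambda>m. phi 2 m * \<Phi> m)"
  using assms
proof (rule fam_span_map[where t = "\<lambda>m x. phi 2 m * x"])
  fix i \<kappa> Y assume *: "even (i + j + \<kappa>)" "b \<Longrightarrow> i + 0 \<le> j + \<kappa>" "tau_filt b n Y"
  have "psi_phi_span b (Suc (Suc j)) n (\<lambda>m. of_nat m ^ \<kappa> * (psi_phi i m * Y))"
    by (rule fam_span_single) (use * in auto)
  then show "psi_phi_span b (Suc (Suc j)) n (\<lambda>m. phi 2 m * (of_nat m ^ \<kappa> * (psi m ^ i * Y)))"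
    by (simp add: psi_phi_def mult_ac)
qed (simp_all add: algebra_simps)

text \<open>\<open>phi 2 m\<close> is \<open>psi m ^ 2 - cst (1 / 4)\<close>, whose two terms have
  the same parity and degree at most 2.\<close>

lemma psi_phi_span_imp_psi_span:
  assumes "psi_phi_span b j n \<Phi>"
  shows "psi_span b j n \<Phi>"
  using assms
proof (rule fam_span_map[where t = "\<lambda>m x. x"])
  fix i \<kappa> Y assume *: "even (i + j + \<kappa>)" "b \<Longrightarrow> i + 2 \<le> j + \<kappa>" "tau_filt b n Y"
  have "psi_span b j n (\<lambda>m. of_nat m ^ \<kappa> * (psi m ^ (i + 2) * Y) - cst (1 / 4) * (of_nat m ^ \<kappa> * (psi m ^ i * Y)))"
    by (intro fam_span_diff fam_span_cst fam_span_single) (use * in auto)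
  then show "psi_span b j n (\<lambda>m. of_nat m ^ \<kappa> * (psi_phi i m * Y))"
    by (simp add: psi_phi_def phi_2_psi algebra_simps power2_eq_square)
qed simp_all

abbreviation "phi_span \<equiv> fam_span (\<lambda>i. phi (i + 2)) 2"

text \<open>Adding 2 to j keeps the parity and only relaxes the degree bound.\<close>

lemma fam_span_Suc_Suc: "fam_span h d b j n \<Phi> \<Longrightarrow> fam_span h d b (Suc (Suc j)) n \<Phi>"
  by (erule fam_span_map[where t = "\<lambda>m x. x"]) (auto intro!: fam_span_single)

text \<open>At level 1 the coefficients are constants, so the derivative falls on \<open>phi\<close>
  alone.\<close>

lemma phi_span_part_deriv:
  assumes "phi_span b j 1 \<Phi>"
  shows "phi_span b (Suc j) 1 (\<lambda>m. part_deriv m (\<Phi> m))"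
  using assms
proof (rule fam_span_map[where t = part_deriv])
  fix i \<kappa> Y assume *: "even (i + j + \<kappa>)" "b \<Longrightarrow> i + 2 \<le> j + \<kappa>" "tau_filt b 1 Y"
  obtain c where Y: "Y = cst c" using tau_filt_eq_cst *(3) by blast
  have "phi_span b (Suc j) 1 (\<lambda>m. of_nat m ^ \<kappa> * (phi (Suc i + 2) m * Y))"
    by (rule fam_span_single) (use * in auto)
  then show "phi_span b (Suc j) 1 (\<lambda>m. part_deriv m (of_nat m ^ \<kappa> * (phi (i + 2) m * Y)))"
    unfolding part_deriv_of_nat_power_mult by (simp add: part_deriv_mult part_deriv_phi Y)
qed (simp_all add: part_deriv_add)

text \<open>Solving the recursion \<open>part_deriv_psi_phi\<close> for its leading term expresses
  \<open>psi_phi i\<close> through derivatives of \<open>phi 2\<close>, which are the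
  \<open>phi (l + 2)\<close>. With \<open>True\<close> the degree bound is recorded, which also
  serves the case without it.\<close>

lemma phi_span_psi_phi: "phi_span True (i + 2) 1 (psi_phi i)"
proof (induction i rule: less_induct)
  case (less i)
  show ?case
  proof (cases i)
    case 0
    have "phi_span True 2 1 (\<lambda>m. of_nat m ^ 0 * (phi (0 + 2) m * cst 1))"
      by (rule fam_span_single) (use tau_filt_cst[of True 0 1] in auto)
    moreover have "psi_phi 0 = phi 2" by (simp add: psi_phi_def fun_eq_iff)
    ultimately show ?thesis by (simp add: 0 numeral_2_eq_2)
  next
    case (Suc i')
    have prev: "phi_span True (Suc (i' + 2)) 1 (\<lambda>m. cst (of_nat i' / 4) * psi_phi (i' - 1) m)"
    proof (cases i')
      case 0
      then show ?thesis by (simp add: fam_span_0)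
    next
      case (Suc i'')
      have "phi_span True (Suc (Suc (i'' + 2))) 1 (psi_phi i'')"
        by (rule fam_span_Suc_Suc, rule less.IH) (simp add: \<open>i = Suc i'\<close> Suc)
      then show ?thesis by (intro fam_span_cst) (simp add: Suc)
    qed
    have "psi_phi (Suc i') m = cst (1 / of_nat (i' + 2)) * (part_deriv m (psi_phi i' m) + cst (of_nat i' / 4) * psi_phi (i' - 1) m)" for m
    proof -
      have "cst (1 / of_nat (i' + 2)) * of_nat (i' + 2) = 1"
        by (simp only: cst_of_nat[symmetric] cst_mult[symmetric]) simp
      then show ?thesis
        by (simp add: part_deriv_psi_phi mult.assoc[symmetric])
    qed
    moreover have "phi_span True (Suc (i' + 2)) 1 (\<lambda>m. cst (1 / of_nat (i' + 2)) * (part_deriv m (psi_phi i' m) + cst (of_nat i' / 4) * psi_phi (i' - 1) m))"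
      using phi_span_part_deriv[OF less.IH[of i']] by (intro fam_span_cst fam_span_add[OF _ prev]) (simp add: Suc)
    ultimately show ?thesis by (simp add: Suc fun_eq_iff[symmetric])
  qed
qed

text \<open>The change of basis is needed because products and derivatives are simple in powers of
  \<open>psi\<close>, while summation over m is understood for \<open>phi l m\<close>, which it
  turns into \<open>tau k l\<close>.\<close>

lemma psi_phi_span_imp_phi_span:
  assumes "psi_phi_span b j n \<Phi>"
  shows "phi_span b j n \<Phi>"
  using assms
proof (rule fam_span_map[where t = "\<lambda>m x. x"])
  fix i \<kappa> Y assume *: "even (i + j + \<kappa>)" "b \<Longrightarrow> i + 2 \<le> j + \<kappa>" "tau_filt b n Y"
  show "phi_span b j n (\<lambda>m. of_nat m ^ \<kappa> * (psi_phi i m * Y))"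
    using phi_span_psi_phi[of i]
  proof (rule fam_span_map[where t = "\<lambda>m x. of_nat m ^ \<kappa> * (x * Y)"])
    fix i' \<kappa>' Y' assume **: "even (i' + (i + 2) + \<kappa>')" "True \<Longrightarrow> i' + 2 \<le> i + 2 + \<kappa>'" "tau_filt True 1 Y'"
    then obtain c where Y': "Y' = cst c" using tau_filt_eq_cst by blast
    have "phi_span b j n (\<lambda>m. of_nat m ^ (\<kappa> + \<kappa>') * (phi (i' + 2) m * (cst c * Y)))"
    proof (rule fam_span_single)
      show "even (i' + j + (\<kappa> + \<kappa>'))" using * ** by presburger
      show "i' + 2 \<le> j + (\<kappa> + \<kappa>')" if b using *(2) **(2) that by simp
      show "tau_filt b n (cst c * Y)" by (rule tau_filt_scale) fact
    qed
    then show "phi_span b j n (\<lambda>m. of_nat m ^ \<kappa> * (of_nat m ^ \<kappa>' * (phi (i' + 2) m * Y') * Y))"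
      by (simp add: Y' power_add mult_ac)
  qed (simp_all add: algebra_simps)
qed simp_all

lemma psi_phi_span_supported: "psi_phi_span b j n \<Phi> \<Longrightarrow> supported m (\<Phi> m)"
proof (induction rule: fam_span.induct)
  case (fam_span_step \<Phi> i \<kappa> Y)
  have "supported m (phi 2 m * (of_nat m ^ \<kappa> * psi m ^ i * Y))"
    by (simp add: supported_mult)
  then show ?case using fam_span_step by (intro supported_add) (simp_all add: psi_phi_def mult_ac)
qed simp

text \<open>A term m^\<kappa> phi_{i+2} Y becomes \<open>tau (k + \<kappa>) (i + 2) * Y\<close>; the
  assumptions on j and k are what puts this index into \<open>tau_index b\<close>. The extra factor
  raises the level by one.\<close>

lemma tau_filt_part_sum:
  assumes "psi_phi_span b j n \<Phi>" "even (j + k)" "b \<Longrightarrow> j \<le> k"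
  shows "tau_filt b (Suc n) (part_sum k \<Phi>)"
  using psi_phi_span_imp_phi_span[OF assms(1)]
proof (induction rule: fam_span.induct)
  case fam_span_0
  then show ?case by (simp add: tau_filt_0)
next
  case (fam_span_step \<Phi> i \<kappa> Y)
  have "part_sum k (\<lambda>m. \<Phi> m + of_nat m ^ \<kappa> * (phi (i + 2) m * Y)) = part_sum k \<Phi> + tau (k + \<kappa>) (i + 2) * Y"
    by (simp only: part_sum_add part_sum_of_nat_power part_sum_phi_mult)
  moreover have "(k + \<kappa>, i + 2) \<in> tau_index b"
    using fam_span_step.hyps(2,3) assms(2,3) unfolding tau_index_def by auto
  ultimately show ?case
    using fam_span_step by (auto intro!: tau_filt_add tau_filt_tau)
qed

text \<open>Each derivative reverses parity and raises the degree by one, hence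
  \<open>Suc j\<close>. The derivatives of the coefficients enter as a hypothesis: for constants
  they vanish, and for general levels they are available only from
  \<open>psi_phi_span_part_deriv_tau_filt\<close>, whose proof relies on the present lemma at level
  1.\<close>

lemma psi_span_part_deriv:
  assumes "\<And>Y. tau_filt b n Y \<Longrightarrow> psi_phi_span b 1 n (\<lambda>m. part_deriv m Y)" "psi_span b j n \<Phi>"
  shows "psi_phi_span b (Suc j) n (\<lambda>m. part_deriv m (\<Phi> m))"
  using assms(2)
proof (rule fam_span_map[where t = part_deriv])
  fix i \<kappa> Y assume *: "even (i + j + \<kappa>)" "b \<Longrightarrow> i + 0 \<le> j + \<kappa>" "tau_filt b n Y"
  have 1: "psi_phi_span b (1 + j) n (\<lambda>m. of_nat m ^ \<kappa> * (psi m ^ i * part_deriv m Y))"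
    using assms(1)[OF *(3)] by (rule fam_span_psi_mult) (use * in auto)
  have 2: "psi_phi_span b (Suc j) n (\<lambda>m. of_nat m ^ \<kappa> * (of_nat i * psi_phi (i - 1) m * Y))"
  proof (cases i)
    case 0
    then show ?thesis by (simp add: fam_span_0)
  next
    case (Suc i')
    have "psi_phi_span b (Suc j) n (\<lambda>m. cst (of_nat i) * (of_nat m ^ \<kappa> * (psi_phi i' m * Y)))"
      by (intro fam_span_cst fam_span_single) (use * Suc in auto)
    then show ?thesis by (simp add: Suc cst_of_nat mult_ac del: of_nat_Suc)
  qed
  have "part_deriv m (of_nat m ^ \<kappa> * (psi m ^ i * Y))
      = of_nat m ^ \<kappa> * (psi m ^ i * part_deriv m Y) + of_nat m ^ \<kappa> * (of_nat i * psi_phi (i - 1) m * Y)" for m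
    unfolding part_deriv_of_nat_power_mult by (simp add: part_deriv_mult part_deriv_psi_power psi_phi_def algebra_simps)
  then show "psi_phi_span b (Suc j) n (\<lambda>m. part_deriv m (of_nat m ^ \<kappa> * (psi m ^ i * Y)))"
    using fam_span_add[OF 1[simplified] 2] by simp
qed (simp_all add: part_deriv_add)

lemma part_deriv_tau_filt_1: "tau_filt b 1 Y \<Longrightarrow> part_deriv m Y = 0"
  using tau_filt_eq_cst by fastforce

text \<open>These are the iterated derivatives of \<open>phi 2\<close>; each one raises the degree
  in \<open>psi\<close> by one and reverses its parity.\<close>

lemma psi_phi_span_phi: "psi_phi_span True (l + 2) 1 (phi (l + 2))"
proof (induction l)
  case 0
  have "psi_phi_span True 2 1 (\<lambda>m. of_nat m ^ 0 * (psi_phi 0 m * cst 1))"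
    by (rule fam_span_single) (use tau_filt_cst[of True 0 1] in auto)
  moreover have "psi_phi 0 = phi 2" by (simp add: psi_phi_def fun_eq_iff)
  ultimately show ?case by (simp add: numeral_2_eq_2)
next
  case (Suc l)
  have "psi_phi_span True (Suc (l + 2)) 1 (\<lambda>m. part_deriv m (phi (l + 2) m))"
    by (rule psi_span_part_deriv[OF _ psi_phi_span_imp_psi_span[OF Suc]]) (simp add: part_deriv_tau_filt_1 fam_span_0)
  then show ?case by (simp add: part_deriv_phi)
qed

text \<open>Differentiating the factor \<open>tau k l\<close> replaces it by m^k phi_{l+1}, which
  costs one level. Its degree l + 1 in \<open>psi\<close> is at most 1 + k when
  \<open>l \<le> k\<close>, and (l + 1) + 1 + k is even, whence j = 1.\<close>

lemma psi_phi_span_part_deriv_tau_filt: "tau_filt b n' X \<Longrightarrow> psi_phi_span b 1 (n' - 1) (\<lambda>m. part_deriv m X)"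
proof (induction rule: tau_filt.induct)
  case (tau_filt_tau k l n X)
  have l: "1 \<le> l" "even (k + l)" "b \<Longrightarrow> l \<le> k" using tau_filt_tau.hyps(1) by (auto simp: tau_index_def)
  show ?case
  proof (cases n)
    case 0
    then have "X = 0" using tau_filt_eq_0 tau_filt_tau.hyps by blast
    then show ?thesis by (simp add: fam_span_0)
  next
    case (Suc n')
    have 1: "psi_phi_span b 1 n (\<lambda>m. tau k l * part_deriv m X)"
      using fam_span_tau[OF tau_filt_tau.IH tau_filt_tau.hyps(1)] by (simp add: Suc)
    have "psi_phi_span True (Suc l) 1 (phi (Suc l))"
      using psi_phi_span_phi[of "l - 1"] l(1) by simp
    then have 2: "psi_phi_span b 1 n (\<lambda>m. of_nat m ^ k * (phi (Suc l) m * X))"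
    proof (rule fam_span_map[where t = "\<lambda>m x. of_nat m ^ k * (x * X)"])
      fix i \<kappa> Y assume *: "even (i + Suc l + \<kappa>)" "True \<Longrightarrow> i + 2 \<le> Suc l + \<kappa>" "tau_filt True 1 Y"
      then obtain c where Y: "Y = cst c" using tau_filt_eq_cst by blast
      have "psi_phi_span b 1 n (\<lambda>m. of_nat m ^ (k + \<kappa>) * (psi_phi i m * (cst c * X)))"
      proof (rule fam_span_single)
        show "even (i + 1 + (k + \<kappa>))" using *(1) l(2) by presburger
        show "i + 2 \<le> 1 + (k + \<kappa>)" if b using *(2) l(3) that by simp
      qed (rule tau_filt_scale, fact)
      then show "psi_phi_span b 1 n (\<lambda>m. of_nat m ^ k * (of_nat m ^ \<kappa> * (psi_phi i m * Y) * X))"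
        by (simp add: Y power_add mult_ac)
    qed (simp_all add: algebra_simps)
    have "part_deriv m (tau k l * X) = of_nat m ^ k * (phi (Suc l) m * X) + tau k l * part_deriv m X" for m
      by (simp add: part_deriv_mult part_deriv_tau[OF l(1)] mult.assoc)
    then show ?thesis using fam_span_add[OF 2 1] by simp
  qed
qed (auto simp: part_deriv_add part_deriv_cst_mult intro: fam_span_0 fam_span_add fam_span_cst)

text \<open>On u-brackets Theta m is pointwise multiplication by r_m + 1/2, which is odd for the parity above.\<close>

definition Theta :: "nat \<Rightarrow> useries \<Rightarrow> useries" where
  "Theta m X = part_deriv m X + psi m * X"

text \<open>By \<open>part_deriv_ones\<close>, moving the derivation past \<open>ones\<close> adds
  \<open>phi 1 m\<close>, and together with 1/2 this is \<open>psi m\<close>.\<close>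

lemma part_deriv_plus_half_ones: "part_deriv m (ones * X) + cst (1 / 2) * (ones * X) = ones * Theta m X"
  by (simp add: part_deriv_mult part_deriv_ones Theta_def psi_def algebra_simps)

lemma coeff_Theta_power:
  "coeff_u (ones * (Theta m ^^ j) X) p = (of_nat (mult_r m p) + 1 / 2) ^ j * coeff_u (ones * X) p"
proof (induction j)
  case (Suc j)
  have "coeff_u (ones * (Theta m ^^ Suc j) X) p
      = (of_nat (mult_r m p) + 1 / 2) * coeff_u (ones * (Theta m ^^ j) X) p"
    by (simp flip: part_deriv_plus_half_ones add: distrib_right)
  with Suc show ?case by simp
qed simp

text \<open>For l at least 2, the Faulhaber polynomial of degree l is a combination of s^j (s^2 - 1/4) with j and l
  of the same parity, where s = r + 1/2; theta_quad j m is the operator of multiplication by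
  this polynomial, and the factor s^2 - 1/4 makes it divisible by u_m.\<close>

definition theta_quad :: "nat \<Rightarrow> nat \<Rightarrow> useries \<Rightarrow> useries" where
  "theta_quad j m X = (Theta m ^^ (j + 2)) X - cst (1 / 4) * (Theta m ^^ j) X"

definition centred_quad :: "nat \<Rightarrow> nat \<Rightarrow> rat" where
  "centred_quad j r = (of_nat r + 1 / 2) ^ j * ((of_nat r + 1 / 2)\<^sup>2 - 1 / 4)"

lemma coeff_theta_quad: "coeff_u (ones * theta_quad j m X) p = centred_quad j (mult_r m p) * coeff_u (ones * X) p"
  unfolding theta_quad_def centred_quad_def right_diff_distrib mult.left_commute[of ones "cst _"] coeff_u_simps
    coeff_u_cst_mult coeff_Theta_power power_add
  by (simp add: algebra_simps)

text \<open>In the Leibniz expansion of \<open>(Theta m ^^ j) X\<close>, this is the coefficient of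
  the only term in which X is not differentiated.\<close>

definition theta_one :: "nat \<Rightarrow> nat \<Rightarrow> useries" where
  "theta_one j m = (Theta m ^^ j) 1"

lemma psi_span_theta_one: "psi_span True j 1 (theta_one j)"
proof (induction j)
  case 0
  have "psi_span True 0 1 (\<lambda>m. of_nat m ^ 0 * (psi m ^ 0 * cst 1))"
    by (rule fam_span_single) (use tau_filt_cst[of True 0 1] in auto)
  then show ?case by (simp add: theta_one_def)
next
  case (Suc j)
  have "psi_phi_span True (Suc j) 1 (\<lambda>m. part_deriv m (theta_one j m))"
    by (rule psi_span_part_deriv[OF _ Suc]) (simp add: part_deriv_tau_filt_1 fam_span_0)
  then have "psi_span True (Suc j) 1 (\<lambda>m. part_deriv m (theta_one j m) + psi m * theta_one j m)"
    by (intro fam_span_add psi_span_psi Suc psi_phi_span_imp_psi_span)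
  then show ?case by (simp add: theta_one_def[abs_def] Theta_def)
qed

lemma psi_span_mult_psi_phi_span:
  assumes "psi_span True j 1 A" "psi_phi_span b j' n \<Phi>"
  shows "psi_phi_span b (j' + j) n (\<lambda>m. A m * \<Phi> m)"
  using assms(1)
proof (rule fam_span_map[where t = "\<lambda>m x. x * \<Phi> m"])
  fix i \<kappa> Y assume *: "even (i + j + \<kappa>)" "True \<Longrightarrow> i + 0 \<le> j + \<kappa>" "tau_filt True 1 Y"
  then obtain c where Y: "Y = cst c" using tau_filt_eq_cst by blast
  have "psi_phi_span b (j' + j) n (\<lambda>m. cst c * (of_nat m ^ \<kappa> * (psi m ^ i * \<Phi> m)))"
    by (intro fam_span_cst fam_span_psi_mult assms(2)) (use * in auto)
  then show "psi_phi_span b (j' + j) n (\<lambda>m. of_nat m ^ \<kappa> * (psi m ^ i * Y) * \<Phi> m)"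
    by (simp add: Y mult_ac)
qed (simp_all add: algebra_simps)

lemma psi_phi_span_part_deriv_TT': "tau_filt b n Y \<Longrightarrow> psi_phi_span b 1 n (\<lambda>m. part_deriv m Y)"
  by (rule fam_span_mono[OF psi_phi_span_part_deriv_tau_filt]) auto

text \<open>Every term left after removing \<open>theta_one j m * X\<close> contains a derivative of
  X, whose coefficients have one factor fewer.\<close>

lemma psi_span_Theta_power:
  assumes "tau_filt b (Suc n) X"
  shows "psi_span b j n (\<lambda>m. (Theta m ^^ j) X - theta_one j m * X)"
proof (induction j)
  case 0
  then show ?case by (simp add: theta_one_def fam_span_0)
next
  case (Suc j)
  let ?R = "\<lambda>m. (Theta m ^^ j) X - theta_one j m * X"
  have "psi_phi_span b (1 + j) n (\<lambda>m. theta_one j m * part_deriv m X)"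
    by (rule psi_span_mult_psi_phi_span[OF psi_span_theta_one]) (use psi_phi_span_part_deriv_tau_filt[OF assms] in simp)
  then have "psi_span b (Suc j) n (\<lambda>m. theta_one j m * part_deriv m X + part_deriv m (?R m) + psi m * ?R m)"
    using psi_phi_span_imp_psi_span[OF psi_span_part_deriv[OF psi_phi_span_part_deriv_TT' Suc]] psi_span_psi[OF Suc]
    by (intro fam_span_add) (auto dest: psi_phi_span_imp_psi_span)
  moreover have "(Theta m ^^ Suc j) X - theta_one (Suc j) m * X = theta_one j m * part_deriv m X + part_deriv m (?R m) + psi m * ?R m" for m
    by (simp add: theta_one_def Theta_def part_deriv_diff part_deriv_mult algebra_simps)
  ultimately show ?case by simp
qed

text \<open>The constant 1/4 is chosen so that X itself survives only with a factor
  \<open>phi 2 m\<close>; the other terms contain a derivative.\<close>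

lemma Theta_Theta: "Theta m (Theta m X) - cst (1 / 4) * X = part_deriv m (part_deriv m X) + cst 2 * (psi m * part_deriv m X) + cst 2 * (phi 2 m * X)"
proof -
  have "cst 2 = 1 + 1" by (simp flip: cst_add cst_1)
  then show ?thesis by (simp add: Theta_def part_deriv_add part_deriv_mult part_deriv_psi phi_2_psi power2_eq_square algebra_simps)
qed

text \<open>The difference contains X only in differentiated form, which lowers the level, and
  \<open>Theta_Theta\<close> keeps every term a multiple of \<open>phi 2 m\<close>, as summation
  over m requires.\<close>

lemma psi_phi_span_theta_quad:
  assumes "tau_filt b (Suc n) X"
  shows "psi_phi_span b (j + 2) n (\<lambda>m. theta_quad j m X - theta_quad j m 1 * X)"
proof -
  define A where "A = theta_one j"
  define R where "R m = (Theta m ^^ j) X - A m * X" for m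
  have R: "psi_span b j n R" using psi_span_Theta_power[OF assms] by (simp add: R_def[abs_def] A_def)
  have A: "psi_span True j 1 A" unfolding A_def by (rule psi_span_theta_one)
  have DA: "psi_span True (Suc j) 1 (\<lambda>m. part_deriv m (A m))"
    by (rule psi_phi_span_imp_psi_span, rule psi_span_part_deriv[OF _ A]) (simp add: part_deriv_tau_filt_1 fam_span_0)
  have DX: "psi_phi_span b 1 n (\<lambda>m. part_deriv m X)" using psi_phi_span_part_deriv_tau_filt[OF assms] by simp
  have DDX: "psi_phi_span b 2 n (\<lambda>m. part_deriv m (part_deriv m X))"
    using psi_span_part_deriv[OF psi_phi_span_part_deriv_TT' psi_phi_span_imp_psi_span[OF DX]] by (simp add: numeral_2_eq_2)
  have DR: "psi_phi_span b (Suc j) n (\<lambda>m. part_deriv m (R m))"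
    by (rule psi_span_part_deriv[OF psi_phi_span_part_deriv_TT' R])
  have DDR: "psi_phi_span b (Suc (Suc j)) n (\<lambda>m. part_deriv m (part_deriv m (R m)))"
    by (rule psi_span_part_deriv[OF psi_phi_span_part_deriv_TT' psi_phi_span_imp_psi_span[OF DR]])
  have psi: "psi_phi_span b (Suc j') n (\<lambda>m. psi m * \<Phi> m)" if "psi_phi_span b j' n \<Phi>" for j' \<Phi>
    using fam_span_psi_mult[OF that, of 1 1 0] by simp
  have 1: "psi_phi_span b (j + 2) n (\<lambda>m. part_deriv m (A m) * part_deriv m X)"
    using psi_span_mult_psi_phi_span[OF DA DX] by simp
  have 2: "psi_phi_span b (j + 2) n (\<lambda>m. A m * part_deriv m (part_deriv m X))"
    using psi_span_mult_psi_phi_span[OF A DDX] by (simp add: add.commute)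
  have 3: "psi_phi_span b (j + 2) n (\<lambda>m. psi m * (A m * part_deriv m X))"
    using psi[OF psi_span_mult_psi_phi_span[OF A DX]] by simp
  have 4: "psi_phi_span b (j + 2) n (\<lambda>m. psi m * part_deriv m (R m))"
    using psi[OF DR] by simp
  have 5: "psi_phi_span b (j + 2) n (\<lambda>m. phi 2 m * R m)"
    using psi_span_phi_2[OF R] by simp
  have "psi_phi_span b (j + 2) n (\<lambda>m. cst 2 * (part_deriv m (A m) * part_deriv m X) + A m * part_deriv m (part_deriv m X) + cst 2 * (psi m * (A m * part_deriv m X))
     + part_deriv m (part_deriv m (R m)) + cst 2 * (psi m * part_deriv m (R m)) + cst 2 * (phi 2 m * R m))"
    using DDR by (intro fam_span_add fam_span_cst 1 2 3 4 5) simp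
  \<comment> \<open>Apply \<open>Theta_Theta\<close> to \<open>A m * X + R m\<close>; outside
    \<open>R m\<close>, the terms with X undifferentiated make up
    \<open>theta_quad j m 1 * X\<close>.\<close>
  moreover have "theta_quad j m X - theta_quad j m 1 * X = cst 2 * (part_deriv m (A m) * part_deriv m X) + A m * part_deriv m (part_deriv m X) + cst 2 * (psi m * (A m * part_deriv m X))
     + part_deriv m (part_deriv m (R m)) + cst 2 * (psi m * part_deriv m (R m)) + cst 2 * (phi 2 m * R m)" for m
  proof -
    have "cst 2 = 1 + 1" by (simp flip: cst_add cst_1)
    have N: "theta_quad j m Y = Theta m (Theta m ((Theta m ^^ j) Y)) - cst (1 / 4) * (Theta m ^^ j) Y" for Y
      by (simp add: theta_quad_def)
    have "(Theta m ^^ j) X = A m * X + R m" "(Theta m ^^ j) 1 = A m"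
      by (simp_all add: R_def A_def theta_one_def)
    then show ?thesis unfolding N Theta_Theta
      by (simp add: part_deriv_add part_deriv_mult \<open>cst 2 = 1 + 1\<close> algebra_simps)
  qed
  ultimately show ?thesis by simp
qed

section \<open>Faulhaber polynomials in the centred variable r + 1/2\<close>

lemma faulhaber_0 [simp]: "faulhaber l 0 = 0" by (simp add: faulhaber_def)

lemma faulhaber_Suc: "faulhaber l (Suc r) = faulhaber l r + of_nat (Suc r) ^ (l - 1)"
  by (simp add: faulhaber_def)

definition centred_span :: "nat \<Rightarrow> (nat \<Rightarrow> rat) \<Rightarrow> bool" where
  "centred_span l f \<longleftrightarrow> (\<exists>c. \<forall>r. f r = (\<Sum>i | i + 2 \<le> l \<and> even (i + l). c i * centred_quad i r))"

lemma finite_idx [simp]: "finite {i. i + 2 \<le> (l :: nat) \<and> P i}"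
  by (rule finite_subset[of _ "{..l}"]) auto

lemma centred_span_0: "centred_span l (\<lambda>r. 0)"
  unfolding centred_span_def by (rule exI[of _ "\<lambda>i. 0"]) simp

lemma centred_span_add: "centred_span l f \<Longrightarrow> centred_span l g \<Longrightarrow> centred_span l (\<lambda>r. f r + g r)"
proof (unfold centred_span_def, elim exE)
  fix c d
  assume "\<forall>r. f r = (\<Sum>i | i + 2 \<le> l \<and> even (i + l). c i * centred_quad i r)"
    "\<forall>r. g r = (\<Sum>i | i + 2 \<le> l \<and> even (i + l). d i * centred_quad i r)"
  then show "\<exists>c. \<forall>r. f r + g r = (\<Sum>i | i + 2 \<le> l \<and> even (i + l). c i * centred_quad i r)"
    by (intro exI[of _ "\<lambda>i. c i + d i"]) (simp add: distrib_right sum.distrib)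
qed

lemma centred_span_scale: "centred_span l f \<Longrightarrow> centred_span l (\<lambda>r. a * f r)"
proof (unfold centred_span_def, elim exE)
  fix c
  assume "\<forall>r. f r = (\<Sum>i | i + 2 \<le> l \<and> even (i + l). c i * centred_quad i r)"
  then show "\<exists>c. \<forall>r. a * f r = (\<Sum>i | i + 2 \<le> l \<and> even (i + l). c i * centred_quad i r)"
    by (intro exI[of _ "\<lambda>i. a * c i"]) (simp add: mult.assoc sum_distrib_left)
qed

lemma centred_span_sum: "(\<And>x. x \<in> A \<Longrightarrow> centred_span l (f x)) \<Longrightarrow> centred_span l (\<lambda>r. \<Sum>x\<in>A. f x r)"
  by (induction A rule: infinite_finite_induct) (auto intro: centred_span_0 centred_span_add)

lemma centred_span_centred_quad: "i + 2 \<le> l \<Longrightarrow> even (i + l) \<Longrightarrow> centred_span l (centred_quad i)"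
  unfolding centred_span_def
proof (intro exI allI)
  fix r
  assume i: "i + 2 \<le> l" "even (i + l)"
  have "(\<Sum>j | j + 2 \<le> l \<and> even (j + l). (if j = i then 1 else 0) * centred_quad j r)
      = (\<Sum>j | j + 2 \<le> l \<and> even (j + l). if j = i then centred_quad j r else 0)"
    by (rule sum.cong) auto
  also have "\<dots> = centred_quad i r" using i by (subst sum.delta[OF finite_idx]) simp
  finally show "centred_quad i r = (\<Sum>j | j + 2 \<le> l \<and> even (j + l). (if j = i then 1 else 0) * centred_quad j r)" ..
qed

lemma centred_span_mono:
  assumes "centred_span l f" "l \<le> l'" "even (l + l')"
  shows "centred_span l' f"
proof -
  obtain c where c: "\<And>r. f r = (\<Sum>i | i + 2 \<le> l \<and> even (i + l). c i * centred_quad i r)"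
    using assms(1) by (auto simp: centred_span_def)
  have "centred_span l' (\<lambda>r. \<Sum>i | i + 2 \<le> l \<and> even (i + l). c i * centred_quad i r)"
  proof (intro centred_span_sum centred_span_scale centred_span_centred_quad)
    fix i assume "i \<in> {i. i + 2 \<le> l \<and> even (i + l)}"
    then show "i + 2 \<le> l'" using assms(2) by simp
    show "even (i + l')" using \<open>i \<in> _\<close> assms(3) by simp
  qed
  moreover have "f = (\<lambda>r. \<Sum>i | i + 2 \<le> l \<and> even (i + l). c i * centred_quad i r)"
    using c by (simp add: fun_eq_iff)
  ultimately show ?thesis by (simp only:)
qed

text \<open>With x = r + 1 the centred variable is x + 1/2 at r + 1 and x - 1/2 at r, and its square
  minus 1/4 is x^2 + x and x^2 - x. The difference is x times a polynomial in x with the parity of j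
  and leading coefficient j + 2.\<close>

lemma centred_quad_diff:
  "\<exists>c. \<forall>r. centred_quad j (Suc r) - centred_quad j r = of_nat (j + 2) * of_nat (Suc r) ^ (j + 1)
     + (\<Sum>t | t < j \<and> even (t + j). c t * of_nat (Suc r) ^ (t + 1))"
proof -
  define h where "h = (1 / 2 :: rat)"
  define a where "a t = of_nat (j choose t) * h ^ (j - t)" for t
  define a' where "a' t = (if t = 0 then 0 else a (t - 1))" for t
  define \<sigma> where "\<sigma> t = (- 1 :: rat) ^ (j - t)" for t
  show ?thesis
  proof (rule exI[of _ "\<lambda>t. 2 * (a' t + a t)"], rule allI)
    fix r
    define x where "x = (of_nat (Suc r) :: rat)"
    have plus: "(x + h) ^ j = (\<Sum>t\<le>j. a t * x ^ t)"
      using binomial_ring[of x h j] by (simp add: a_def mult_ac)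
    have minus: "(x - h) ^ j = (\<Sum>t\<le>j. \<sigma> t * a t * x ^ t)"
      using binomial_ring[of x "- h" j] by (simp add: a_def \<sigma>_def mult_ac power_minus[of h])
    have "centred_quad j (Suc r) = (x + h) ^ j * (x * x + x)"
      unfolding centred_quad_def x_def h_def by (simp add: power2_eq_square field_simps del: of_nat_Suc)
    moreover have "centred_quad j r = (x - h) ^ j * (x * x - x)"
      unfolding centred_quad_def x_def h_def by (simp add: power2_eq_square field_simps)
    ultimately have "centred_quad j (Suc r) - centred_quad j r = x * (x * ((x + h) ^ j - (x - h) ^ j) + ((x + h) ^ j + (x - h) ^ j))"
      by (simp add: algebra_simps)
    also have "x * ((x + h) ^ j - (x - h) ^ j) = (\<Sum>t\<le>j. (1 - \<sigma> t) * a t * x ^ Suc t)"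
      unfolding plus minus sum_subtractf[symmetric] sum_distrib_left
      by (rule sum.cong) (simp_all add: algebra_simps)
    also have "\<dots> = (\<Sum>t<j. (1 - \<sigma> t) * a t * x ^ Suc t)"
      by (simp add: lessThan_Suc_atMost[symmetric] \<sigma>_def)
    \<comment> \<open>Since \<sigma> changes sign with each step in t, the shift to exponent t + 1
      gives both sums the common factor 1 + \<sigma> t, which selects the parity of j.\<close>
    also have "\<dots> = (\<Sum>t<j. (1 + \<sigma> (Suc t)) * a' (Suc t) * x ^ Suc t)"
    proof (rule sum.cong[OF refl])
      fix t assume "t \<in> {..<j}"
      then have "j - t = Suc (j - Suc t)" by auto
      then show "(1 - \<sigma> t) * a t * x ^ Suc t = (1 + \<sigma> (Suc t)) * a' (Suc t) * x ^ Suc t"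
        by (simp add: \<sigma>_def a'_def)
    qed
    also have "\<dots> = (\<Sum>t\<le>j. (1 + \<sigma> t) * a' t * x ^ t)"
      by (simp add: sum.atMost_shift a'_def)
    also have "(x + h) ^ j + (x - h) ^ j = (\<Sum>t\<le>j. (1 + \<sigma> t) * a t * x ^ t)"
      unfolding plus minus sum.distrib[symmetric]
      by (rule sum.cong) (simp_all add: algebra_simps)
    also have "(\<Sum>t\<le>j. (1 + \<sigma> t) * a' t * x ^ t) + (\<Sum>t\<le>j. (1 + \<sigma> t) * a t * x ^ t)
        = (\<Sum>t\<le>j. (1 + \<sigma> t) * (a' t + a t) * x ^ t)"
      by (simp add: sum.distrib[symmetric] algebra_simps)
    also have "\<dots> = (\<Sum>t<j. (1 + \<sigma> t) * (a' t + a t) * x ^ t) + 2 * (a' j + a j) * x ^ j"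
      by (simp add: lessThan_Suc_atMost[symmetric] \<sigma>_def)
    \<comment> \<open>Here \<open>a j\<close> is 1 and \<open>a' j\<close> is j/2.\<close>
    also have "2 * (a' j + a j) = of_nat (j + 2)"
      by (cases j) (simp_all add: a'_def a_def h_def field_simps)
    also have "(\<Sum>t<j. (1 + \<sigma> t) * (a' t + a t) * x ^ t) = (\<Sum>t | t < j \<and> even (t + j). 2 * (a' t + a t) * x ^ t)"
      by (rule sum.mono_neutral_cong_right) (auto simp: \<sigma>_def)
    finally show "centred_quad j (Suc r) - centred_quad j r = of_nat (j + 2) * of_nat (Suc r) ^ (j + 1)
       + (\<Sum>t | t < j \<and> even (t + j). 2 * (a' t + a t) * of_nat (Suc r) ^ (t + 1))"
      by (simp add: x_def[symmetric] distrib_left sum_distrib_left mult_ac del: of_nat_Suc)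
  qed
qed

text \<open>Summing \<open>centred_quad_diff\<close> from 0 to r expresses
  \<open>centred_quad (l - 2)\<close> as l F_l plus multiples of F_{t+2} with t + 2 < l of the same
  parity; both sides vanish at 0. Induction then solves for F_l.\<close>

lemma centred_span_faulhaber:
  assumes "l \<ge> 2"
  shows "centred_span l (faulhaber l)"
  using assms
proof (induction l rule: less_induct)
  case (less l)
  define j where "j = l - 2"
  have l: "l = j + 2" using less.prems by (simp add: j_def)
  obtain c where c: "\<And>r. centred_quad j (Suc r) - centred_quad j r = of_nat (j + 2) * of_nat (Suc r) ^ (j + 1)
     + (\<Sum>t | t < j \<and> even (t + j). c t * of_nat (Suc r) ^ (t + 1))"
    using centred_quad_diff by blast
  have eq: "centred_quad j r = of_nat (j + 2) * faulhaber (j + 2) r + (\<Sum>t | t < j \<and> even (t + j). c t * faulhaber (t + 2) r)" for r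
  proof (induction r)
    case 0
    then show ?case by (simp add: centred_quad_def power2_eq_square)
  next
    case (Suc r)
    have "centred_quad j (Suc r) = centred_quad j r + (of_nat (j + 2) * of_nat (Suc r) ^ (j + 1)
     + (\<Sum>t | t < j \<and> even (t + j). c t * of_nat (Suc r) ^ (t + 1)))"
      using c[of r] by (simp only: diff_eq_eq add.commute)
    also have "\<dots> = of_nat (j + 2) * (faulhaber (j + 2) r + of_nat (Suc r) ^ (j + 1))
      + (\<Sum>t | t < j \<and> even (t + j). c t * (faulhaber (t + 2) r + of_nat (Suc r) ^ (t + 1)))"
      unfolding Suc by (simp add: distrib_left sum.distrib del: of_nat_Suc of_nat_add)
    finally show ?case by (simp add: faulhaber_Suc del: of_nat_Suc of_nat_add)
  qed
  have "faulhaber l r = (1 / of_nat l) * (centred_quad j r + (- 1) * (\<Sum>t | t < j \<and> even (t + j). c t * faulhaber (t + 2) r))" for r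
    using eq[of r] by (simp add: l)
  moreover have "centred_span l (\<lambda>r. (1 / of_nat l) * (centred_quad j r + (- 1) * (\<Sum>t | t < j \<and> even (t + j). c t * faulhaber (t + 2) r)))"
  proof (intro centred_span_scale centred_span_add centred_span_sum)
    fix t assume "t \<in> {t. t < j \<and> even (t + j)}"
    then have t: "t + 2 < l" "2 \<le> t + 2" "t + 2 \<le> l" "even (t + 2 + l)" by (auto simp: l)
    show "centred_span l (faulhaber (t + 2))"
      by (rule centred_span_mono[OF less.IH[OF t(1,2)] t(3,4)])
  next
    show "centred_span l (centred_quad j)" by (rule centred_span_centred_quad) (simp_all add: l)
  qed
  ultimately show ?case by presburger
qed

lemma faulhaber_1: "faulhaber 1 r = of_nat r"
  by (simp add: faulhaber_def)

text \<open>Multiplication by F_l is carried through the bracket by \<open>theta_quad\<close>. The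
  case l = 1 is separate, since F_1(r) = r is not odd in r + 1/2; there the remainder is just
  \<open>part_deriv m X\<close>.\<close>

lemma coeff_faulhaber_mult:
  assumes "tau_filt b (Suc n) X" "l \<ge> 1"
  shows "\<exists>R. psi_phi_span b l n R \<and> (\<forall>m p. faulhaber l (mult_r m p) * coeff_u (ones * X) p = coeff_u (ones * (phi l m * X + R m)) p)"
proof (cases "l = 1")
  case True
  show ?thesis
  proof (intro exI[of _ "\<lambda>m. part_deriv m X"] conjI allI)
    show "psi_phi_span b l n (\<lambda>m. part_deriv m X)" using psi_phi_span_part_deriv_tau_filt[OF assms(1)] True by simp
    fix m p
    have "ones * (phi l m * X + part_deriv m X) = part_deriv m (ones * X)"
      by (simp add: part_deriv_mult part_deriv_ones True algebra_simps)
    then show "faulhaber l (mult_r m p) * coeff_u (ones * X) p = coeff_u (ones * (phi l m * X + part_deriv m X)) p"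
      by (simp add: True faulhaber_1[simplified])
  qed
next
  case False
  then obtain c where c: "\<And>r. faulhaber l r = (\<Sum>i | i + 2 \<le> l \<and> even (i + l). c i * centred_quad i r)"
    using assms(2) centred_span_faulhaber[of l] by (auto simp: centred_span_def)
  let ?I = "{i. i + 2 \<le> l \<and> even (i + l)}"
  have N: "coeff_u (ones * (\<Sum>i\<in>?I. cst (c i) * theta_quad i m Y)) p = faulhaber l (mult_r m p) * coeff_u (ones * Y) p" for m Y p
    by (simp add: sum_distrib_left mult.left_commute[of ones "cst _"] coeff_theta_quad c sum_distrib_right mult.assoc)
  define R where "R m = (\<Sum>i\<in>?I. cst (c i) * (theta_quad i m X - theta_quad i m 1 * X))" for m
  \<comment> \<open>Taking X = 1 identifies the leading coefficient: its product with
    \<open>ones\<close> has the coefficients F_l(r_m), as does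
    \<open>ones * phi l m\<close>.\<close>
  have one: "(\<Sum>i\<in>?I. cst (c i) * theta_quad i m 1) = phi l m" for m
  proof -
    have "ones * (\<Sum>i\<in>?I. cst (c i) * theta_quad i m 1) = ones * phi l m"
      by (rule useries_eqI) (simp only: N coeff_phi_mult_ones, simp)
    then show ?thesis by (simp only: ones_cancel)
  qed
  show ?thesis
  proof (intro exI[of _ R] conjI allI)
    show "psi_phi_span b l n R"
      unfolding R_def
    proof (intro fam_span_sum fam_span_cst)
      fix i assume i: "i \<in> ?I"
      have "psi_phi_span b (i + 2) n (\<lambda>m. theta_quad i m X - theta_quad i m 1 * X)" by (rule psi_phi_span_theta_quad) fact
      then show "psi_phi_span b l n (\<lambda>m. theta_quad i m X - theta_quad i m 1 * X)"
        by (rule fam_span_map[where t = "\<lambda>m x. x"])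
           (use i in \<open>auto intro!: fam_span_single\<close>)
    qed
    fix m p
    have "phi l m * X + R m = (\<Sum>i\<in>?I. cst (c i) * theta_quad i m X)"
      unfolding R_def one[symmetric] by (simp add: sum_distrib_right right_diff_distrib sum_subtractf mult.assoc)
    then show "faulhaber l (mult_r m p) * coeff_u (ones * X) p = coeff_u (ones * (phi l m * X + R m)) p"
      by (simp only: N)
  qed
qed

text \<open>To leading order in the number of factors, the pointwise and the induced product with T_{k,l} agree.\<close>

lemma ubracket_Pfun_mult:
  assumes "tau_filt b (Suc n) (ubracket f)" "(k, l) \<in> tau_index b"
  shows "\<exists>R. tau_filt b (Suc n) R \<and> ubracket (\<lambda>p. Pfun k l p * f p) = tau k l * ubracket f + R"
proof -
  have l: "l \<ge> 1" "even (l + k)" "b \<Longrightarrow> l \<le> k" using assms(2) by (auto simp: tau_index_def)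
  obtain R where R: "psi_phi_span b l n R"
    "\<And>m p. faulhaber l (mult_r m p) * coeff_u (ones * ubracket f) p = coeff_u (ones * (phi l m * ubracket f + R m)) p"
    using coeff_faulhaber_mult[OF assms(1) l(1)] by blast
  show ?thesis
  proof (intro exI[of _ "part_sum k R"] conjI ubracketI)
    show "tau_filt b (Suc n) (part_sum k R)" by (rule tau_filt_part_sum[OF R(1) l(2,3)])
    have "ones * (tau k l * ubracket f + part_sum k R) = part_sum k (\<lambda>m. phi l m * (ones * ubracket f)) + part_sum k R * ones"
      by (simp only: part_sum_phi_mult distrib_left) (simp only: mult_ac)
    also have "\<dots> = part_sum k (\<lambda>m. phi l m * (ones * ubracket f)) + part_sum k (\<lambda>m. R m * ones)"
      using psi_phi_span_supported[OF R(1)] by (simp add: part_sum_mult)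
    also have "\<dots> = part_sum k (\<lambda>m. ones * (phi l m * ubracket f + R m))"
      unfolding part_sum_add[symmetric] by (simp add: algebra_simps del: ones_ubracket)
    also have "\<dots> = useries (\<lambda>p. Pfun k l p * f p)"
      by (rule useries_eqI) (simp add: coeff_part_sum R(2)[symmetric] Pfun_def sum_distrib_right mult.assoc del: ones_ubracket, simp)
    finally show "ones * (tau k l * ubracket f + part_sum k R) = useries (\<lambda>p. Pfun k l p * f p)" .
  qed
qed

section \<open>The three algebras\<close>

definition lin_closed :: "(partition \<Rightarrow> rat) set \<Rightarrow> bool" where
  "lin_closed C \<longleftrightarrow> (\<lambda>p. 0) \<in> C \<and> (\<forall>f\<in>C. \<forall>g\<in>C. \<forall>c. (\<lambda>p. f p + c * g p) \<in> C)"

lemma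
  assumes "lin_closed C"
  shows lin_closed_0: "(\<lambda>p. 0) \<in> C"
    and lin_closed_step: "f \<in> C \<Longrightarrow> g \<in> C \<Longrightarrow> (\<lambda>p. f p + c * g p) \<in> C"
    and lin_closed_add: "f \<in> C \<Longrightarrow> g \<in> C \<Longrightarrow> (\<lambda>p. f p + g p) \<in> C"
    and lin_closed_diff: "f \<in> C \<Longrightarrow> g \<in> C \<Longrightarrow> (\<lambda>p. f p - g p) \<in> C"
    and lin_closed_scale: "g \<in> C \<Longrightarrow> (\<lambda>p. c * g p) \<in> C"
proof -
  show 0: "(\<lambda>p. 0) \<in> C" and step: "f \<in> C \<Longrightarrow> g \<in> C \<Longrightarrow> (\<lambda>p. f p + c * g p) \<in> C" for f g c
    using assms by (auto simp: lin_closed_def)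
  show "f \<in> C \<Longrightarrow> g \<in> C \<Longrightarrow> (\<lambda>p. f p + g p) \<in> C" using step[of f g 1] by simp
  show "f \<in> C \<Longrightarrow> g \<in> C \<Longrightarrow> (\<lambda>p. f p - g p) \<in> C" using step[of f g "-1"] by simp
  show "g \<in> C \<Longrightarrow> (\<lambda>p. c * g p) \<in> C" using step[OF 0, of g c] by simp
qed

lemma qlin_span_0: "(\<lambda>p. 0) \<in> qlin_span X"
  unfolding qlin_span_def by (auto intro!: exI[of _ "0 :: nat"])

lemma qlin_spanE:
  assumes "f \<in> qlin_span X"
  obtains n c g where "\<forall>i<n. g i \<in> X" "f = (\<lambda>p. \<Sum>i<(n :: nat). c i * g i p)"
  using assms that unfolding qlin_span_def by blast

lemma qlin_span_step:
  assumes "f \<in> qlin_span X" "x \<in> X"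
  shows "(\<lambda>p. f p + c * x p) \<in> qlin_span X"
proof -
  obtain n c' g where n: "\<forall>i<n. g i \<in> X" "f = (\<lambda>p. \<Sum>i<(n :: nat). c' i * g i p)"
    using assms(1) by (rule qlin_spanE)
  show ?thesis unfolding qlin_span_def
    by (intro CollectI exI[of _ "Suc n"] exI[of _ "c'(n := c)"] exI[of _ "g(n := x)"])
       (use n assms(2) in \<open>auto simp: less_Suc_eq\<close>)
qed

lemma qlin_span_induct [consumes 1, case_names zero step]:
  assumes "f \<in> qlin_span X" "P (\<lambda>p. 0)"
    and "\<And>f x c. f \<in> qlin_span X \<Longrightarrow> P f \<Longrightarrow> x \<in> X \<Longrightarrow> P (\<lambda>p. f p + c * x p)"
  shows "P f"
proof -
  obtain n c g where n: "\<forall>i<n. g i \<in> X" "f = (\<lambda>p. \<Sum>i<(n :: nat). c i * g i p)"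
    using assms(1) by (rule qlin_spanE)
  have "P (\<lambda>p. \<Sum>i<n. c i * g i p) \<and> (\<lambda>p. \<Sum>i<n. c i * g i p) \<in> qlin_span X" using n(1)
    by (induction n) (auto intro: assms(2,3) qlin_span_0 qlin_span_step)
  with n show ?thesis by simp
qed

lemma qlin_span_minimal:
  assumes "lin_closed C" "X \<subseteq> C"
  shows "qlin_span X \<subseteq> C"
proof
  fix f assume "f \<in> qlin_span X"
  then show "f \<in> C"
    by (induction rule: qlin_span_induct) (use assms in \<open>auto intro: lin_closed_0 lin_closed_step\<close>)
qed

lemma qlin_span_base: "x \<in> X \<Longrightarrow> x \<in> qlin_span X"
  using qlin_span_step[OF qlin_span_0, of x X 1] by simp

lemma qlin_span_mono: "X \<subseteq> Y \<Longrightarrow> qlin_span X \<subseteq> qlin_span Y"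
  unfolding qlin_span_def by blast

lemma lin_closed_qlin_span [simp]: "lin_closed (qlin_span X)"
  unfolding lin_closed_def
proof (intro conjI qlin_span_0 ballI allI)
  fix f g c
  assume f: "f \<in> qlin_span X" and g: "g \<in> qlin_span X"
  from g show "(\<lambda>p. f p + c * g p) \<in> qlin_span X"
  proof (induction rule: qlin_span_induct)
    case zero
    then show ?case using f by simp
  next
    case (step g x d)
    then show ?case using qlin_span_step[OF step.IH step.hyps(2), of "c * d"] by (simp add: algebra_simps)
  qed
qed

definition linear_op :: "((partition \<Rightarrow> rat) \<Rightarrow> partition \<Rightarrow> rat) \<Rightarrow> bool" where
  "linear_op L \<longleftrightarrow> L (\<lambda>p. 0) = (\<lambda>p. 0) \<and> (\<forall>f g c. L (\<lambda>p. f p + c * g p) = (\<lambda>p. L f p + c * L g p))"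

lemma qlin_span_linear:
  assumes "linear_op L" "lin_closed C" "\<And>x. x \<in> X \<Longrightarrow> L x \<in> C" "f \<in> qlin_span X"
  shows "L f \<in> C"
  using assms(4)
  by (induction rule: qlin_span_induct) (use assms(1-3) in \<open>auto simp: linear_op_def intro: lin_closed_0 lin_closed_step\<close>)

lemma qlin_span_bilinear:
  assumes "\<And>f. linear_op (op f)" "\<And>g. linear_op (\<lambda>f. op f g)" "lin_closed C"
    and "\<And>x y. x \<in> X \<Longrightarrow> y \<in> Y \<Longrightarrow> op x y \<in> C" "f \<in> qlin_span X" "g \<in> qlin_span Y"
  shows "op f g \<in> C"
  by (rule qlin_span_linear[OF assms(2,3) _ assms(5)], rule qlin_span_linear[OF assms(1,3) _ assms(6)])
     (rule assms(4))

abbreviation pmult :: "(partition \<Rightarrow> rat) \<Rightarrow> (partition \<Rightarrow> rat) \<Rightarrow> partition \<Rightarrow> rat" where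
  "pmult f g \<equiv> (\<lambda>p. f p * g p)"

lemma linear_pmult: "linear_op (pmult f)" "linear_op (\<lambda>f. pmult f g)"
  by (simp_all add: linear_op_def algebra_simps)

lemma ubracket_step: "ubracket (\<lambda>p. f p + c * g p) = ubracket f + cst c * ubracket g"
  by (simp only: ubracket_add ubracket_scale)

lemma ubracket_diff: "ubracket (\<lambda>p. f p - g p) = ubracket f - ubracket g"
  using ubracket_step[of f "- 1" g] by (simp add: cst_minus)

lemma ubracket_0 [simp]: "ubracket (\<lambda>p. 0) = 0"
  using ubracket_diff[of one_fun one_fun] by simp

lemma linear_odot: "linear_op (odot f)" "linear_op (\<lambda>f. odot f g)"
  by (simp_all add: linear_op_def ubracket_odot ubracket_step algebra_simps flip: ubracket_inject)

lemma odot_one [simp]: "odot one_fun f = f" "odot f one_fun = f"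
  by (simp_all add: ubracket_odot flip: ubracket_inject)

lemma odot_assoc: "odot (odot f g) h = odot f (odot g h)"
  by (simp add: ubracket_odot mult.assoc flip: ubracket_inject)

section \<open>Algebras generated under the two products\<close>

lemma ptw_monos_Nil: "one_fun \<in> ptw_monos G 0"
  unfolding ptw_monos_def one_fun_def by (rule CollectI, rule exI[of _ "[]"]) simp

lemma ptw_monos_Cons: "(w, g) \<in> G \<Longrightarrow> f \<in> ptw_monos G w' \<Longrightarrow> pmult g f \<in> ptw_monos G (w + w')"
  unfolding ptw_monos_def
  by clarify (rule_tac x = "(w, g) # xs" in exI, simp)

lemma ptw_monos_induct [consumes 1, case_names one mult]:
  assumes "f \<in> ptw_monos G w" "P 0 one_fun"
    "\<And>w g w' f. (w, g) \<in> G \<Longrightarrow> f \<in> ptw_monos G w' \<Longrightarrow> P w' f \<Longrightarrow> P (w + w') (pmult g f)"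
  shows "P w f"
proof -
  obtain xs where xs: "set xs \<subseteq> G" "w = sum_list (map fst xs)" "f = (\<lambda>p. prod_list (map (\<lambda>x. snd x p) xs))"
    using assms(1) by (auto simp: ptw_monos_def)
  have "P (sum_list (map fst xs)) (\<lambda>p. prod_list (map (\<lambda>x. snd x p) xs))" using xs(1)
  proof (induction xs)
    case Nil
    then show ?case using assms(2) by (simp add: one_fun_def)
  next
    case (Cons x xs)
    then have "P (fst x + sum_list (map fst xs)) (pmult (snd x) (\<lambda>p. prod_list (map (\<lambda>x. snd x p) xs)))"
      by (intro assms(3)) (auto simp: ptw_monos_def)
    then show ?case by simp
  qed
  with xs show ?thesis by simp
qed

lemma ptw_monos_gen: "(w, g) \<in> G \<Longrightarrow> g \<in> ptw_monos G w"
  using ptw_monos_Cons[OF _ ptw_monos_Nil, of w g G] by (simp add: one_fun_def)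

lemma ptw_monos_mult:
  "f \<in> ptw_monos G w \<Longrightarrow> g \<in> ptw_monos G w' \<Longrightarrow> pmult f g \<in> ptw_monos G (w + w')"
proof (induction rule: ptw_monos_induct)
  case one
  then show ?case by (simp add: one_fun_def)
next
  case (mult w h w'' f)
  then show ?case using ptw_monos_Cons[OF mult(1) mult(3)] by (simp add: mult_ac add_ac)
qed

lemma odot_monos_Nil: "one_fun \<in> odot_monos G 0"
  unfolding odot_monos_def by (rule CollectI, rule exI[of _ "[]"]) simp

lemma odot_monos_Cons: "(w, g) \<in> G \<Longrightarrow> f \<in> odot_monos G w' \<Longrightarrow> odot g f \<in> odot_monos G (w + w')"
  unfolding odot_monos_def
  by clarify (rule_tac x = "(w, g) # xs" in exI, simp)

lemma odot_monos_induct [consumes 1, case_names one mult]: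
  assumes "f \<in> odot_monos G w" "P 0 one_fun"
    "\<And>w g w' f. (w, g) \<in> G \<Longrightarrow> f \<in> odot_monos G w' \<Longrightarrow> P w' f \<Longrightarrow> P (w + w') (odot g f)"
  shows "P w f"
proof -
  obtain xs where xs: "set xs \<subseteq> G" "w = sum_list (map fst xs)" "f = foldr (\<lambda>x acc. odot (snd x) acc) xs one_fun"
    using assms(1) by (auto simp: odot_monos_def)
  have "P (sum_list (map fst xs)) (foldr (\<lambda>x acc. odot (snd x) acc) xs one_fun)" using xs(1)
  proof (induction xs)
    case Nil
    then show ?case using assms(2) by simp
  next
    case (Cons x xs)
    then have "P (fst x + sum_list (map fst xs)) (odot (snd x) (foldr (\<lambda>x acc. odot (snd x) acc) xs one_fun))"
      by (intro assms(3)) (auto simp: odot_monos_def)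
    then show ?case by simp
  qed
  with xs show ?thesis by simp
qed

lemma odot_monos_gen: "(w, g) \<in> G \<Longrightarrow> g \<in> odot_monos G w"
  using odot_monos_Cons[OF _ odot_monos_Nil, of w g G] by simp

lemma odot_monos_mult:
  "f \<in> odot_monos G w \<Longrightarrow> g \<in> odot_monos G w' \<Longrightarrow> odot f g \<in> odot_monos G (w + w')"
proof (induction rule: odot_monos_induct)
  case (mult w h w'' f)
  then show ?case using odot_monos_Cons[OF mult(1) mult(3)] by (simp add: odot_assoc add_ac)
qed simp

lemma closed_pointwise_span: "closed_pointwise (qlin_span (\<Union>w. ptw_monos G w))"
  unfolding closed_pointwise_def
proof (intro ballI)
  fix f g assume "f \<in> qlin_span (\<Union>w. ptw_monos G w)" "g \<in> qlin_span (\<Union>w. ptw_monos G w)"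
  then show "pmult f g \<in> qlin_span (\<Union>w. ptw_monos G w)"
    by (rule qlin_span_bilinear[OF linear_pmult lin_closed_qlin_span, rotated -2])
       (auto intro!: qlin_span_base ptw_monos_mult)
qed

lemma closed_odot_span: "closed_odot (qlin_span (\<Union>w. odot_monos G w))"
  unfolding closed_odot_def
proof (intro ballI)
  fix f g assume "f \<in> qlin_span (\<Union>w. odot_monos G w)" "g \<in> qlin_span (\<Union>w. odot_monos G w)"
  then show "odot f g \<in> qlin_span (\<Union>w. odot_monos G w)"
    by (rule qlin_span_bilinear[OF linear_odot lin_closed_qlin_span, rotated -2])
       (auto intro!: qlin_span_base odot_monos_mult)
qed

lemma odot_hom_mult:
  "f \<in> qlin_span (odot_monos G w) \<Longrightarrow> g \<in> qlin_span (odot_monos G w') \<Longrightarrow> odot f g \<in> qlin_span (odot_monos G (w + w'))"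
  by (rule qlin_span_bilinear[OF linear_odot lin_closed_qlin_span, rotated -2])
     (auto intro!: qlin_span_base odot_monos_mult)

lemma pmult_alg_minimal:
  assumes "lin_closed C" "one_fun \<in> C" "\<And>w g f. (w, g) \<in> G \<Longrightarrow> f \<in> C \<Longrightarrow> pmult g f \<in> C"
  shows "qlin_span (\<Union>w. ptw_monos G w) \<subseteq> C"
proof (rule qlin_span_minimal[OF assms(1)], clarify)
  fix f w assume "f \<in> ptw_monos G w"
  then show "f \<in> C" by (induction rule: ptw_monos_induct) (use assms in auto)
qed

lemma odot_alg_minimal:
  assumes "lin_closed C" "one_fun \<in> C" "\<And>w g f. (w, g) \<in> G \<Longrightarrow> f \<in> C \<Longrightarrow> odot g f \<in> C"
  shows "qlin_span (\<Union>w. odot_monos G w) \<subseteq> C"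
proof (rule qlin_span_minimal[OF assms(1)], clarify)
  fix f w assume "f \<in> odot_monos G w"
  then show "f \<in> C" by (induction rule: odot_monos_induct) (use assms in auto)
qed

lemma ptw_monos_mono: "G \<subseteq> G' \<Longrightarrow> ptw_monos G w \<subseteq> ptw_monos G' w"
  unfolding ptw_monos_def by blast

section \<open>The algebra of double moments under either product\<close>

definition tau_space :: "bool \<Rightarrow> (partition \<Rightarrow> rat) set" where
  "tau_space b = {f. \<exists>n. tau_filt b n (ubracket f)}"

definition Tmom_gens :: "bool \<Rightarrow> (nat \<times> (partition \<Rightarrow> rat)) set" where
  "Tmom_gens b = {(k + l, Tmom k l) | k l. (k, l) \<in> tau_index b}"

text \<open>The pointwise counterpart of \<open>tau_space b\<close>, which consists of the functions
  whose bracket is a polynomial in the admissible \<open>tau k l\<close>.\<close>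

definition Tmom_alg :: "bool \<Rightarrow> (partition \<Rightarrow> rat) set" where
  "Tmom_alg b = qlin_span (\<Union>w. ptw_monos (Tmom_gens b) w)"

lemma lin_closed_tau_space: "lin_closed (tau_space b)"
  unfolding lin_closed_def tau_space_def
proof (safe, goal_cases)
  case 1
  then show ?case by (auto intro: tau_filt_0)
next
  case (2 f g n n' c)
  have "tau_filt b (max n n') (ubracket f + cst c * ubracket g)"
    by (intro tau_filt_add tau_filt_scale tau_filt_mono[OF _ 2(1)] tau_filt_mono[OF _ 2(2)]) auto
  then show ?case by (auto simp: ubracket_step)
qed

lemma one_tau_space: "one_fun \<in> tau_space b"
  using tau_filt_cst[of b 0 1] by (auto simp: tau_space_def)

lemma tau_filt_mult: "tau_filt b n X \<Longrightarrow> tau_filt b n' Y \<Longrightarrow> \<exists>N. tau_filt b N (X * Y)"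
proof (induction rule: tau_filt.induct)
  case (tau_filt_0 n)
  then show ?case by (auto intro: tau_filt.tau_filt_0)
next
  case (tau_filt_cst n c)
  then show ?case by (auto intro: tau_filt_scale)
next
  case (tau_filt_add n X Z)
  then obtain N1 N2 where "tau_filt b N1 (X * Y)" "tau_filt b N2 (Z * Y)" by blast
  then have "tau_filt b (max N1 N2) (X * Y + Z * Y)"
    by (intro tau_filt.tau_filt_add) (auto intro: tau_filt_mono[OF max.cobounded1] tau_filt_mono[OF max.cobounded2])
  then show ?case by (auto simp: distrib_right)
next
  case (tau_filt_scale n X c)
  then show ?case by (metis tau_filt.tau_filt_scale mult.assoc)
next
  case (tau_filt_tau k l n X)
  then show ?case by (metis tau_filt.tau_filt_tau mult.assoc)
qed

lemma tau_space_odot: "f \<in> tau_space b \<Longrightarrow> g \<in> tau_space b \<Longrightarrow> odot f g \<in> tau_space b"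
  by (auto simp: tau_space_def ubracket_odot intro: tau_filt_mult)

lemma tau_space_minimal:
  assumes C: "lin_closed C" "one_fun \<in> C" "\<And>f g. f \<in> C \<Longrightarrow> g \<in> C \<Longrightarrow> odot f g \<in> C"
    and P: "\<And>k l. (k, l) \<in> tau_index b \<Longrightarrow> Pfun k l \<in> C"
  shows "tau_space b \<subseteq> C"
proof -
  have "f \<in> C" if "tau_filt b n X" "ubracket f = X" for n X f
    using that
  proof (induction arbitrary: f rule: tau_filt.induct)
    case (tau_filt_0 n)
    then have "f = (\<lambda>p. 0)" by (simp flip: ubracket_inject)
    with C show ?case by (simp add: lin_closed_0)
  next
    case (tau_filt_cst n c)
    then have "f = (\<lambda>p. c * one_fun p)" by (simp add: ubracket_scale flip: ubracket_inject)
    with C show ?case by (simp add: lin_closed_scale)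
  next
    case (tau_filt_add n X Y)
    have "f = (\<lambda>p. coeff_u (ones * X) p + coeff_u (ones * Y) p)"
      using tau_filt_add.prems by (simp add: ubracket_add ubracket_surj flip: ubracket_inject del: coeff_u_simps)
    then show ?case using tau_filt_add.IH C(1) by (auto intro!: lin_closed_add simp: ubracket_surj)
  next
    case (tau_filt_scale n X c)
    have "f = (\<lambda>p. c * coeff_u (ones * X) p)"
      using tau_filt_scale.prems by (simp add: ubracket_scale ubracket_surj flip: ubracket_inject)
    then show ?case using tau_filt_scale.IH C(1) by (auto intro!: lin_closed_scale simp: ubracket_surj)
  next
    case (tau_filt_tau k l n X)
    have "f = odot (Pfun k l) (coeff_u (ones * X))"
      using tau_filt_tau.prems by (simp add: ubracket_odot ubracket_Pfun ubracket_surj flip: ubracket_inject)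
    then show ?case using tau_filt_tau.IH tau_filt_tau.hyps C(3) P by (auto simp: ubracket_surj)
  qed
  then show ?thesis by (auto simp: tau_space_def)
qed

definition Tconst :: "nat \<Rightarrow> nat \<Rightarrow> rat" where
  "Tconst k l = - bernoulli (k + l) / (2 * of_nat (k + l)) * (kdelta l 1 + kdelta k 0)"

lemma Tmom_Pfun: "Tmom k l = (\<lambda>p. Pfun k l p + Tconst k l * one_fun p)"
  by (rule ext) (simp add: Tmom_def Tconst_def Pfun_def one_fun_def)

lemma Pfun_Tmom: "Pfun k l = (\<lambda>p. Tmom k l p + (- Tconst k l) * one_fun p)"
  by (simp add: Tmom_Pfun)

lemma tau_space_Pfun_pmult: "(k, l) \<in> tau_index b \<Longrightarrow> f \<in> tau_space b \<Longrightarrow> pmult (Pfun k l) f \<in> tau_space b"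
  by (auto simp: tau_space_def) (metis tau_filt_Suc tau_filt_add tau_filt_tau ubracket_Pfun_mult)

lemma tau_space_Tmom_pmult:
  assumes "(k, l) \<in> tau_index b" "f \<in> tau_space b"
  shows "pmult (Tmom k l) f \<in> tau_space b"
  using lin_closed_step[OF lin_closed_tau_space tau_space_Pfun_pmult[OF assms] assms(2), of "Tconst k l"]
  by (simp add: Tmom_Pfun one_fun_def algebra_simps)

text \<open>A pointwise factor raises the level by at most one, which gives one inclusion.
  Conversely, an induced product with \<open>Pfun k l\<close> is the pointwise product minus a
  remainder of lower level.\<close>

lemma Tmom_alg_eq: "Tmom_alg b = tau_space b"
proof
  show "Tmom_alg b \<subseteq> tau_space b"
    unfolding Tmom_alg_def by (rule pmult_alg_minimal[OF lin_closed_tau_space one_tau_space]) (auto simp: Tmom_gens_def intro: tau_space_Tmom_pmult)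
  have lin: "lin_closed (Tmom_alg b)" by (simp add: Tmom_alg_def)
  have one: "one_fun \<in> Tmom_alg b" unfolding Tmom_alg_def using ptw_monos_Nil by (auto intro!: qlin_span_base)
  have mult: "f \<in> Tmom_alg b \<Longrightarrow> g \<in> Tmom_alg b \<Longrightarrow> pmult f g \<in> Tmom_alg b" for f g
    using closed_pointwise_span[of "Tmom_gens b"] by (simp add: Tmom_alg_def closed_pointwise_def)
  have P: "Pfun k l \<in> Tmom_alg b" if "(k, l) \<in> tau_index b" for k l
    unfolding Pfun_Tmom
  proof (intro lin_closed_step lin one)
    have "(k + l, Tmom k l) \<in> Tmom_gens b" using that by (auto simp: Tmom_gens_def)
    then show "Tmom k l \<in> Tmom_alg b"
      unfolding Tmom_alg_def by (auto intro!: qlin_span_base ptw_monos_gen)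
  qed
  have "f \<in> Tmom_alg b" if "tau_filt b n (ubracket f)" for n f
    using that
  proof (induction n arbitrary: f)
    case 0
    then have "f = (\<lambda>p. 0)" using tau_filt_eq_0 by (simp flip: ubracket_inject)
    with lin show ?case by (simp add: lin_closed_0)
  next
    case (Suc n)
    \<comment> \<open>The inner rule induction runs at the fixed level \<open>Suc n\<close> and
      handles linear combinations; products are passed to the outer induction on the level.\<close>
    have "f \<in> Tmom_alg b" if "tau_filt b n' X" "n' = Suc n" "ubracket f = X" for n' X f
      using that
    proof (induction arbitrary: f rule: tau_filt.induct)
      case (tau_filt_0 n)
      then have "f = (\<lambda>p. 0)" by (simp flip: ubracket_inject)
      with lin show ?case by (simp add: lin_closed_0)
    next
      case (tau_filt_cst n c)
      then have "f = (\<lambda>p. c * one_fun p)" by (simp add: ubracket_scale flip: ubracket_inject)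
      with lin one show ?case by (simp add: lin_closed_scale)
    next
      case (tau_filt_add n X Y)
      have "f = (\<lambda>p. coeff_u (ones * X) p + coeff_u (ones * Y) p)"
        using tau_filt_add.prems by (simp add: ubracket_add ubracket_surj flip: ubracket_inject del: coeff_u_simps)
      then show ?case using tau_filt_add.IH tau_filt_add.prems lin by (auto intro!: lin_closed_add simp: ubracket_surj)
    next
      case (tau_filt_scale n X c)
      have "f = (\<lambda>p. c * coeff_u (ones * X) p)"
        using tau_filt_scale.prems by (simp add: ubracket_scale ubracket_surj flip: ubracket_inject)
      then show ?case using tau_filt_scale.IH tau_filt_scale.prems lin by (auto intro!: lin_closed_scale simp: ubracket_surj)
    next
      case (tau_filt_tau k l n0 X)
      then have n0: "n0 = n" by simp
      define h where "h = coeff_u (ones * X)"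
      have h: "ubracket h = X" by (simp add: h_def ubracket_surj)
      show ?case
      proof (cases n)
        case 0
        then have "X = 0" using tau_filt_tau.hyps n0 tau_filt_eq_0 by blast
        then have "f = (\<lambda>p. 0)" using tau_filt_tau.prems by (simp flip: ubracket_inject)
        with lin show ?thesis by (simp add: lin_closed_0)
      next
        case (Suc n1)
        have hA: "h \<in> Tmom_alg b" using Suc.IH tau_filt_tau.hyps n0 h by auto
        \<comment> \<open>The remainder stays at the level n of h, below that of
          \<open>tau k l * X\<close>, so the outer hypothesis covers both h and the
          remainder.\<close>
        obtain R where R: "tau_filt b n R" "ubracket (pmult (Pfun k l) h) = tau k l * ubracket h + R"
          using ubracket_Pfun_mult[of b n1 h k l] tau_filt_tau.hyps n0 h Suc by auto
        define g where "g = coeff_u (ones * R)"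
        have g: "ubracket g = R" by (simp add: g_def ubracket_surj)
        have "f = (\<lambda>p. pmult (Pfun k l) h p - g p)"
          using tau_filt_tau.prems R h g by (simp only: ubracket_diff flip: ubracket_inject) simp
        moreover have "g \<in> Tmom_alg b" using \<open>\<And>f. tau_filt b n (ubracket f) \<Longrightarrow> f \<in> Tmom_alg b\<close> R g by auto
        ultimately show ?thesis using lin_closed_diff[OF lin mult[OF P hA]] tau_filt_tau.hyps by simp
      qed
    qed
    with Suc show ?case by blast
  qed
  then show "tau_space b \<subseteq> Tmom_alg b" by (auto simp: tau_space_def)
qed


section \<open>Moment functions and the derivation attached to them\<close>

lemma psum_Pfun: "(\<Sum>x\<in>#parts p. of_nat x ^ k) = Pfun k 1 p"
proof -
  have "(\<Sum>x\<in>#M. f x) = (\<Sum>m\<in>set_mset M. f m * of_nat (count M m))" for f :: "nat \<Rightarrow> rat" and M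
  proof (induction M)
    case (add x M)
    have "(\<Sum>m\<in>set_mset (add_mset x M). f m * of_nat (count (add_mset x M) m))
        = (\<Sum>m\<in>set_mset (add_mset x M). (if m = x then f m else 0) + f m * of_nat (count M m))"
      by (rule sum.cong) (auto simp: algebra_simps)
    also have "\<dots> = f x + (\<Sum>m\<in>set_mset (add_mset x M). f m * of_nat (count M m))"
      by (simp add: sum.distrib sum.delta del: sum.insert)
    also have "(\<Sum>m\<in>set_mset (add_mset x M). f m * of_nat (count M m)) = (\<Sum>m\<in>set_mset M. f m * of_nat (count M m))"
      by (rule sum.mono_neutral_right) (auto simp: count_eq_zero_iff)
    finally show ?case using add by simp
  qed simp
  then show ?thesis by (simp add: Pfun_def faulhaber_1[simplified] mult_r_def)
qed

lemma Smom_Tmom: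
  assumes "k \<ge> 2"
  shows "Smom k = Tmom (k - 1) 1"
  unfolding Tmom_Pfun using assms
  by (intro ext) (simp add: Smom_def psum_Pfun[simplified] Tconst_def kdelta_def one_fun_def)

text \<open>Since S_k is first order in the derivations, the difference of the two products with S_k is a derivation
  of the induced product; moreover it is homogeneous, sending T_{k',l} to T_{k+k'-1,l+1}.\<close>

definition delta :: "nat \<Rightarrow> (partition \<Rightarrow> rat) \<Rightarrow> partition \<Rightarrow> rat" where
  "delta k f = (\<lambda>p. pmult (Smom k) f p - odot (Smom k) f p)"

text \<open>On \<open>ones * X\<close> multiplication by r_m is
  \<open>ones * (part_deriv m X + phi 1 m * X)\<close>. After summation over m the second term
  accounts for the induced product, so the first is what remains.\<close>

lemma ubracket_delta:
  assumes "k \<ge> 2"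
  shows "ubracket (delta k f) = part_sum (k - 1) (\<lambda>m. part_deriv m (ubracket f))"
proof -
  let ?k = "k - 1"
  have "ubracket (pmult (Pfun ?k 1) f) = tau ?k 1 * ubracket f + part_sum ?k (\<lambda>m. part_deriv m (ubracket f))"
  proof (rule ubracketI)
    have "ones * (tau ?k 1 * ubracket f + part_sum ?k (\<lambda>m. part_deriv m (ubracket f)))
        = part_sum ?k (\<lambda>m. phi 1 m * (ones * ubracket f)) + part_sum ?k (\<lambda>m. part_deriv m (ubracket f)) * ones"
      by (simp only: part_sum_phi_mult distrib_left) (simp only: mult_ac)
    also have "\<dots> = part_sum ?k (\<lambda>m. part_deriv m (ones * ubracket f))"
      unfolding part_sum_mult[OF supported_part_deriv, symmetric] part_sum_add[symmetric] part_deriv_mult part_deriv_ones by (simp only: mult_ac)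
    also have "\<dots> = useries (pmult (Pfun ?k 1) f)"
      by (rule useries_eqI) (simp add: coeff_part_sum Pfun_def faulhaber_1[simplified] sum_distrib_right mult.assoc)
    finally show "ones * (tau ?k 1 * ubracket f + part_sum ?k (\<lambda>m. part_deriv m (ubracket f))) = useries (pmult (Pfun ?k 1) f)" .
  qed
  moreover have "pmult (Smom k) f = (\<lambda>p. pmult (Pfun ?k 1) f p + Tconst ?k 1 * f p)"
    by (simp add: Smom_Tmom[OF assms] Tmom_Pfun one_fun_def algebra_simps)
  ultimately have "ubracket (pmult (Smom k) f) = tau ?k 1 * ubracket f + part_sum ?k (\<lambda>m. part_deriv m (ubracket f)) + cst (Tconst ?k 1) * ubracket f"
    by (simp only: ubracket_step)
  moreover have "ubracket (Smom k) = tau ?k 1 + cst (Tconst ?k 1) * 1"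
    by (simp only: Smom_Tmom[OF assms] Tmom_Pfun ubracket_step ubracket_Pfun ubracket_one_fun)
  moreover have "ubracket (delta k f) = ubracket (pmult (Smom k) f) - ubracket (Smom k) * ubracket f"
    by (simp only: delta_def ubracket_diff ubracket_odot)
  ultimately show ?thesis by (simp only: distrib_right) simp
qed

lemma linear_delta: "linear_op (delta k)"
  using linear_pmult(1)[of "Smom k"] linear_odot(1)[of "Smom k"]
  unfolding linear_op_def delta_def fun_eq_iff by (simp add: algebra_simps)

lemma delta_odot:
  assumes "k \<ge> 2"
  shows "delta k (odot f g) = (\<lambda>p. odot (delta k f) g p + odot f (delta k g) p)"
proof -
  have "part_sum (k - 1) (\<lambda>m. part_deriv m (X * Y)) = part_sum (k - 1) (\<lambda>m. part_deriv m X) * Y + X * part_sum (k - 1) (\<lambda>m. part_deriv m Y)" for X Y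
    using part_sum_mult[of "\<lambda>m. part_deriv m X" "k - 1" Y] part_sum_mult[of "\<lambda>m. part_deriv m Y" "k - 1" X]
    by (simp add: part_deriv_mult part_sum_add mult.commute)
  then show ?thesis
    by (simp add: ubracket_delta[OF assms] ubracket_odot ubracket_add flip: ubracket_inject)
qed

lemma delta_one: "k \<ge> 2 \<Longrightarrow> delta k one_fun = (\<lambda>p. 0)"
  by (simp add: ubracket_delta flip: ubracket_inject)

lemma delta_Pfun:
  assumes "k \<ge> 2" "l \<ge> 1"
  shows "delta k (Pfun k' l) = Pfun (k - 1 + k') (l + 1)"
  unfolding ubracket_inject[symmetric] ubracket_delta[OF assms(1)] ubracket_Pfun part_deriv_tau[OF assms(2)] part_sum_of_nat_power
  by (simp add: tau_def)

lemma delta_Tmom: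
  assumes "k \<ge> 2" "l \<ge> 1"
  shows "delta k (Tmom k' l) = Tmom (k - 1 + k') (l + 1)"
proof -
  \<comment> \<open>Both Kronecker deltas vanish: the first index is at least 1 and the second at
    least 2.\<close>
  have "Tconst (k - 1 + k') (l + 1) = 0" using assms by (simp add: Tconst_def kdelta_def)
  moreover have "delta k (Tmom k' l) = delta k (Pfun k' l)"
    using assms by (simp only: ubracket_delta ubracket_step Tmom_Pfun ubracket_one_fun flip: ubracket_inject)
      (simp add: part_deriv_add)
  ultimately show ?thesis by (simp add: Tmom_Pfun delta_Pfun[OF assms])
qed

lemma Smom_pmult: "pmult (Smom k) f = (\<lambda>p. odot (Smom k) f p + delta k f p)"
  by (simp add: delta_def)

section \<open>Gradings and the comparison of the three algebras\<close>

lemma T_gens_Tmom_gens: "T_gens = Tmom_gens False"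
  by (auto simp: T_gens_def Tmom_gens_def tau_index_def)

lemma T_alg_eq: "T_alg = tau_space False"
  using Tmom_alg_eq[of False] by (simp add: T_alg_def Tmom_alg_def T_gens_Tmom_gens)

lemma T_hom_subset: "T_hom w \<subseteq> T_alg"
proof -
  have "Tmom k l \<in> tau_space False" if "(k, l) \<in> tau_index False" for k l
    using tau_space_Tmom_pmult[OF that one_tau_space] by (simp add: one_fun_def)
  then have "qlin_span (\<Union>w. odot_monos T_gens w) \<subseteq> tau_space False"
    by (intro odot_alg_minimal lin_closed_tau_space one_tau_space tau_space_odot) (auto simp: T_gens_Tmom_gens Tmom_gens_def)
  moreover have "T_hom w \<subseteq> qlin_span (\<Union>w. odot_monos T_gens w)"
    unfolding T_hom_def by (rule qlin_span_mono) blast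
  ultimately show ?thesis by (simp add: T_alg_eq)
qed

lemma T_alg_subset: "T_alg \<subseteq> qlin_span (\<Union>w. T_hom w)"
proof -
  let ?C = "qlin_span (\<Union>w. odot_monos T_gens w)"
  have one: "one_fun \<in> ?C" using odot_monos_Nil by (auto intro!: qlin_span_base)
  have "Pfun k l \<in> ?C" if "(k, l) \<in> tau_index False" for k l
    unfolding Pfun_Tmom
  proof (intro lin_closed_step lin_closed_qlin_span one)
    have "(k + l, Tmom k l) \<in> T_gens" using that by (auto simp: T_gens_Tmom_gens Tmom_gens_def)
    then show "Tmom k l \<in> ?C" by (auto intro!: qlin_span_base odot_monos_gen)
  qed
  then have "tau_space False \<subseteq> ?C"
    using closed_odot_span[of T_gens] one by (intro tau_space_minimal) (auto simp: closed_odot_def)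
  also have "?C \<subseteq> qlin_span (\<Union>w. T_hom w)"
    by (rule qlin_span_mono) (auto simp: T_hom_def intro: qlin_span_base)
  finally show ?thesis by (simp add: T_alg_eq)
qed

lemma delta_T_hom:
  assumes "even k" "k \<ge> 2" "f \<in> T_hom w"
  shows "delta k f \<in> T_hom (k + w)"
  unfolding T_hom_def
proof (rule qlin_span_linear[OF linear_delta lin_closed_qlin_span _ assms(3)[unfolded T_hom_def]])
  fix f assume "f \<in> odot_monos T_gens w"
  then show "delta k f \<in> qlin_span (odot_monos T_gens (k + w))"
  proof (induction rule: odot_monos_induct)
    case one
    then show ?case using assms(2) by (simp add: delta_one qlin_span_0)
  next
    case (mult w g w' f)
    obtain k' l where g: "g = Tmom k' l" "w = k' + l" "l \<ge> 1" "even (k' + l)"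
      using mult(1) by (auto simp: T_gens_def)
    have "(k - 1 + k' + (l + 1), Tmom (k - 1 + k') (l + 1)) \<in> T_gens"
      unfolding T_gens_def
      by (intro CollectI exI[of _ "k - 1 + k'"] exI[of _ "l + 1"]) (use g assms(1,2) in auto)
    moreover have "k - 1 + k' + (l + 1) = k + w" using assms(2) g by simp
    ultimately have "delta k g \<in> qlin_span (odot_monos T_gens (k + w))"
      using delta_Tmom[OF assms(2) g(3)] g(1) by (auto intro!: qlin_span_base odot_monos_gen)
    from odot_hom_mult[OF this qlin_span_base[OF mult(2)]]
    have 1: "odot (delta k g) f \<in> qlin_span (odot_monos T_gens (k + (w + w')))"
      by (simp add: add.assoc)
    from odot_hom_mult[OF qlin_span_base[OF odot_monos_gen[OF mult(1)]] mult(3)]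
    have 2: "odot g (delta k f) \<in> qlin_span (odot_monos T_gens (k + (w + w')))"
      by (simp add: add_ac)
    show ?case unfolding delta_odot[OF assms(2)]
      by (rule lin_closed_add[OF lin_closed_qlin_span 1 2])
  qed
qed

lemma Smom_T_gens: "even k \<Longrightarrow> k \<ge> 2 \<Longrightarrow> (k, Smom k) \<in> Tmom_gens True"
  unfolding Tmom_gens_def tau_index_def by (clarsimp simp: Smom_Tmom) (rule exI[of _ "k - 1"], rule exI[of _ 1], simp)

lemma Tmom_gens_mono: "Tmom_gens True \<subseteq> Tmom_gens False"
  by (auto simp: Tmom_gens_def tau_index_def)

text \<open>The weight on S is defined by pointwise products, that on T by induced ones. They are
  compatible since \<open>pmult (Smom k) f\<close> is the sum of \<open>odot (Smom k) f\<close> and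
  \<open>delta k f\<close>, both of which raise the induced weight by k.\<close>

lemma S_hom_T_hom: "S_hom w \<subseteq> T_hom w"
  unfolding S_hom_def
proof (rule qlin_span_minimal)
  show "lin_closed (T_hom w)" by (simp add: T_hom_def)
  show "ptw_monos S_gens w \<subseteq> T_hom w"
  proof
    fix f assume "f \<in> ptw_monos S_gens w"
    then show "f \<in> T_hom w"
    proof (induction rule: ptw_monos_induct)
      case one
      then show ?case unfolding T_hom_def using odot_monos_Nil by (rule qlin_span_base)
    next
      case (mult w g w' f)
      then have w: "g = Smom w" "even w" "w \<ge> 2" by (auto simp: S_gens_def)
      have "(w, Smom w) \<in> T_gens" using Smom_T_gens[OF w(2,3)] Tmom_gens_mono by (auto simp: T_gens_Tmom_gens)
      then have "odot g f \<in> T_hom (w + w')"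
        using mult(3) w(1) unfolding T_hom_def by (intro odot_hom_mult) (auto intro: qlin_span_base odot_monos_gen)
      moreover have "delta w f \<in> T_hom (w + w')" using delta_T_hom[OF w(2,3) mult(3)] .
      ultimately show ?case unfolding w(1) Smom_pmult using w(1)
        by (intro lin_closed_add) (auto simp: T_hom_def)
    qed
  qed
qed

lemma odot_T_hom: "f \<in> T_hom w \<Longrightarrow> g \<in> T_hom w' \<Longrightarrow> odot f g \<in> T_hom (w + w')"
  unfolding T_hom_def by (rule odot_hom_mult)

lemma SymS_hom_T_hom: "SymS_hom w \<subseteq> T_hom w"
  unfolding SymS_hom_def
proof (rule qlin_span_minimal)
  show "lin_closed (T_hom w)" by (simp add: T_hom_def)
  show "odot_monos SymS_gens w \<subseteq> T_hom w"
  proof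
    fix f assume "f \<in> odot_monos SymS_gens w"
    then show "f \<in> T_hom w"
    proof (induction rule: odot_monos_induct)
      case one
      then show ?case unfolding T_hom_def using odot_monos_Nil by (rule qlin_span_base)
    next
      case (mult w g w' f)
      then have "g \<in> T_hom w" using S_hom_T_hom by (auto simp: SymS_gens_def)
      then show ?case using mult(3) by (rule odot_T_hom)
    qed
  qed
qed

lemma lin_closed_SymS: "lin_closed SymS_alg"
  by (simp add: SymS_alg_def)

lemma odot_SymS: "f \<in> SymS_alg \<Longrightarrow> g \<in> SymS_alg \<Longrightarrow> odot f g \<in> SymS_alg"
  using closed_odot_span[of SymS_gens] by (simp add: closed_odot_def SymS_alg_def)

lemma S_hom_SymS: "S_hom w \<subseteq> SymS_alg"
proof
  fix f assume "f \<in> S_hom w"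
  then have "(w, f) \<in> SymS_gens" by (simp add: SymS_gens_def)
  then show "f \<in> SymS_alg" unfolding SymS_alg_def by (auto intro!: qlin_span_base odot_monos_gen)
qed

lemma one_SymS: "one_fun \<in> SymS_alg"
  unfolding SymS_alg_def using odot_monos_Nil by (auto intro!: qlin_span_base)

lemma S_hom_Smom_pmult:
  assumes "even k" "k \<ge> 2" "f \<in> S_hom w"
  shows "pmult (Smom k) f \<in> S_hom (k + w)"
  unfolding S_hom_def
proof (rule qlin_span_linear[OF linear_pmult(1) lin_closed_qlin_span _ assms(3)[unfolded S_hom_def]])
  fix x assume "x \<in> ptw_monos S_gens w"
  then show "pmult (Smom k) x \<in> qlin_span (ptw_monos S_gens (k + w))"
    using assms(1,2) by (intro qlin_span_base ptw_monos_Cons) (auto simp: S_gens_def)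
qed

lemma Smom_S_hom: "even k \<Longrightarrow> k \<ge> 2 \<Longrightarrow> Smom k \<in> S_hom k"
  unfolding S_hom_def by (auto intro!: qlin_span_base ptw_monos_gen simp: S_gens_def)

text \<open>On a homogeneous element g of S both products with S_k lie in \<open>SymS_alg\<close>,
  hence so does their difference; the derivation rule extends this to induced products.\<close>

lemma delta_SymS:
  assumes "even k" "k \<ge> 2" "f \<in> SymS_alg"
  shows "delta k f \<in> SymS_alg"
proof (rule qlin_span_linear[OF linear_delta lin_closed_SymS _ assms(3)[unfolded SymS_alg_def]])
  fix f assume "f \<in> (\<Union>w. odot_monos SymS_gens w)"
  then obtain w where "f \<in> odot_monos SymS_gens w" by blast
  then show "delta k f \<in> SymS_alg"
  proof (induction rule: odot_monos_induct)
    case one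
    then show ?case using assms(2) lin_closed_SymS by (simp add: delta_one lin_closed_0)
  next
    case (mult w g w' f)
    then have g: "g \<in> S_hom w" by (simp add: SymS_gens_def)
    have "pmult (Smom k) g \<in> SymS_alg" "odot (Smom k) g \<in> SymS_alg"
      using S_hom_Smom_pmult[OF assms(1,2) g] g Smom_S_hom[OF assms(1,2)] S_hom_SymS by (auto intro!: odot_SymS)
    then have "delta k g \<in> SymS_alg"
      unfolding delta_def by (rule lin_closed_diff[OF lin_closed_SymS])
    moreover have "f \<in> SymS_alg" "g \<in> SymS_alg"
      using mult(2) g S_hom_SymS unfolding SymS_alg_def by (auto intro: qlin_span_base)
    ultimately show ?case unfolding delta_odot[OF assms(2)]
      using mult(3) by (intro lin_closed_add lin_closed_SymS odot_SymS)
  qed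
qed

text \<open>\<open>delta 2\<close> raises both indices by one, so l - 1 applications lead from
  S_{k-l+2}, up to a constant, to \<open>Pfun k l\<close>; the condition \<open>l \<le> k\<close>
  makes that index at least 2.\<close>

lemma Pfun_SymS:
  assumes "(k, l) \<in> tau_index True"
  shows "Pfun k l \<in> SymS_alg"
proof -
  have "l \<ge> 1" "even (k + l)" "l \<le> k" using assms by (auto simp: tau_index_def)
  then show ?thesis
  proof (induction l arbitrary: k rule: dec_induct)
    case base
    then have "Smom (k + 1) = Tmom k 1" by (simp add: Smom_Tmom)
    moreover have "Smom (k + 1) \<in> SymS_alg"
      using base S_hom_SymS Smom_S_hom[of "k + 1"] by auto
    ultimately show ?case unfolding Pfun_Tmom
      by (intro lin_closed_step lin_closed_SymS one_SymS) simp
  next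
    case (step l)
    have "Pfun (k - 1) l \<in> SymS_alg" using step.prems by (intro step.IH) auto
    from delta_SymS[OF _ _ this, of 2] show ?case
      using step by (simp add: delta_Pfun)
  qed
qed

lemma S_hom_Tmom_alg: "S_hom w \<subseteq> Tmom_alg True"
proof -
  have "S_gens \<subseteq> Tmom_gens True" using Smom_T_gens by (auto simp: S_gens_def)
  then show ?thesis unfolding S_hom_def Tmom_alg_def
    by (intro qlin_span_mono) (use ptw_monos_mono in blast)
qed

text \<open>Closure under the pointwise product follows from this description through
  \<open>Tmom_alg_eq\<close>.\<close>

lemma SymS_alg_eq: "SymS_alg = tau_space True"
proof
  show "SymS_alg \<subseteq> tau_space True"
    unfolding SymS_alg_def
    by (intro odot_alg_minimal lin_closed_tau_space one_tau_space tau_space_odot)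
       (use S_hom_Tmom_alg in \<open>auto simp: SymS_gens_def Tmom_alg_eq\<close>)
  show "tau_space True \<subseteq> SymS_alg"
    by (intro tau_space_minimal lin_closed_SymS one_SymS odot_SymS Pfun_SymS)
qed

lemma closed_pointwise_tau_space: "closed_pointwise (tau_space b)"
  using closed_pointwise_span[of "Tmom_gens b"] by (simp add: Tmom_alg_eq[symmetric] Tmom_alg_def)

lemma S_subset_SymS: "S_alg \<subseteq> SymS_alg"
  unfolding S_alg_def
proof (rule qlin_span_minimal[OF lin_closed_SymS], clarify)
  fix f w assume "f \<in> ptw_monos S_gens w"
  then have "f \<in> S_hom w" unfolding S_hom_def by (rule qlin_span_base)
  then show "f \<in> SymS_alg" using S_hom_SymS by blast
qed

lemma SymS_subset_T: "SymS_alg \<subseteq> T_alg"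
  unfolding SymS_alg_eq T_alg_eq Tmom_alg_eq[symmetric] Tmom_alg_def
  using Tmom_gens_mono ptw_monos_mono by (intro qlin_span_mono) blast

section \<open>Strictness of the inclusions\<close>

lemma poly_eq_on_nat:
  fixes q q' :: "rat poly"
  assumes "\<And>n :: nat. n \<ge> 2 \<Longrightarrow> poly q (of_nat n) = poly q' (of_nat n)"
  shows "q = q'"
proof (rule ccontr)
  assume "q \<noteq> q'"
  then have "finite {x. poly (q - q') x = 0}" by (intro poly_roots_finite) simp
  moreover have "of_nat ` {2..} \<subseteq> {x. poly (q - q') x = 0}" using assms by auto
  ultimately have "finite ((of_nat :: nat \<Rightarrow> rat) ` {2..})" by (rule finite_subset[rotated])
  then have "finite {2 :: nat..}" by (rule finite_imageD) (simp add: inj_on_def)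
  then show False using infinite_Ici by blast
qed

definition pair_partition :: "nat \<Rightarrow> partition" where
  "pair_partition y = Abs_partition {#1, y#}"

lemma parts_pair_partition: "y \<ge> 1 \<Longrightarrow> parts (pair_partition y) = {#1, y#}"
  by (simp add: pair_partition_def)

text \<open>On the partitions (y, 1) an element of S is a polynomial in y, including y = 1.\<close>

lemma Pfun_2_2_notin: "Pfun 2 2 \<notin> S_alg"
proof
  define C where "C = {f :: partition \<Rightarrow> rat. \<exists>q. \<forall>y\<ge>1. f (pair_partition y) = poly q (of_nat y)}"
  have "S_alg \<subseteq> C"
    unfolding S_alg_def
  proof (rule pmult_alg_minimal)
    show "lin_closed C"
      unfolding lin_closed_def C_def
    proof (safe, goal_cases)
      case 1
      show ?case by (rule exI[of _ 0]) simp
    next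
      case (2 f g q q' c)
      then show ?case by (intro exI[of _ "q + smult c q'"]) simp
    qed
    show "one_fun \<in> C" by (auto simp: C_def one_fun_def intro!: exI[of _ 1])
    fix w g f assume "(w, g) \<in> S_gens" "f \<in> C"
    then obtain q where q: "\<forall>y\<ge>1. f (pair_partition y) = poly q (of_nat y)" and g: "g = Smom w"
      by (auto simp: C_def S_gens_def)
    have "pmult g f (pair_partition y) = poly (([:1 - bernoulli w / (2 * of_nat w):] + monom 1 (w - 1)) * q) (of_nat y)" if "y \<ge> 1" for y
      using q that by (simp add: g Smom_def parts_pair_partition poly_monom)
    then show "pmult g f \<in> C" unfolding C_def by blast
  qed
  moreover assume "Pfun 2 2 \<in> S_alg"
  ultimately obtain q where q: "\<And>y. y \<ge> 1 \<Longrightarrow> Pfun 2 2 (pair_partition y) = poly q (of_nat y)"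
    by (auto simp: C_def)
  \<comment> \<open>For y at least 2 the parts 1 and y are distinct and force q = 1 + y^2, hence
    q(1) = 2; but at y = 1 the multiplicity 2 gives F_2(2) = 3.\<close>
  have "q = [:1, 0, 1:]"
  proof (rule poly_eq_on_nat)
    fix n :: nat assume n: "n \<ge> 2"
    then have "poly q (of_nat n) = Pfun 2 2 (pair_partition n)" using q by simp
    also have "\<dots> = 1 + of_nat n ^ 2"
      using n by (simp add: Pfun_def parts_pair_partition mult_r_def faulhaber_def)
    finally show "poly q (of_nat n) = poly [:1, 0, 1:] (of_nat n)"
      by (simp add: power2_eq_square)
  qed
  moreover have "Pfun 2 2 (pair_partition 1) = 3"
    by (simp add: Pfun_def parts_pair_partition mult_r_def faulhaber_def numeral_2_eq_2)
  ultimately show False using q[of 1] by simp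
qed

lemma Pfun_rect: "m \<ge> 1 \<Longrightarrow> r \<ge> 1 \<Longrightarrow> Pfun k l (rect r m) = of_nat m ^ k * faulhaber l r"
  by (simp add: Pfun_def mult_r_def)

text \<open>On r copies of the part m the generators T_{k,l} with k > 0 are polynomial in m with a value at m = 0
  that does not depend on r.\<close>

lemma Pfun_0_2_notin: "Pfun 0 2 \<notin> SymS_alg"
proof
  define C where "C = {f :: partition \<Rightarrow> rat. \<exists>c. \<forall>r\<ge>1. \<exists>q. poly q 0 = c \<and> (\<forall>m\<ge>1. f (rect r m) = poly q (of_nat m))}"
  have "Tmom_alg True \<subseteq> C"
    unfolding Tmom_alg_def
  proof (rule pmult_alg_minimal)
    show "lin_closed C"
      unfolding lin_closed_def
    proof (intro conjI ballI allI)
      show "(\<lambda>p. 0) \<in> C" unfolding C_def by (auto intro!: exI[of _ 0])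
      fix f g a assume "f \<in> C" "g \<in> C"
      then obtain c d where
        f: "\<forall>r\<ge>1. \<exists>q. poly q 0 = c \<and> (\<forall>m\<ge>1. f (rect r m) = poly q (of_nat m))" and
        g: "\<forall>r\<ge>1. \<exists>q. poly q 0 = d \<and> (\<forall>m\<ge>1. g (rect r m) = poly q (of_nat m))"
        unfolding C_def by blast
      show "(\<lambda>p. f p + a * g p) \<in> C"
        unfolding C_def
      proof (intro CollectI exI[of _ "c + a * d"] allI impI)
        fix r :: nat assume r: "r \<ge> 1"
        obtain q1 where "poly q1 0 = c" "\<forall>m\<ge>1. f (rect r m) = poly q1 (of_nat m)"
          using f[rule_format, OF r] by (elim exE conjE)
        moreover obtain q2 where "poly q2 0 = d" "\<forall>m\<ge>1. g (rect r m) = poly q2 (of_nat m)"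
          using g[rule_format, OF r] by (elim exE conjE)
        ultimately show "\<exists>q. poly q 0 = c + a * d \<and> (\<forall>m\<ge>1. f (rect r m) + a * g (rect r m) = poly q (of_nat m))"
          by (intro exI[of _ "q1 + smult a q2"]) simp
      qed
    qed
    show "one_fun \<in> C" unfolding C_def one_fun_def by (auto intro!: exI[of _ 1])
    fix w g f assume "(w, g) \<in> Tmom_gens True" "f \<in> C"
    \<comment> \<open>From \<open>1 \<le> l\<close> and \<open>l \<le> k\<close> follows
      \<open>k \<ge> 1\<close>, so that m^k contributes nothing at m = 0.\<close>
    then obtain k l c where g: "g = Tmom k l" "k \<ge> 1" and
      f: "\<forall>r\<ge>1. \<exists>q. poly q 0 = c \<and> (\<forall>m\<ge>1. f (rect r m) = poly q (of_nat m))"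
      unfolding C_def Tmom_gens_def tau_index_def by auto
    show "pmult g f \<in> C"
      unfolding C_def
    proof (intro CollectI exI[of _ "Tconst k l * c"] allI impI)
      fix r :: nat assume r: "r \<ge> 1"
      obtain q where "poly q 0 = c" "\<forall>m\<ge>1. f (rect r m) = poly q (of_nat m)"
        using f[rule_format, OF r] by (elim exE conjE)
      then show "\<exists>q. poly q 0 = Tconst k l * c \<and> (\<forall>m\<ge>1. pmult g f (rect r m) = poly q (of_nat m))"
        using r g by (intro exI[of _ "([:Tconst k l:] + monom (faulhaber l r) k) * q"])
          (simp add: Tmom_Pfun one_fun_def Pfun_rect[simplified] poly_monom)
    qed
  qed
  moreover assume "Pfun 0 2 \<in> SymS_alg"
  ultimately have "Pfun 0 2 \<in> C" by (auto simp: SymS_alg_eq Tmom_alg_eq)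
  then obtain c where c: "\<forall>r\<ge>1. \<exists>q. poly q 0 = c \<and> (\<forall>m\<ge>1. Pfun 0 2 (rect r m) = poly q (of_nat m))"
    unfolding C_def mem_Collect_eq by (elim exE)
  have "faulhaber 2 r = c" if "r \<ge> 1" for r
  proof -
    obtain q where q: "poly q 0 = c" "\<forall>m\<ge>1. Pfun 0 2 (rect r m) = poly q (of_nat m)"
      using c[rule_format, OF \<open>r \<ge> 1\<close>] by (elim exE conjE)
    have "q = [:faulhaber 2 r:]"
    proof (rule poly_eq_on_nat)
      fix n :: nat assume "n \<ge> 2"
      then show "poly q (of_nat n) = poly [:faulhaber 2 r:] (of_nat n)"
        using q(2)[rule_format, of n] that by (simp add: Pfun_rect[simplified])
    qed
    with q(1) show ?thesis by simp
  qed
  \<comment> \<open>F_2(1) = 1 and F_2(2) = 3.\<close>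
  from this[of 1] this[of 2] show False by (simp add: faulhaber_def numeral_2_eq_2)
qed

lemma S_psubset: "S_alg \<subset> SymS_alg"
proof -
  have "Pfun 2 2 \<in> SymS_alg" by (rule Pfun_SymS) (simp add: tau_index_def)
  then show ?thesis using S_subset_SymS Pfun_2_2_notin by blast
qed

lemma SymS_psubset: "SymS_alg \<subset> T_alg"
proof -
  have "Pfun 0 2 \<in> tau_space False"
    using tau_space_Pfun_pmult[OF _ one_tau_space, of 0 2 False] by (simp add: tau_index_def one_fun_def)
  then show ?thesis using SymS_subset_T Pfun_0_2_notin T_alg_eq by blast
qed

section \<open>Bernoulli numbers\<close>

definition bern_fps :: "rat fps" where "bern_fps = fps_X / (fps_exp 1 - 1)"

lemma bernoulli_nth: "fps_nth bern_fps n = bernoulli n / fact n"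
  by (simp add: bernoulli_def bern_fps_def)

lemma bern_fps_times: "bern_fps * (fps_exp 1 - 1) = fps_X"
proof -
  have nz: "fps_exp 1 - 1 \<noteq> (0 :: rat fps)"
    by (auto simp: fps_eq_iff intro!: exI[of _ 1])
  have "subdegree (fps_exp 1 - 1 :: rat fps) \<le> subdegree (fps_X :: rat fps)"
    by (rule subdegree_leI) simp
  with nz show ?thesis
    unfolding bern_fps_def by (intro fps_times_divide_eq)
qed

lemma exp_minus_one_cancel: "(f :: rat fps) * (fps_exp 1 - 1) = g * (fps_exp 1 - 1) \<longleftrightarrow> f = g"
proof -
  have "fps_exp 1 - 1 \<noteq> (0 :: rat fps)"
    by (auto simp: fps_eq_iff intro!: exI[of _ 1])
  then show ?thesis by simp
qed

text \<open>Compare the coefficients of x^(s + 1) in x times the sum of e^(b x) over b < d, which is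
  x (e^(d x) - 1)/(e^x - 1).\<close>

lemma sum_powers_bernoulli:
  "(\<Sum>b<d. of_nat b ^ s) = (\<Sum>j\<le>s. of_nat (Suc s choose j) * bernoulli j * of_nat d ^ (Suc s - j)) / of_nat (Suc s)"
proof -
  have "(\<Sum>b<d. fps_exp (of_nat b)) * (fps_exp 1 - 1) = (fps_exp (of_nat d) - 1 :: rat fps)"
  proof (induction d)
    case (Suc d)
    have "fps_exp (of_nat (Suc d)) = fps_exp (of_nat d) * (fps_exp 1 :: rat fps)"
      by (simp add: fps_exp_add_mult[symmetric] add.commute)
    with Suc show ?case by (simp add: algebra_simps)
  qed simp
  then have "(bern_fps * (fps_exp 1 - 1)) * (\<Sum>b<d. fps_exp (of_nat b)) = bern_fps * (fps_exp (of_nat d) - 1)"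
    by (simp add: mult_ac)
  then have "fps_X * (\<Sum>b<d. fps_exp (of_nat b)) = bern_fps * (fps_exp (of_nat d) - 1)"
    by (simp only: bern_fps_times)
  then have "fps_nth (fps_X * (\<Sum>b<d. fps_exp (of_nat b))) (Suc s) = fps_nth (bern_fps * (fps_exp (of_nat d) - 1)) (Suc s)"
    by simp
  moreover have "fps_nth (fps_X * (\<Sum>b<d. fps_exp (of_nat b))) (Suc s) = (\<Sum>b<d. of_nat b ^ s / fact s :: rat)"
    by (simp add: fps_sum_nth)
  moreover have "fps_nth (bern_fps * (fps_exp (of_nat d) - 1)) (Suc s)
      = (\<Sum>j\<le>Suc s. bernoulli j / fact j * fps_nth (fps_exp (of_nat d) - 1) (Suc s - j))"
    by (simp only: fps_mult_nth bernoulli_nth atLeast0AtMost)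
  ultimately have "(\<Sum>b<d. of_nat b ^ s / fact s) = (\<Sum>j\<le>Suc s. bernoulli j / fact j * fps_nth (fps_exp (of_nat d) - 1) (Suc s - j))"
    by (simp only:)
  also have "\<dots> = (\<Sum>j\<le>s. bernoulli j / fact j * (of_nat d ^ (Suc s - j) / fact (Suc s - j)))"
    by simp (rule sum.cong, auto simp: Suc_diff_le)
  finally have "fact s * (\<Sum>b<d. of_nat b ^ s / fact s) = fact s * (\<Sum>j\<le>s. bernoulli j / fact j * (of_nat d ^ (Suc s - j) / fact (Suc s - j)))"
    by simp
  then have "(\<Sum>b<d. of_nat b ^ s) = (\<Sum>j\<le>s. fact s * (bernoulli j / fact j * (of_nat d ^ (Suc s - j) / fact (Suc s - j))))"
    by (simp add: sum_distrib_left)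
  also have "\<dots> = (\<Sum>j\<le>s. of_nat (Suc s choose j) * bernoulli j * of_nat d ^ (Suc s - j) / of_nat (Suc s))"
  proof (rule sum.cong[OF refl])
    fix j assume "j \<in> {..s}"
    then have "of_nat (Suc s choose j) = (fact (Suc s) / (fact j * fact (Suc s - j)) :: rat)"
      by (intro binomial_fact) auto
    then show "fact s * (bernoulli j / fact j * (of_nat d ^ (Suc s - j) / fact (Suc s - j)))
      = of_nat (Suc s choose j) * bernoulli j * of_nat d ^ (Suc s - j) / (of_nat (Suc s) :: rat)"
      by (simp add: field_simps del: of_nat_Suc)
  qed
  finally show ?thesis by (simp add: sum_divide_distrib)
qed

lemma bernoulli_0 [simp]: "bernoulli 0 = 1"
  using sum_powers_bernoulli[where d = 1 and s = 0] by simp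

lemma bernoulli_rec: "s \<ge> 1 \<Longrightarrow> (\<Sum>j\<le>s. of_nat (Suc s choose j) * bernoulli j) = 0"
  using sum_powers_bernoulli[of s 1] by (simp add: power_0_left)

lemma bernoulli_1 [simp]: "bernoulli 1 = - 1 / 2" "bernoulli (Suc 0) = - 1 / 2"
  using bernoulli_rec[of 1] by (simp_all add: field_simps)

text \<open>This is (x/2) coth(x/2), an even series: the added x/2 removes the only odd
  coefficient.\<close>

definition bern_even :: "rat fps" where "bern_even = bern_fps + fps_const (1 / 2) * fps_X"

text \<open>Substituting -x in B(x) (e^x - 1) = x and multiplying by e^x shows B(-x) = B(x) + x for
  B = \<open>bern_fps\<close>.\<close>

lemma bern_even_uminus: "fps_compose bern_even (- fps_X) = bern_even"
proof -
  have comp: "fps_compose (fps_exp 1 - 1) (- fps_X) = fps_exp (- 1) - (1 :: rat fps)"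
    by (simp add: fps_compose_sub_distrib fps_fps_exp_compose_minus)
  have "fps_compose bern_fps (- fps_X) * (fps_exp (- 1) - 1) = - fps_X"
    unfolding comp[symmetric] by (simp flip: fps_compose_mult_distrib add: bern_fps_times)
  then have "fps_compose bern_fps (- fps_X) * (fps_exp (- 1) - 1) * fps_exp 1 = - fps_X * fps_exp 1"
    by simp
  moreover have "(fps_exp (- 1) - 1) * fps_exp 1 = - (fps_exp 1 - 1 :: rat fps)"
    by (simp add: left_diff_distrib fps_exp_add_mult[symmetric])
  ultimately have "fps_compose bern_fps (- fps_X) * (- (fps_exp 1 - 1)) = - fps_X * fps_exp 1"
    by (simp only: mult.assoc)
  then have "fps_compose bern_fps (- fps_X) * (fps_exp 1 - 1) = fps_X * fps_exp 1"
    by (simp only: mult_minus_right mult_minus_left neg_equal_iff_equal)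
  also have "\<dots> = (bern_fps + fps_X) * (fps_exp 1 - 1)"
    by (simp only: distrib_right bern_fps_times) (simp add: right_diff_distrib)
  finally have "fps_compose bern_fps (- fps_X) = bern_fps + fps_X"
    by (simp only: exp_minus_one_cancel)
  moreover have "fps_const (1 / 2) * (- fps_X) + fps_X = (fps_const (1 / 2) * fps_X :: rat fps)"
    by (rule fps_ext) (auto simp: fps_X_nth)
  ultimately show ?thesis
    by (simp add: bern_even_def fps_compose_add_distrib fps_compose_mult_distrib algebra_simps)
qed

lemma bern_even_odd: "odd n \<Longrightarrow> fps_nth bern_even n = 0"
proof -
  assume "odd n"
  have "fps_nth (fps_compose bern_even (- fps_X)) n = (- 1) ^ n * fps_nth bern_even n"
    by (simp add: fps_compose_uminus')
  with \<open>odd n\<close> show ?thesis by (simp add: bern_even_uminus)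
qed

lemma bern_even_nth: "n \<noteq> 1 \<Longrightarrow> fps_nth bern_even n = bernoulli n / fact n"
  by (simp add: bern_even_def bernoulli_nth)

lemma bernoulli_odd: "odd n \<Longrightarrow> n \<noteq> 1 \<Longrightarrow> bernoulli n = 0"
  using bern_even_odd[of n] bern_even_nth[of n] by simp

text \<open>The differential equation of (x/2) coth(x/2), obtained by differentiating B(x) (e^x - 1)
  = x and multiplying by x.\<close>

lemma bern_even_square:
  "bern_even * bern_even = bern_even - fps_X * fps_deriv bern_even + fps_const (1 / 4) * fps_X ^ 2"
proof -
  define U where "U = (fps_exp 1 - 1 :: rat fps)"
  have BU: "bern_fps * U = fps_X" by (simp add: U_def bern_fps_times)
  have "fps_deriv (bern_fps * U) = 1" by (simp add: BU)
  then have d: "fps_deriv bern_fps * U + bern_fps * (U + 1) = 1"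
    by (simp add: U_def add.commute)
  then have "fps_deriv bern_fps * U = 1 - bern_fps * (U + 1)"
    by (simp only: eq_diff_eq)
  then have "fps_X * (fps_deriv bern_fps * U) = fps_X - fps_X * (bern_fps * U) - bern_fps * fps_X"
    by (simp only:) (simp add: algebra_simps)
  then have "(fps_X * fps_deriv bern_fps) * U = (bern_fps - fps_X * bern_fps - bern_fps * bern_fps) * U"
    by (simp only: left_diff_distrib mult.assoc BU)
  then have "fps_X * fps_deriv bern_fps = bern_fps - fps_X * bern_fps - bern_fps * bern_fps"
    by (simp only: U_def exp_minus_one_cancel)
  moreover define h where "h = (fps_const (1 / 2) :: rat fps)"
  have h: "h * h = fps_const (1 / 4)" "h + h = 1" by (simp_all add: h_def)
  have "bern_even * bern_even = bern_fps * bern_fps + (h + h) * fps_X * bern_fps + (h * h) * fps_X ^ 2"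
    unfolding bern_even_def h_def[symmetric] by (simp add: algebra_simps power2_eq_square)
  then have "bern_even * bern_even = bern_fps * bern_fps + fps_X * bern_fps + fps_const (1 / 4) * fps_X ^ 2"
    by (simp only: h mult_1)
  moreover have "bern_even - fps_X * fps_deriv bern_even = bern_fps - fps_X * fps_deriv bern_fps"
    by (simp add: bern_even_def algebra_simps)
  ultimately show ?thesis by simp
qed

text \<open>Coefficient of x^(2m + 2) in \<open>bern_even_square\<close>. The two outer terms of the
  square move to the right, where 1 - (2m + 2) - 2 gives -(2m + 3); \<open>m \<ge> 1\<close> avoids
  the term x^2/4.\<close>

lemma bernoulli_convolution:
  assumes "m \<ge> 1"
  shows "(\<Sum>t<m. bernoulli (2 * t + 2) / fact (2 * t + 2) * (bernoulli (2 * m - 2 * t) / fact (2 * m - 2 * t)))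
    = - of_nat (2 * m + 3) * (bernoulli (2 * m + 2) / fact (2 * m + 2))"
proof -
  let ?c = "fps_nth bern_even"
  have even_sum: "(\<Sum>j\<le>2 * n. f j) = (\<Sum>t\<le>n. f (2 * t))" if "\<And>j. odd j \<Longrightarrow> f j = 0" for f :: "nat \<Rightarrow> rat" and n
    by (induction n) (simp_all add: that)
  have "(\<Sum>j\<le>2 * (m + 1). ?c j * ?c (2 * (m + 1) - j)) = fps_nth (bern_even * bern_even) (2 * (m + 1))"
    by (simp add: fps_mult_nth atLeast0AtMost)
  also have "\<dots> = ?c (2 * m + 2) - of_nat (2 * m + 2) * ?c (2 * m + 2)"
    using assms by (simp add: bern_even_square fps_X_power_nth)
  also have "(\<Sum>j\<le>2 * (m + 1). ?c j * ?c (2 * (m + 1) - j)) = (\<Sum>t\<le>m + 1. ?c (2 * t) * ?c (2 * (m + 1) - 2 * t))"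
    by (rule even_sum) (simp add: bern_even_odd)
  also have "\<dots> = 2 * ?c (2 * m + 2) + (\<Sum>t<m. ?c (2 * t + 2) * ?c (2 * m - 2 * t))"
    by (simp add: sum.atMost_shift bern_even_nth[of 0])
  finally have "(\<Sum>t<m. ?c (2 * t + 2) * ?c (2 * m - 2 * t)) = - of_nat (2 * m + 3) * ?c (2 * m + 2)"
    by (simp add: algebra_simps)
  then show ?thesis by (simp add: bern_even_nth)
qed


lemma sum_odd: "(\<Sum>i\<le>2 * (m :: nat). if odd i then f i else 0) = (\<Sum>t<m. f (2 * t + 1) :: rat)"
  by (induction m) simp_all

lemma binomial_odd_part:
  "(b - a) ^ (2 * m) - (a + b) ^ (2 * m)
    = - 2 * (\<Sum>t<m. of_nat (2 * m choose (2 * t + 1)) * a ^ (2 * t + 1) * b ^ (2 * (m - t - 1) + 1))"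
  for a b :: rat
proof -
  have "(b - a) ^ (2 * m) = (\<Sum>i\<le>2 * m. of_nat (2 * m choose i) * (- a) ^ i * b ^ (2 * m - i))"
    using binomial_ring[of "- a" b "2 * m"] by (simp add: add.commute)
  moreover have "(a + b) ^ (2 * m) = (\<Sum>i\<le>2 * m. of_nat (2 * m choose i) * a ^ i * b ^ (2 * m - i))"
    by (rule binomial_ring)
  ultimately have "(b - a) ^ (2 * m) - (a + b) ^ (2 * m)
      = (\<Sum>i\<le>2 * m. if odd i then - 2 * (of_nat (2 * m choose i) * a ^ i * b ^ (2 * m - i)) else 0)"
    by (simp only: sum_subtractf[symmetric]) (rule sum.cong, auto)
  also have "\<dots> = (\<Sum>t<m. - 2 * (of_nat (2 * m choose (2 * t + 1)) * a ^ (2 * t + 1) * b ^ (2 * m - (2 * t + 1))))"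
    by (rule sum_odd)
  also have "\<dots> = (\<Sum>t<m. - 2 * (of_nat (2 * m choose (2 * t + 1)) * a ^ (2 * t + 1) * b ^ (2 * (m - t - 1) + 1)))"
  proof (rule sum.cong[OF refl])
    fix t assume "t \<in> {..<m}"
    then have "2 * m - (2 * t + 1) = 2 * (m - t - 1) + 1" by auto
    then show "- 2 * (of_nat (2 * m choose (2 * t + 1)) * a ^ (2 * t + 1) * b ^ (2 * m - (2 * t + 1)))
      = - 2 * (of_nat (2 * m choose (2 * t + 1)) * a ^ (2 * t + 1) * b ^ (2 * (m - t - 1) + 1))" by simp
  qed
  finally show ?thesis by (simp only: sum_distrib_left)
qed

text \<open>Of the odd Bernoulli numbers only B_1 = -1/2 survives; it produces the term
  -d^(2m).\<close>

lemma sum_even_powers_bernoulli: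
  assumes "m \<ge> 1"
  shows "2 * (\<Sum>b<d. of_nat b ^ (2 * m)) = 2 / of_nat (2 * m + 1) * of_nat d ^ (2 * m + 1) - of_nat d ^ (2 * m)
    + (\<Sum>t<m. 2 / of_nat (2 * m + 1) * of_nat (2 * m + 1 choose (2 * t + 2)) * bernoulli (2 * t + 2) * of_nat d ^ (2 * (m - t - 1) + 1))"
proof -
  let ?g = "\<lambda>j. of_nat (Suc (2 * m) choose j) * bernoulli j * of_nat d ^ (Suc (2 * m) - j)"
  have "(\<Sum>j\<le>2 * n. f j) = f 0 + (if n \<ge> 1 then f 1 else 0) + (\<Sum>t<n. f (2 * t + 2))"
    if "\<And>j. odd j \<Longrightarrow> j \<noteq> 1 \<Longrightarrow> f j = 0" for f :: "nat \<Rightarrow> rat" and n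
  proof (induction n)
    case (Suc n)
    then show ?case using that[of "2 * n + 1"] by (cases "n = 0") (simp add: numeral_2_eq_2, cases n, simp_all)
  qed simp
  from this[of ?g m] have "(\<Sum>j\<le>2 * m. ?g j) = ?g 0 + ?g 1 + (\<Sum>t<m. ?g (2 * t + 2))"
    using assms by (simp add: bernoulli_odd)
  also have "?g 0 = of_nat d ^ (2 * m + 1)" by simp
  also have "?g 1 = - of_nat (2 * m + 1) / 2 * of_nat d ^ (2 * m)" by (simp add: algebra_simps)
  also have "(\<Sum>t<m. ?g (2 * t + 2)) = (\<Sum>t<m. of_nat (2 * m + 1 choose (2 * t + 2)) * bernoulli (2 * t + 2) * of_nat d ^ (2 * (m - t - 1) + 1))"
  proof (rule sum.cong[OF refl])
    fix t assume "t \<in> {..<m}"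
    then have "Suc (2 * m) - (2 * t + 2) = 2 * (m - t - 1) + 1" by auto
    then show "?g (2 * t + 2) = of_nat (2 * m + 1 choose (2 * t + 2)) * bernoulli (2 * t + 2) * of_nat d ^ (2 * (m - t - 1) + 1)"
      by simp
  qed
  finally have "2 * (\<Sum>b<d. of_nat b ^ (2 * m)) = 2 / of_nat (2 * m + 1) * (of_nat d ^ (2 * m + 1)
      + - of_nat (2 * m + 1) / 2 * of_nat d ^ (2 * m)
      + (\<Sum>t<m. of_nat (2 * m + 1 choose (2 * t + 2)) * bernoulli (2 * t + 2) * of_nat d ^ (2 * (m - t - 1) + 1)))"
    by (simp only: sum_powers_bernoulli Suc_eq_plus1[symmetric]) simp
  also have "\<dots> = 2 / of_nat (2 * m + 1) * of_nat d ^ (2 * m + 1)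
      + 2 / of_nat (2 * m + 1) * (- of_nat (2 * m + 1) / 2 * of_nat d ^ (2 * m))
      + (\<Sum>t<m. 2 / of_nat (2 * m + 1) * of_nat (2 * m + 1 choose (2 * t + 2)) * bernoulli (2 * t + 2) * of_nat d ^ (2 * (m - t - 1) + 1))"
    by (simp only: distrib_left sum_distrib_left mult.assoc)
  also have "2 / of_nat (2 * m + 1) * (- of_nat (2 * m + 1) / 2 * of_nat d ^ (2 * m)) = - (of_nat d ^ (2 * m) :: rat)"
  proof -
    have "2 / N * (- N / 2 * x) = - x" if "N \<noteq> 0" for N x :: rat using that by simp
    then show ?thesis by (metis add_is_0 of_nat_eq_0_iff one_neq_zero)
  qed
  finally show ?thesis by simp
qed

section \<open>Divisor sums\<close>

text \<open>The index set of Liouville's elementary identities; the weights summed over it depend on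
  a and b only.\<close>

definition quads :: "nat \<Rightarrow> (nat \<times> nat \<times> nat \<times> nat) set" where
  "quads n = {(a, b, x, y). a > 0 \<and> b > 0 \<and> x > 0 \<and> y > 0 \<and> a * x + b * y = n}"

lemma finite_quads [simp]: "finite (quads n)"
proof (rule finite_subset)
  show "quads n \<subseteq> {..n} \<times> {..n} \<times> {..n} \<times> {..n}"
  proof
    fix z assume "z \<in> quads n"
    then obtain a b x y where z: "z = (a, b, x, y)" and *: "a > 0" "b > 0" "x > 0" "y > 0" "a * x + b * y = n"
      by (auto simp: quads_def)
    then have "a \<le> a * x" "x \<le> a * x" "b \<le> b * y" "y \<le> b * y" by auto
    with * have "a \<le> n" "b \<le> n" "x \<le> n" "y \<le> n" by linarith+
    then show "z \<in> {..n} \<times> {..n} \<times> {..n} \<times> {..n}" by (simp add: z)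
  qed
qed simp

definition quad_total :: "nat \<Rightarrow> (nat \<Rightarrow> nat \<Rightarrow> rat) \<Rightarrow> rat" where
  "quad_total n h = (\<Sum>(a, b, x, y)\<in>quads n. h a b)"
definition quad_x_gt_y :: "nat \<Rightarrow> (nat \<Rightarrow> nat \<Rightarrow> rat) \<Rightarrow> rat" where
  "quad_x_gt_y n h = (\<Sum>(a, b, x, y)\<in>{(a, b, x, y) \<in> quads n. x > y}. h a b)"
definition quad_b_gt_a :: "nat \<Rightarrow> (nat \<Rightarrow> nat \<Rightarrow> rat) \<Rightarrow> rat" where
  "quad_b_gt_a n h = (\<Sum>(a, b, x, y)\<in>{(a, b, x, y) \<in> quads n. b > a}. h a b)"
definition quad_x_eq_y :: "nat \<Rightarrow> (nat \<Rightarrow> nat \<Rightarrow> rat) \<Rightarrow> rat" where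
  "quad_x_eq_y n h = (\<Sum>(a, b, x, y)\<in>{(a, b, x, y) \<in> quads n. x = y}. h a b)"
definition quad_a_eq_b :: "nat \<Rightarrow> (nat \<Rightarrow> nat \<Rightarrow> rat) \<Rightarrow> rat" where
  "quad_a_eq_b n h = (\<Sum>(a, b, x, y)\<in>{(a, b, x, y) \<in> quads n. a = b}. h a b)"

text \<open>The substitution a x + b y = a (x - y) + (a + b) y.\<close>

lemma quad_sum_shift: "quad_b_gt_a n g = quad_x_gt_y n (\<lambda>a b. g a (a + b))"
  unfolding quad_b_gt_a_def quad_x_gt_y_def
  by (rule sum.reindex_bij_witness[of _ "\<lambda>(a, b, x, y). (a, a + b, x - y, y)" "\<lambda>(a, b, x, y). (a, b - a, x + y, y)"])
     (auto simp: quads_def algebra_simps dest!: less_imp_Suc_add)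

lemma quad_total_split_x: "quad_total n h = quad_x_eq_y n h + quad_x_gt_y n h + quad_x_gt_y n (\<lambda>a b. h b a)"
proof -
  have "quads n = {(a, b, x, y) \<in> quads n. x = y} \<union> {(a, b, x, y) \<in> quads n. x > y} \<union> {(a, b, x, y) \<in> quads n. y > x}"
    by auto
  then have "quad_total n h = (\<Sum>(a, b, x, y)\<in>{(a, b, x, y) \<in> quads n. x = y} \<union> {(a, b, x, y) \<in> quads n. x > y} \<union> {(a, b, x, y) \<in> quads n. y > x}. h a b)"
    unfolding quad_total_def by simp
  also have "\<dots> = (\<Sum>(a, b, x, y)\<in>{(a, b, x, y) \<in> quads n. x = y} \<union> {(a, b, x, y) \<in> quads n. x > y}. h a b)
      + (\<Sum>(a, b, x, y)\<in>{(a, b, x, y) \<in> quads n. y > x}. h a b)"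
    by (rule sum.union_disjoint) (auto intro: finite_subset[OF _ finite_quads])
  also have "(\<Sum>(a, b, x, y)\<in>{(a, b, x, y) \<in> quads n. x = y} \<union> {(a, b, x, y) \<in> quads n. x > y}. h a b) = quad_x_eq_y n h + quad_x_gt_y n h"
    unfolding quad_x_eq_y_def quad_x_gt_y_def
    by (rule sum.union_disjoint) (auto intro: finite_subset[OF _ finite_quads])
  also have "(\<Sum>(a, b, x, y)\<in>{(a, b, x, y) \<in> quads n. y > x}. h a b) = quad_x_gt_y n (\<lambda>a b. h b a)"
    unfolding quad_x_gt_y_def
    by (rule sum.reindex_bij_witness[of _ "\<lambda>(a, b, x, y). (b, a, y, x)" "\<lambda>(a, b, x, y). (b, a, y, x)"])
       (auto simp: quads_def)
  finally show ?thesis .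
qed

lemma quad_total_split_a: "quad_total n h = quad_a_eq_b n h + quad_b_gt_a n h + quad_b_gt_a n (\<lambda>a b. h b a)"
proof -
  have "quads n = {(a, b, x, y) \<in> quads n. a = b} \<union> {(a, b, x, y) \<in> quads n. b > a} \<union> {(a, b, x, y) \<in> quads n. a > b}"
    by auto
  then have "quad_total n h = (\<Sum>(a, b, x, y)\<in>{(a, b, x, y) \<in> quads n. a = b} \<union> {(a, b, x, y) \<in> quads n. b > a} \<union> {(a, b, x, y) \<in> quads n. a > b}. h a b)"
    unfolding quad_total_def by simp
  also have "\<dots> = (\<Sum>(a, b, x, y)\<in>{(a, b, x, y) \<in> quads n. a = b} \<union> {(a, b, x, y) \<in> quads n. b > a}. h a b)
      + (\<Sum>(a, b, x, y)\<in>{(a, b, x, y) \<in> quads n. a > b}. h a b)"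
    by (rule sum.union_disjoint) (auto intro: finite_subset[OF _ finite_quads])
  also have "(\<Sum>(a, b, x, y)\<in>{(a, b, x, y) \<in> quads n. a = b} \<union> {(a, b, x, y) \<in> quads n. b > a}. h a b) = quad_a_eq_b n h + quad_b_gt_a n h"
    unfolding quad_a_eq_b_def quad_b_gt_a_def
    by (rule sum.union_disjoint) (auto intro: finite_subset[OF _ finite_quads])
  also have "(\<Sum>(a, b, x, y)\<in>{(a, b, x, y) \<in> quads n. a > b}. h a b) = quad_b_gt_a n (\<lambda>a b. h b a)"
    unfolding quad_b_gt_a_def
    by (rule sum.reindex_bij_witness[of _ "\<lambda>(a, b, x, y). (b, a, y, x)" "\<lambda>(a, b, x, y). (b, a, y, x)"])
       (auto simp: quads_def)
  finally show ?thesis .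
qed

text \<open>The sum of (b - a)^(2m) is split by comparing a with b, that of (a + b)^(2m) by
  comparing x with y; \<open>quad_sum_shift\<close> turns the off-diagonal parts into sums of
  b^(2m).\<close>

lemma Liouville_even:
  assumes "m \<ge> 1"
  shows "quad_total n (\<lambda>a b. (of_nat b - of_nat a) ^ (2 * m)) - quad_total n (\<lambda>a b. (of_nat a + of_nat b) ^ (2 * m))
    = 2 * quad_a_eq_b n (\<lambda>a b. of_nat b ^ (2 * m)) - quad_x_eq_y n (\<lambda>a b. (of_nat a + of_nat b) ^ (2 * m)) - 2 * quad_x_eq_y n (\<lambda>a b. of_nat b ^ (2 * m))"
proof -
  let ?g1 = "\<lambda>a b. (of_nat b - of_nat a :: rat) ^ (2 * m)"
  let ?g2 = "\<lambda>a b. (of_nat a + of_nat b :: rat) ^ (2 * m)"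
  let ?h = "\<lambda>a b :: nat. (of_nat b :: rat) ^ (2 * m)"
  let ?h' = "\<lambda>a b :: nat. (of_nat a :: rat) ^ (2 * m)"
  have "(of_nat a - of_nat b :: rat) ^ (2 * m) = (of_nat b - of_nat a) ^ (2 * m)" for a b :: nat
    by (simp add: power_mult power2_commute)
  then have g1: "quad_total n ?g1 = quad_a_eq_b n ?g1 + 2 * quad_b_gt_a n ?g1"
    using quad_total_split_a[of n ?g1] by simp
  have "quad_a_eq_b n ?g1 = 0" unfolding quad_a_eq_b_def using assms by (intro sum.neutral) (auto simp: power_0_left)
  moreover have "quad_b_gt_a n ?g1 = quad_x_gt_y n ?h" by (simp add: quad_sum_shift)
  moreover have "quad_total n ?g2 = quad_x_eq_y n ?g2 + 2 * quad_x_gt_y n ?g2"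
    using quad_total_split_x[of n ?g2] by (simp add: add.commute)
  moreover have "quad_x_gt_y n ?g2 = quad_b_gt_a n ?h" by (simp add: quad_sum_shift)
  \<comment> \<open>The two remaining sums of b^(2m), over x > y and over b > a, are related by
    splitting the total of b^(2m) both ways.\<close>
  moreover have "quad_total n ?h = quad_x_eq_y n ?h + quad_x_gt_y n ?h + quad_x_gt_y n ?h'" by (rule quad_total_split_x)
  moreover have "quad_total n ?h = quad_a_eq_b n ?h + quad_b_gt_a n ?h + quad_b_gt_a n ?h'" by (rule quad_total_split_a)
  moreover have "quad_b_gt_a n ?h' = quad_x_gt_y n ?h'" by (simp add: quad_sum_shift)
  ultimately show ?thesis using g1 by linarith
qed

text \<open>The function f(a, b) = a^2 b^2 (a - b)^2 is symmetric and so is f(a, a + b).\<close>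

lemma Liouville_cubes:
  "4 * quad_total n (\<lambda>a b. of_nat a ^ 3 * of_nat b ^ 3) = quad_x_eq_y n (\<lambda>a b. of_nat a ^ 2 * of_nat b ^ 2 * (of_nat a + of_nat b) ^ 2)"
proof -
  let ?f = "\<lambda>a b. of_nat a ^ 2 * of_nat b ^ 2 * (of_nat a - of_nat b :: rat) ^ 2"
  let ?k = "\<lambda>a b. of_nat a ^ 2 * of_nat b ^ 2 * (of_nat a + of_nat b :: rat) ^ 2"
  have "quad_total n ?f = quad_a_eq_b n ?f + 2 * quad_b_gt_a n ?f"
    using quad_total_split_a[of n ?f] by (simp add: power2_commute[of "of_nat _" "of_nat _"] mult_ac)
  moreover have "quad_a_eq_b n ?f = 0" unfolding quad_a_eq_b_def by (intro sum.neutral) auto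
  moreover have "quad_b_gt_a n ?f = quad_x_gt_y n ?k" by (simp add: quad_sum_shift mult_ac power2_eq_square)
  moreover have "quad_total n ?k = quad_x_eq_y n ?k + 2 * quad_x_gt_y n ?k"
    using quad_total_split_x[of n ?k] by (simp add: add.commute mult_ac)
  moreover have "quad_total n ?k - quad_total n ?f = 4 * quad_total n (\<lambda>a b. of_nat a ^ 3 * of_nat b ^ 3)"
    unfolding quad_total_def sum_subtractf[symmetric] sum_distrib_left
    by (rule sum.cong) (auto simp: power2_eq_square power3_eq_cube algebra_simps)
  ultimately show ?thesis by linarith
qed


section \<open>Convolutions of divisor sums\<close>

definition sigma_fps :: "nat \<Rightarrow> rat fps" where
  "sigma_fps i = Abs_fps (\<lambda>n. if n = 0 then 0 else divisor_sigma i n)"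

text \<open>A solution amounts to a splitting n = k + (n - k) with a divisor a of k and a divisor b
  of n - k.\<close>

lemma quad_total_monomial: "quad_total n (\<lambda>a b. of_nat a ^ i * of_nat b ^ j) = fps_nth (sigma_fps i * sigma_fps j) n"
proof -
  \<comment> \<open>Every number divides 0, so k = 0 is given the empty set to match the zero
    constant term.\<close>
  let ?dv = "\<lambda>k. if k = 0 then {} else {d. d dvd (k :: nat)}"
  have fin: "finite (?dv k)" for k by simp
  have sigma_fps: "fps_nth (sigma_fps i) k = (\<Sum>d\<in>?dv k. of_nat d ^ i)" for k i
    by (simp add: sigma_fps_def divisor_sigma_def)
  have "fps_nth (sigma_fps i * sigma_fps j) n = (\<Sum>k=0..n. \<Sum>(a, b)\<in>?dv k \<times> ?dv (n - k). of_nat a ^ i * of_nat b ^ j)"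
    unfolding fps_mult_nth sigma_fps sum_product by (simp only: sum.cartesian_product)
  also have "\<dots> = (\<Sum>(k, a, b)\<in>Sigma {0..n} (\<lambda>k. ?dv k \<times> ?dv (n - k)). of_nat a ^ i * of_nat b ^ j)"
    using fin by (subst sum.Sigma) auto
  also have "\<dots> = (\<Sum>(a, b, x, y)\<in>quads n. of_nat a ^ i * of_nat b ^ j)"
    by (rule sum.reindex_bij_witness[of _ "\<lambda>(a, b, x, y). (a * x, a, b)" "\<lambda>(k, a, b). (a, b, k div a, (n - k) div b)"])
       (auto simp: quads_def split: if_splits elim!: dvdE intro!: gr0I)
  finally show ?thesis by (simp add: quad_total_def)
qed

text \<open>For x = y the equation reads (a + b) x = n, so d = a + b runs over the divisors of
  n.\<close>

lemma quad_x_eq_y_sum: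
  assumes "n > 0"
  shows "quad_x_eq_y n h = (\<Sum>d | d dvd n. \<Sum>a\<in>{0<..<d}. h (d - a) a)"
proof -
  have "(\<Sum>d | d dvd n. \<Sum>a\<in>{0<..<d}. h (d - a) a) = (\<Sum>(d, a)\<in>Sigma {d. d dvd n} (\<lambda>d. {0<..<d}). h (d - a) a)"
    using assms by (subst sum.Sigma) auto
  also have "\<dots> = quad_x_eq_y n h"
    unfolding quad_x_eq_y_def
    by (rule sum.reindex_bij_witness[of _ "\<lambda>(a, b, x, y). (a + b, b)" "\<lambda>(d, a). (d - a, a, n div d, n div d)"])
       (use assms in \<open>auto simp: quads_def simp flip: add_mult_distrib elim!: dvdE\<close>)
  finally show ?thesis ..
qed

text \<open>For a = b the equation reads a (x + y) = n, and n/a splits as x + y in n/a - 1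
  ways.\<close>

lemma quad_a_eq_b_sum:
  assumes "n > 0"
  shows "quad_a_eq_b n h = (\<Sum>d | d dvd n. (of_nat (n div d) - 1) * h d d)"
proof -
  have "(\<Sum>d | d dvd n. (of_nat (n div d) - 1) * h d d) = (\<Sum>d | d dvd n. \<Sum>x\<in>{0<..<n div d}. h d d)"
  proof (rule sum.cong[OF refl])
    fix d assume "d \<in> {d. d dvd n}"
    then have "n div d \<ge> 1" using assms by (auto elim!: dvdE)
    then show "(of_nat (n div d) - 1) * h d d = (\<Sum>x\<in>{0<..<n div d}. h d d)"
      by (simp add: of_nat_diff)
  qed
  also have "\<dots> = (\<Sum>(d, x)\<in>Sigma {d. d dvd n} (\<lambda>d. {0<..<n div d}). h d d)"
    using assms by (subst sum.Sigma) auto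
  also have "\<dots> = quad_a_eq_b n h"
    unfolding quad_a_eq_b_def
    by (rule sum.reindex_bij_witness[of _ "\<lambda>(a, b, x, y). (a, x)" "\<lambda>(d, x). (d, d, x, n div d - x)"])
       (use assms in \<open>auto simp: quads_def algebra_simps elim!: dvdE\<close>)
  finally show ?thesis ..
qed


lemma sigma_fps_nth: "n > 0 \<Longrightarrow> fps_nth (sigma_fps i) n = (\<Sum>d | d dvd n. of_nat d ^ i)"
  and sigma_fps_nth_0 [simp]: "fps_nth (sigma_fps i) 0 = 0"
  by (simp_all add: sigma_fps_def divisor_sigma_def)

text \<open>\<open>Liouville_even\<close> with the left side expanded by the binomial theorem and
  the right side evaluated divisor by divisor through power sums.\<close>

lemma sigma_fps_convolution:
  assumes "m \<ge> 1" "n > 0"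
  shows "2 * (\<Sum>t<m. of_nat (2 * m choose (2 * t + 1)) * fps_nth (sigma_fps (2 * t + 1) * sigma_fps (2 * (m - t - 1) + 1)) n)
    = of_nat (2 * m + 3) / of_nat (2 * m + 1) * fps_nth (sigma_fps (2 * m + 1)) n - 2 * of_nat n * fps_nth (sigma_fps (2 * m - 1)) n
     + (\<Sum>t<m. 2 / of_nat (2 * m + 1) * of_nat (2 * m + 1 choose (2 * t + 2)) * bernoulli (2 * t + 2)
         * fps_nth (sigma_fps (2 * (m - t - 1) + 1)) n)"
proof -
  define N where "N = (of_nat (2 * m + 1) :: rat)"
  have N: "N \<noteq> 0" unfolding N_def of_nat_eq_0_iff by simp
  have N2: "of_nat (2 * m + 3) = N + 2" by (simp add: N_def)
  define w where "w t = 2 / N * of_nat (2 * m + 1 choose (2 * t + 2)) * bernoulli (2 * t + 2)" for t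
  define c where "c t = (of_nat (2 * m choose (2 * t + 1)) :: rat)" for t
  have "quad_total n (\<lambda>a b. (of_nat b - of_nat a) ^ (2 * m)) - quad_total n (\<lambda>a b. (of_nat a + of_nat b) ^ (2 * m))
      = (\<Sum>x\<in>quads n. - 2 * (\<Sum>t<m. c t * of_nat (fst x) ^ (2 * t + 1) * of_nat (fst (snd x)) ^ (2 * (m - t - 1) + 1)))"
    unfolding quad_total_def sum_subtractf[symmetric] split_def binomial_odd_part c_def ..
  also have "\<dots> = - 2 * (\<Sum>t<m. c t * (\<Sum>x\<in>quads n. of_nat (fst x) ^ (2 * t + 1) * of_nat (fst (snd x)) ^ (2 * (m - t - 1) + 1)))"
    unfolding sum_distrib_left by (subst sum.swap) (simp add: mult.assoc)
  also have "\<dots> = - 2 * (\<Sum>t<m. c t * fps_nth (sigma_fps (2 * t + 1) * sigma_fps (2 * (m - t - 1) + 1)) n)"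
    unfolding quad_total_monomial[symmetric] quad_total_def split_def ..
  finally have L: "- 2 * (\<Sum>t<m. c t * fps_nth (sigma_fps (2 * t + 1) * sigma_fps (2 * (m - t - 1) + 1)) n)
    = 2 * quad_a_eq_b n (\<lambda>a b. of_nat b ^ (2 * m)) - quad_x_eq_y n (\<lambda>a b. (of_nat a + of_nat b) ^ (2 * m)) - 2 * quad_x_eq_y n (\<lambda>a b. of_nat b ^ (2 * m))"
    by (simp only: Liouville_even[OF assms(1)])
  have "2 * quad_a_eq_b n (\<lambda>a b. of_nat b ^ (2 * m)) - quad_x_eq_y n (\<lambda>a b. (of_nat a + of_nat b) ^ (2 * m)) - 2 * quad_x_eq_y n (\<lambda>a b. of_nat b ^ (2 * m))
    = (\<Sum>d | d dvd n. 2 * ((of_nat (n div d) - 1) * of_nat d ^ (2 * m))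
        - (\<Sum>a\<in>{0<..<d}. (of_nat (d - a) + of_nat a) ^ (2 * m)) - 2 * (\<Sum>a\<in>{0<..<d}. of_nat a ^ (2 * m)))"
    by (simp only: quad_a_eq_b_sum[OF assms(2)] quad_x_eq_y_sum[OF assms(2)] sum_subtractf sum_distrib_left)
  also have "\<dots> = (\<Sum>d | d dvd n. 2 * of_nat n * of_nat d ^ (2 * m - 1) - (N + 2) / N * of_nat d ^ (2 * m + 1)
        - (\<Sum>t<m. w t * of_nat d ^ (2 * (m - t - 1) + 1)))"
  proof (rule sum.cong[OF refl])
    fix d assume "d \<in> {d. d dvd n}"
    then have d: "d > 0" "of_nat n = (of_nat (n div d) * of_nat d :: rat)"
      using assms(2) by (auto elim!: dvdE simp flip: of_nat_mult)
    have "(\<Sum>a\<in>{0<..<d}. (of_nat (d - a) + of_nat a) ^ (2 * m)) = (\<Sum>a\<in>{0<..<d}. of_nat d ^ (2 * m) :: rat)"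
      by (rule sum.cong) (auto simp flip: of_nat_add)
    also have "\<dots> = (of_nat d - 1) * of_nat d ^ (2 * m)"
      using d by (simp add: of_nat_diff)
    finally have 1: "(\<Sum>a\<in>{0<..<d}. (of_nat (d - a) + of_nat a) ^ (2 * m)) = (of_nat d - 1) * (of_nat d ^ (2 * m) :: rat)" .
    have "(\<Sum>a\<in>{0<..<d}. of_nat a ^ (2 * m)) = (\<Sum>a<d. of_nat a ^ (2 * m) :: rat)"
      using assms(1) by (intro sum.mono_neutral_left) (auto simp: power_0_left)
    then have 2: "2 * (\<Sum>a\<in>{0<..<d}. of_nat a ^ (2 * m)) = 2 / N * of_nat d ^ (2 * m + 1) - of_nat d ^ (2 * m)
      + (\<Sum>t<m. w t * of_nat d ^ (2 * (m - t - 1) + 1))"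
      by (simp only: sum_even_powers_bernoulli[OF assms(1)] w_def N_def)
    have 3: "of_nat d ^ (2 * m) = (of_nat d * of_nat d ^ (2 * m - 1) :: rat)"
      using assms(1) by (simp flip: power_Suc)
    define x where "x = (of_nat d ^ (2 * m - 1) :: rat)"
    have 4: "(of_nat d :: rat) ^ (2 * m) = of_nat d * x"
      unfolding x_def by (rule 3)
    have 6: "(of_nat d :: rat) ^ (2 * m + 1) = of_nat d * (of_nat d * x)"
      by (simp flip: 4)
    have 5: "(N + 2) / N = 1 + 2 / N" using N by (simp add: field_simps)
    show "2 * ((of_nat (n div d) - 1) * of_nat d ^ (2 * m))
        - (\<Sum>a\<in>{0<..<d}. (of_nat (d - a) + of_nat a) ^ (2 * m)) - 2 * (\<Sum>a\<in>{0<..<d}. of_nat a ^ (2 * m))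
      = 2 * of_nat n * of_nat d ^ (2 * m - 1) - (N + 2) / N * of_nat d ^ (2 * m + 1)
        - (\<Sum>t<m. w t * of_nat d ^ (2 * (m - t - 1) + 1))"
      unfolding 1 2 5 6 4 x_def[symmetric] d(2) by (simp add: algebra_simps)
  qed
  also have "\<dots> = 2 * of_nat n * fps_nth (sigma_fps (2 * m - 1)) n - (N + 2) / N * fps_nth (sigma_fps (2 * m + 1)) n
     - (\<Sum>t<m. w t * fps_nth (sigma_fps (2 * (m - t - 1) + 1)) n)"
    unfolding sigma_fps_nth[OF assms(2)] sum_subtractf sum_distrib_left by (subst sum.swap) (rule refl)
  finally show ?thesis using L unfolding N2 N_def[symmetric] w_def c_def by linarith
qed

section \<open>Eisenstein series and quasimodular forms\<close>

text \<open>For even k > 0 this is half the zeta value at 1 - k, the constant term belonging to the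
  divisor sums in the Eisenstein series of weight k.\<close>

definition eis_const :: "nat \<Rightarrow> rat" where "eis_const k = - bernoulli k / (2 * of_nat k)"

definition Eis :: "nat \<Rightarrow> rat fps" where "Eis k = fps_const (eis_const k) + sigma_fps (k - 1)"

definition q_deriv :: "rat fps \<Rightarrow> rat fps" where "q_deriv F = fps_X * fps_deriv F"

lemma q_deriv_nth: "fps_nth (q_deriv F) n = of_nat n * fps_nth F n"
  by (cases n) (simp_all add: q_deriv_def)

text \<open>This matches the Bernoulli terms in \<open>sigma_fps_convolution\<close> with the
  products of a constant term and a divisor sum in \<open>Eis_convolution\<close>; it rests on (2t +
  2) C(2m + 1, 2t + 2) = (2m + 1) C(2m, 2t + 1).\<close>

lemma eis_const_binomial:
  "2 * (of_nat (2 * m choose (2 * t + 1)) * eis_const (2 * t + 2))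
    = - (1 / of_nat (2 * m + 1) * of_nat (2 * m + 1 choose (2 * t + 2)) * bernoulli (2 * t + 2))"
proof -
  define N where "N = (of_nat (2 * m + 1) :: rat)"
  define T where "T = (of_nat (2 * t + 2) :: rat)"
  define P where "P = (of_nat (2 * m + 1 choose (2 * t + 2)) :: rat)"
  have "N \<noteq> 0" "T \<noteq> 0" unfolding N_def T_def of_nat_eq_0_iff by simp_all
  have "(2 * m + 1 choose (2 * t + 2)) * (2 * t + 2) = (2 * m + 1) * (2 * m choose (2 * t + 1))"
    using Suc_times_binomial_eq[of "2 * m" "2 * t + 1"] by simp
  then have "P * T = N * of_nat (2 * m choose (2 * t + 1))"
    unfolding N_def T_def P_def of_nat_mult[symmetric] by (simp only:)
  then have *: "of_nat (2 * m choose (2 * t + 1)) = P * T / N"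
    using \<open>N \<noteq> 0\<close> by (simp add: field_simps)
  show ?thesis
    unfolding eis_const_def T_def[symmetric] N_def[symmetric] P_def[symmetric] * using \<open>T \<noteq> 0\<close> \<open>N \<noteq> 0\<close> by simp
qed

text \<open>The constant term of \<open>Eis_convolution\<close>. The binomial coefficient cancels
  the factorials, leaving \<open>bernoulli_convolution\<close>.\<close>

lemma eis_const_convolution:
  assumes "m \<ge> 1"
  shows "(\<Sum>t<m. of_nat (2 * m choose (2 * t + 1)) * (eis_const (2 * t + 2) * eis_const (2 * (m - t))))
    = of_nat (2 * m + 3) / (2 * of_nat (2 * m + 1)) * eis_const (2 * m + 2)"
proof -
  define b where "b j = bernoulli j / (fact j :: rat)" for j
  have g: "eis_const (Suc j) = - fact j * b (Suc j) / 2" for j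
    by (simp add: eis_const_def b_def field_simps del: of_nat_Suc)
  have "(\<Sum>t<m. of_nat (2 * m choose (2 * t + 1)) * (eis_const (2 * t + 2) * eis_const (2 * (m - t))))
      = (\<Sum>t<m. fact (2 * m) / 4 * (b (2 * t + 2) * b (2 * m - 2 * t)))"
  proof (rule sum.cong[OF refl])
    fix t assume t: "t \<in> {..<m}"
    then have 1: "2 * (m - t) = Suc (2 * m - (2 * t + 1))" "2 * m - 2 * t = Suc (2 * m - (2 * t + 1))" by auto
    have 2: "of_nat (2 * m choose (2 * t + 1)) = (fact (2 * m) / (fact (2 * t + 1) * fact (2 * m - (2 * t + 1))) :: rat)"
      using t by (intro binomial_fact) auto
    have 3: "2 * t + 2 = Suc (2 * t + 1)" by simp
    show "of_nat (2 * m choose (2 * t + 1)) * (eis_const (2 * t + 2) * eis_const (2 * (m - t)))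
      = fact (2 * m) / 4 * (b (2 * t + 2) * b (2 * m - 2 * t))"
      unfolding 1 2 3 g by simp
  qed
  also have "\<dots> = fact (2 * m) / 4 * (\<Sum>t<m. b (2 * t + 2) * b (2 * m - 2 * t))"
    by (simp only: sum_distrib_left)
  also have "(\<Sum>t<m. b (2 * t + 2) * b (2 * m - 2 * t)) = - of_nat (2 * m + 3) * b (2 * m + 2)"
    unfolding b_def by (rule bernoulli_convolution) fact
  also have "fact (2 * m) / 4 * (- of_nat (2 * m + 3) * b (2 * m + 2))
      = of_nat (2 * m + 3) / (2 * of_nat (2 * m + 1)) * (- fact (2 * m + 1) * b (Suc (2 * m + 1)) / 2)"
  proof -
    have "fact (2 * m + 1) = (of_nat (2 * m + 1) * fact (2 * m) :: rat)" by simp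
    moreover have "of_nat (2 * m + 1) \<noteq> (0 :: rat)" unfolding of_nat_eq_0_iff by simp
    moreover have "F / 4 * (- A * B) = A / (2 * N) * (- (N * F) * B / 2)" if "N \<noteq> 0" for F A B N :: rat
      using that by (simp add: field_simps)
    ultimately show ?thesis by (metis Suc_eq_plus1 add_2_eq_Suc')
  qed
  finally show ?thesis by (simp only: g[symmetric]) simp
qed

text \<open>Ramanujan's identity. For m = 1, 2, 3 it expresses the derivatives of E_2, E_4 and E_6 (using that E_8 is the
  square of E_4); for larger m it yields the Eisenstein series of weight 2 m + 2 from those of smaller weight.\<close>

lemma Eis_convolution:
  assumes "m \<ge> 1"
  shows "(\<Sum>t<m. fps_const (of_nat (2 * m choose (2 * t + 1))) * (Eis (2 * t + 2) * Eis (2 * (m - t))))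
    = fps_const (of_nat (2 * m + 3) / (2 * of_nat (2 * m + 1))) * Eis (2 * m + 2) - q_deriv (Eis (2 * m))"
proof (rule fps_ext)
  fix n
  show "fps_nth (\<Sum>t<m. fps_const (of_nat (2 * m choose (2 * t + 1))) * (Eis (2 * t + 2) * Eis (2 * (m - t)))) n
    = fps_nth (fps_const (of_nat (2 * m + 3) / (2 * of_nat (2 * m + 1))) * Eis (2 * m + 2) - q_deriv (Eis (2 * m))) n"
  proof (cases "n = 0")
    case True
    then show ?thesis
      unfolding True fps_sum_nth fps_mult_left_const_nth fps_sub_nth q_deriv_nth fps_mult_nth_0
      using eis_const_convolution[OF assms] by (simp add: Eis_def)
  next
    case False
    then have n: "n > 0" by simp
    let ?s = "\<lambda>i. fps_nth (sigma_fps i) n"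
    let ?c = "\<lambda>t. of_nat (2 * m choose (2 * t + 1)) :: rat"
    have "fps_nth (\<Sum>t<m. fps_const (?c t) * (Eis (2 * t + 2) * Eis (2 * (m - t)))) n
      = (\<Sum>t<m. ?c t * (eis_const (2 * t + 2) * ?s (2 * (m - t - 1) + 1)) + ?c t * (eis_const (2 * (m - t)) * ?s (2 * t + 1))
          + ?c t * fps_nth (sigma_fps (2 * t + 1) * sigma_fps (2 * (m - t - 1) + 1)) n)"
      unfolding fps_sum_nth fps_mult_left_const_nth
    proof (rule sum.cong[OF refl])
      fix t assume "t \<in> {..<m}"
      then have "2 * (m - t) - 1 = 2 * (m - t - 1) + 1" "2 * t + 2 - 1 = 2 * t + 1" by auto
      then have "Eis (2 * t + 2) * Eis (2 * (m - t))
        = fps_const (eis_const (2 * t + 2)) * fps_const (eis_const (2 * (m - t))) + fps_const (eis_const (2 * t + 2)) * sigma_fps (2 * (m - t - 1) + 1)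
          + fps_const (eis_const (2 * (m - t))) * sigma_fps (2 * t + 1) + sigma_fps (2 * t + 1) * sigma_fps (2 * (m - t - 1) + 1)"
        unfolding Eis_def by (simp only: distrib_left distrib_right) (simp only: mult_ac add_ac)
      then show "?c t * fps_nth (Eis (2 * t + 2) * Eis (2 * (m - t))) n
        = ?c t * (eis_const (2 * t + 2) * ?s (2 * (m - t - 1) + 1)) + ?c t * (eis_const (2 * (m - t)) * ?s (2 * t + 1))
          + ?c t * fps_nth (sigma_fps (2 * t + 1) * sigma_fps (2 * (m - t - 1) + 1)) n"
        using n by (simp only: fps_add_nth fps_mult_left_const_nth fps_nth_fps_const) (simp only: distrib_left, simp)
    qed
    also have "\<dots> = (\<Sum>t<m. ?c t * (eis_const (2 * t + 2) * ?s (2 * (m - t - 1) + 1))) + (\<Sum>t<m. ?c t * (eis_const (2 * (m - t)) * ?s (2 * t + 1)))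
          + (\<Sum>t<m. ?c t * fps_nth (sigma_fps (2 * t + 1) * sigma_fps (2 * (m - t - 1) + 1)) n)"
      by (simp only: sum.distrib)
    \<comment> \<open>Reversing t identifies the two mixed sums, by symmetry of the binomial
      coefficient.\<close>
    also have "(\<Sum>t<m. ?c t * (eis_const (2 * (m - t)) * ?s (2 * t + 1)))
        = (\<Sum>t<m. ?c (m - Suc t) * (eis_const (2 * (m - (m - Suc t))) * ?s (2 * (m - Suc t) + 1)))"
      by (rule sum.nat_diff_reindex[symmetric])
    also have "\<dots> = (\<Sum>t<m. ?c t * (eis_const (2 * t + 2) * ?s (2 * (m - t - 1) + 1)))"
    proof (rule sum.cong[OF refl])
      fix t assume t: "t \<in> {..<m}"
      have "2 * m choose (2 * (m - Suc t) + 1) = 2 * m choose (2 * m - (2 * (m - Suc t) + 1))"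
        using t by (intro binomial_symmetric) auto
      moreover have "2 * m - (2 * (m - Suc t) + 1) = 2 * t + 1" "2 * (m - (m - Suc t)) = 2 * t + 2" "m - Suc t = m - t - 1"
        using t by auto
      ultimately show "?c (m - Suc t) * (eis_const (2 * (m - (m - Suc t))) * ?s (2 * (m - Suc t) + 1)) = ?c t * (eis_const (2 * t + 2) * ?s (2 * (m - t - 1) + 1))"
        by (simp only:)
    qed
    finally have 1: "2 * fps_nth (\<Sum>t<m. fps_const (?c t) * (Eis (2 * t + 2) * Eis (2 * (m - t)))) n
      = 2 * (\<Sum>t<m. 2 * (?c t * eis_const (2 * t + 2)) * ?s (2 * (m - t - 1) + 1))
        + 2 * (\<Sum>t<m. ?c t * fps_nth (sigma_fps (2 * t + 1) * sigma_fps (2 * (m - t - 1) + 1)) n)"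
      by (simp add: sum_distrib_left mult.assoc)
    \<comment> \<open>The mixed terms are the negatives of the Bernoulli terms in
      \<open>sigma_fps_convolution\<close>, so the two cancel.\<close>
    have "2 * (\<Sum>t<m. 2 * (?c t * eis_const (2 * t + 2)) * ?s (2 * (m - t - 1) + 1))
        = - (\<Sum>t<m. 2 / of_nat (2 * m + 1) * of_nat (2 * m + 1 choose (2 * t + 2)) * bernoulli (2 * t + 2) * ?s (2 * (m - t - 1) + 1))"
      unfolding eis_const_binomial sum_negf[symmetric] sum_distrib_left
      by (rule sum.cong) simp_all
    then have "2 * fps_nth (\<Sum>t<m. fps_const (?c t) * (Eis (2 * t + 2) * Eis (2 * (m - t)))) n
      = of_nat (2 * m + 3) / of_nat (2 * m + 1) * ?s (2 * m + 1) - 2 * of_nat n * ?s (2 * m - 1)"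
      unfolding 1 sigma_fps_convolution[OF assms n] by simp
    moreover have "2 * fps_nth (fps_const (of_nat (2 * m + 3) / (2 * of_nat (2 * m + 1))) * Eis (2 * m + 2) - q_deriv (Eis (2 * m))) n
      = of_nat (2 * m + 3) / of_nat (2 * m + 1) * ?s (2 * m + 1) - 2 * of_nat n * ?s (2 * m - 1)"
    proof -
      have "2 * (A / (2 * N) * x - y) = A / N * x - 2 * y" for A N x y :: rat by simp
      moreover have "fps_nth (Eis (2 * m + 2)) n = ?s (2 * m + 1)" "fps_nth (Eis (2 * m)) n = ?s (2 * m - 1)"
        using n by (simp_all add: Eis_def)
      ultimately show ?thesis by (simp only: fps_sub_nth fps_mult_left_const_nth q_deriv_nth mult.assoc)
    qed
    ultimately show ?thesis by simp
  qed
qed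

text \<open>The summand is d^2 (d - a)^2 a^2, so the sum follows from the power sums of exponents 2,
  3 and 4.\<close>

lemma sum_squares_convolution:
  "(\<Sum>a\<in>{0<..<d}. of_nat (d - a) ^ 2 * of_nat a ^ 2 * (of_nat (d - a) + of_nat a) ^ 2)
    = (of_nat d ^ 7 - of_nat d ^ 3) / (30 :: rat)"
proof -
  have s: "(\<Sum>a<d. of_nat a ^ 2) = (of_nat d * (of_nat d - 1) * (2 * of_nat d - 1) / 6 :: rat)"
    "(\<Sum>a<d. of_nat a ^ 3) = ((of_nat d * (of_nat d - 1) / 2) ^ 2 :: rat)"
    "(\<Sum>a<d. of_nat a ^ 4) = (of_nat d * (of_nat d - 1) * (2 * of_nat d - 1) * (3 * of_nat d ^ 2 - 3 * of_nat d - 1) / 30 :: rat)"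
    by (induction d) (simp_all add: field_simps power2_eq_square power3_eq_cube power4_eq_xxxx)
  have "(\<Sum>a\<in>{0<..<d}. of_nat (d - a) ^ 2 * of_nat a ^ 2 * (of_nat (d - a) + of_nat a :: rat) ^ 2)
      = (\<Sum>a\<in>{0<..<d}. of_nat d ^ 2 * (of_nat d ^ 2 * of_nat a ^ 2 - 2 * of_nat d * of_nat a ^ 3 + of_nat a ^ 4))"
    by (rule sum.cong) (auto simp: of_nat_diff power2_eq_square power3_eq_cube power4_eq_xxxx algebra_simps)
  also have "\<dots> = (\<Sum>a<d. of_nat d ^ 2 * (of_nat d ^ 2 * of_nat a ^ 2 - 2 * of_nat d * of_nat a ^ 3 + of_nat a ^ 4))"
    by (intro sum.mono_neutral_left) auto
  also have "\<dots> = of_nat d ^ 2 * (of_nat d ^ 2 * (\<Sum>a<d. of_nat a ^ 2) - 2 * of_nat d * (\<Sum>a<d. of_nat a ^ 3) + (\<Sum>a<d. of_nat a ^ 4))"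
    by (simp only: sum_distrib_left[symmetric] sum.distrib sum_subtractf)
  also have "\<dots> = (of_nat d ^ 7 - of_nat d ^ 3) / 30"
    unfolding s by (simp add: field_simps eval_nat_numeral)
  finally show ?thesis .
qed

text \<open>The coefficient form of E_8 = E_4^2, from the diagonal side of
  \<open>Liouville_cubes\<close>: 4 times the convolution is 1/30 of the difference, whence
  120.\<close>

lemma sigma_fps_3_square: "fps_const 120 * (sigma_fps 3 * sigma_fps 3) = sigma_fps 7 - sigma_fps 3"
proof (rule fps_ext)
  fix n
  show "fps_nth (fps_const 120 * (sigma_fps 3 * sigma_fps 3)) n = fps_nth (sigma_fps 7 - sigma_fps 3) n"
  proof (cases "n = 0")
    case False
    then have n: "n > 0" by simp
    have "4 * fps_nth (sigma_fps 3 * sigma_fps 3) n = (\<Sum>d | d dvd n. (of_nat d ^ 7 - of_nat d ^ 3) / 30)"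
      unfolding quad_total_monomial[symmetric] Liouville_cubes quad_x_eq_y_sum[OF n] sum_squares_convolution ..
    also have "\<dots> = (fps_nth (sigma_fps 7) n - fps_nth (sigma_fps 3) n) / 30"
      by (simp add: sigma_fps_nth[OF n] sum_divide_distrib[symmetric] sum_subtractf)
    finally show ?thesis
      by (simp only: fps_mult_left_const_nth fps_sub_nth) (simp add: field_simps)
  qed simp
qed

section \<open>The graded ring of quasimodular forms\<close>

lemma is_qmf_0: "is_qmf w 0"
  unfolding is_qmf_def by (intro exI[of _ "0 :: nat"]) simp

lemma is_qmf_step:
  assumes "is_qmf w F" "2 * a + 4 * b + 6 * d = w"
  shows "is_qmf w (F + fps_const c * E2 ^ a * E4 ^ b * E6 ^ d)"
proof -
  obtain n c' a' b' d' where n: "\<forall>i<(n :: nat). 2 * a' i + 4 * b' i + 6 * d' i = w"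
    "F = (\<Sum>i<n. fps_const (c' i) * E2 ^ a' i * E4 ^ b' i * E6 ^ d' i)"
    using assms(1) unfolding is_qmf_def by blast
  show ?thesis unfolding is_qmf_def
    by (intro exI[of _ "Suc n"] exI[of _ "c'(n := c)"] exI[of _ "a'(n := a)"] exI[of _ "b'(n := b)"] exI[of _ "d'(n := d)"])
       (use n assms(2) in \<open>auto simp: less_Suc_eq\<close>)
qed

lemma is_qmf_induct [consumes 1, case_names zero step]:
  assumes "is_qmf w F" "P 0"
    and "\<And>F c a b d. is_qmf w F \<Longrightarrow> P F \<Longrightarrow> 2 * a + 4 * b + 6 * d = w \<Longrightarrow> P (F + fps_const c * E2 ^ a * E4 ^ b * E6 ^ d)"
  shows "P F"
proof -
  obtain n c a b d where n: "\<forall>i<(n :: nat). 2 * a i + 4 * b i + 6 * d i = w"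
    "F = (\<Sum>i<n. fps_const (c i) * E2 ^ a i * E4 ^ b i * E6 ^ d i)"
    using assms(1) unfolding is_qmf_def by blast
  have "P (\<Sum>i<n. fps_const (c i) * E2 ^ a i * E4 ^ b i * E6 ^ d i)
      \<and> is_qmf w (\<Sum>i<n. fps_const (c i) * E2 ^ a i * E4 ^ b i * E6 ^ d i)" using n(1)
    by (induction n) (auto intro: assms(2,3) is_qmf_0 is_qmf_step)
  with n show ?thesis by simp
qed

lemma is_qmf_add:
  assumes "is_qmf w F" "is_qmf w G"
  shows "is_qmf w (F + G)"
  using assms(2)
proof (induction G rule: is_qmf_induct)
  case (step G c a b d)
  then show ?case using is_qmf_step[of w "F + G" a b d c] by (simp add: add.assoc)
qed (simp add: assms(1))

lemma is_qmf_monom: "2 * a + 4 * b + 6 * d = w \<Longrightarrow> is_qmf w (fps_const c * E2 ^ a * E4 ^ b * E6 ^ d)"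
  using is_qmf_step[OF is_qmf_0] by simp

lemma is_qmf_mult:
  assumes "is_qmf w F" "is_qmf w' G"
  shows "is_qmf (w + w') (F * G)"
  using assms(1)
proof (induction F rule: is_qmf_induct)
  case zero
  then show ?case by (simp add: is_qmf_0)
next
  case (step F c a b d)
  have "is_qmf (w + w') ((fps_const c * E2 ^ a * E4 ^ b * E6 ^ d) * G)"
    using assms(2)
  proof (induction G rule: is_qmf_induct)
    case zero
    then show ?case by (simp add: is_qmf_0)
  next
    case (step G c' a' b' d')
    have "is_qmf (w + w') (fps_const (c * c') * E2 ^ (a + a') * E4 ^ (b + b') * E6 ^ (d + d'))"
      by (rule is_qmf_monom) (use step.hyps(2) \<open>2 * a + 4 * b + 6 * d = w\<close> in simp)
    also have "fps_const (c * c') * E2 ^ (a + a') * E4 ^ (b + b') * E6 ^ (d + d')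
        = (fps_const c * E2 ^ a * E4 ^ b * E6 ^ d) * (fps_const c' * E2 ^ a' * E4 ^ b' * E6 ^ d')"
      by (simp only: power_add fps_const_mult[symmetric] mult_ac)
    finally show ?case using is_qmf_add[OF step.IH] by (simp only: distrib_left)
  qed
  then show ?case using is_qmf_add[OF step.IH] by (simp only: distrib_right)
qed

lemma is_qmf_const: "is_qmf 0 (fps_const c)"
  using is_qmf_monom[of 0 0 0 0 c] by simp

lemma is_qmf_scale: "is_qmf w F \<Longrightarrow> is_qmf w (fps_const c * F)"
  using is_qmf_mult[OF is_qmf_const] by simp

lemma is_qmf_diff: "is_qmf w F \<Longrightarrow> is_qmf w G \<Longrightarrow> is_qmf w (F - G)"
  using is_qmf_add[OF _ is_qmf_scale[of w G "- 1"]] by (simp flip: fps_const_neg)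

lemma is_qmf_sum: "(\<And>x. x \<in> A \<Longrightarrow> is_qmf w (F x)) \<Longrightarrow> is_qmf w (\<Sum>x\<in>A. F x)"
  by (induction A rule: infinite_finite_induct) (auto intro: is_qmf_0 is_qmf_add)

lemma is_qmf_E2: "is_qmf 2 E2" and is_qmf_E4: "is_qmf 4 E4" and is_qmf_E6: "is_qmf 6 E6"
  using is_qmf_monom[of 1 0 0 2 1] is_qmf_monom[of 0 1 0 4 1] is_qmf_monom[of 0 0 1 6 1] by simp_all

lemma bernoulli_2: "bernoulli 2 = 1 / 6"
proof -
  have "{..2 :: nat} = {0, 1, 2}" by auto
  moreover have "Suc 2 choose 2 = 3" by (simp add: eval_nat_numeral)
  ultimately show ?thesis using bernoulli_rec[of 2] by simp
qed

lemma bernoulli_4: "bernoulli 4 = - 1 / 30"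
proof -
  have "{..4 :: nat} = {0, 1, 2, 3, 4}" by auto
  moreover have "Suc 4 choose 2 = 10" "Suc 4 choose 4 = 5" by (simp_all add: eval_nat_numeral)
  ultimately show ?thesis using bernoulli_rec[of 4] by (simp add: bernoulli_odd bernoulli_2)
qed

lemma bernoulli_6: "bernoulli 6 = 1 / 42"
proof -
  have "{..6 :: nat} = {0, 1, 2, 3, 4, 5, 6}" by auto
  moreover have "Suc 6 choose 2 = 21" "Suc 6 choose 4 = 35" "Suc 6 choose 6 = 7" by (simp_all add: eval_nat_numeral)
  ultimately show ?thesis using bernoulli_rec[of 6] by (simp add: bernoulli_odd bernoulli_2 bernoulli_4)
qed

lemma bernoulli_8: "bernoulli 8 = - 1 / 30"
proof -
  have "{..8 :: nat} = {0, 1, 2, 3, 4, 5, 6, 7, 8}" by auto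
  moreover have "Suc 8 choose 2 = 36" "Suc 8 choose 4 = 126" "Suc 8 choose 6 = 84" "Suc 8 choose 8 = 9"
    by (simp_all add: eval_nat_numeral)
  ultimately show ?thesis using bernoulli_rec[of 8] by (simp add: bernoulli_odd bernoulli_2 bernoulli_4 bernoulli_6)
qed

lemma Eis_2: "Eis 2 = fps_const (- 1 / 24) * E2"
  and Eis_4: "Eis 4 = fps_const (1 / 240) * E4"
  and Eis_6: "Eis 6 = fps_const (- 1 / 504) * E6"
  by (rule fps_ext; simp add: Eis_def eis_const_def bernoulli_2 bernoulli_4 bernoulli_6 sigma_fps_def E2_def E4_def E6_def)+

text \<open>The constants are 480 = 2 * 240 and 480 * 120 = 240^2.\<close>

lemma Eis_8: "Eis 8 = fps_const (1 / 480) * (E4 * E4)"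
proof -
  have E4: "E4 = 1 + fps_const 240 * sigma_fps 3"
    by (rule fps_ext) (simp add: E4_def sigma_fps_def)
  have "E4 * E4 = 1 + fps_const 480 * sigma_fps 3 + fps_const 480 * (fps_const 120 * (sigma_fps 3 * sigma_fps 3))"
  proof -
    define c where "c = (fps_const 240 :: rat fps)"
    have "E4 * E4 = 1 + (c + c) * sigma_fps 3 + c * c * (sigma_fps 3 * sigma_fps 3)"
      unfolding E4 c_def[symmetric] by (simp add: algebra_simps)
    moreover have "c + c = fps_const 480" "c * c = fps_const 480 * fps_const 120"
      by (simp_all add: c_def)
    ultimately show ?thesis by (simp only: mult.assoc)
  qed
  then have "E4 * E4 = 1 + fps_const 480 * sigma_fps 7"
    unfolding sigma_fps_3_square by (simp add: algebra_simps)
  moreover have "Eis 8 = fps_const (1 / 480) * (1 + fps_const 480 * sigma_fps 7)"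
    by (rule fps_ext) (simp add: Eis_def eis_const_def bernoulli_8)
  ultimately show ?thesis by simp
qed

lemma is_qmf_Eis_small: "is_qmf 2 (Eis 2)" "is_qmf 4 (Eis 4)" "is_qmf 6 (Eis 6)" "is_qmf 8 (Eis 8)"
  using is_qmf_E2 is_qmf_E4 is_qmf_E6 is_qmf_mult[OF is_qmf_E4 is_qmf_E4]
  by (simp_all add: Eis_2 Eis_4 Eis_6 Eis_8 is_qmf_scale)

lemma is_qmf_Eis_mult: "is_qmf k (Eis k) \<Longrightarrow> is_qmf l (Eis l) \<Longrightarrow> k + l = w \<Longrightarrow> is_qmf w (Eis k * Eis l)"
  using is_qmf_mult by blast

lemma q_deriv_Eis:
  assumes "m \<ge> 1"
  shows "q_deriv (Eis (2 * m)) = fps_const (of_nat (2 * m + 3) / (2 * of_nat (2 * m + 1))) * Eis (2 * m + 2)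
    - (\<Sum>t<m. fps_const (of_nat (2 * m choose (2 * t + 1))) * (Eis (2 * t + 2) * Eis (2 * (m - t))))"
  using Eis_convolution[OF assms] by (simp only: algebra_simps)

text \<open>Here \<open>Eis_convolution\<close> is solved for the derivative, which requires the
  weights up to 2m + 2. For m up to 3 these are the explicit cases through
  \<open>Eis 8\<close>.\<close>

lemma is_qmf_q_deriv_Eis:
  assumes "m \<ge> 1" "\<And>j. 1 \<le> j \<Longrightarrow> j \<le> m + 1 \<Longrightarrow> is_qmf (2 * j) (Eis (2 * j))"
  shows "is_qmf (2 * m + 2) (q_deriv (Eis (2 * m)))"
  unfolding q_deriv_Eis[OF assms(1)]
proof (intro is_qmf_diff is_qmf_sum is_qmf_scale)
  show "is_qmf (2 * m + 2) (Eis (2 * m + 2))" using assms(2)[of "m + 1"] by simp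
  fix t assume "t \<in> {..<m}"
  then show "is_qmf (2 * m + 2) (Eis (2 * t + 2) * Eis (2 * (m - t)))"
    using assms(2)[of "t + 1"] assms(2)[of "m - t"] by (intro is_qmf_Eis_mult) auto
qed

lemma is_qmf_Eis_le_4: "1 \<le> j \<Longrightarrow> j \<le> 4 \<Longrightarrow> is_qmf (2 * j) (Eis (2 * j))"
proof -
  assume "1 \<le> j" "j \<le> 4"
  then have "j = 1 \<or> j = 2 \<or> j = 3 \<or> j = 4" by auto
  then show ?thesis using is_qmf_Eis_small by auto
qed

lemma q_deriv_mult: "q_deriv (F * G) = q_deriv F * G + F * q_deriv G"
  by (simp add: q_deriv_def algebra_simps)

lemma q_deriv_add: "q_deriv (F + G) = q_deriv F + q_deriv G"
  by (simp add: q_deriv_def algebra_simps)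

lemma q_deriv_const_mult: "q_deriv (fps_const c * F) = fps_const c * q_deriv F"
  by (simp add: q_deriv_def algebra_simps)

lemma q_deriv_0 [simp]: "q_deriv 0 = 0" by (simp add: q_deriv_def)

lemma is_qmf_q_deriv_E: "is_qmf 4 (q_deriv E2)" "is_qmf 6 (q_deriv E4)" "is_qmf 8 (q_deriv E6)"
proof -
  have E2: "E2 = fps_const (- 24) * Eis 2" and E4: "E4 = fps_const 240 * Eis 4" and E6: "E6 = fps_const (- 504) * Eis 6"
    by (simp_all add: Eis_2 Eis_4 Eis_6 mult.assoc[symmetric])
  have "is_qmf (2 * 1 + 2) (q_deriv (Eis (2 * 1)))"
    by (rule is_qmf_q_deriv_Eis[OF _ is_qmf_Eis_le_4]) simp_all
  then show "is_qmf 4 (q_deriv E2)" unfolding E2 q_deriv_const_mult by (simp add: is_qmf_scale)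
  have "is_qmf (2 * 2 + 2) (q_deriv (Eis (2 * 2)))"
    by (rule is_qmf_q_deriv_Eis[OF _ is_qmf_Eis_le_4]) simp_all
  then show "is_qmf 6 (q_deriv E4)" unfolding E4 q_deriv_const_mult by (simp add: is_qmf_scale)
  have "is_qmf (2 * 3 + 2) (q_deriv (Eis (2 * 3)))"
    by (rule is_qmf_q_deriv_Eis[OF _ is_qmf_Eis_le_4]) simp_all
  then show "is_qmf 8 (q_deriv E6)" unfolding E6 q_deriv_const_mult by (simp add: is_qmf_scale)
qed

lemma is_qmf_q_deriv_mult:
  assumes "is_qmf w F" "is_qmf (w + 2) (q_deriv F)" "is_qmf w' G" "is_qmf (w' + 2) (q_deriv G)"
  shows "is_qmf (w + w' + 2) (q_deriv (F * G))"
  using is_qmf_add[of "w + w' + 2" "q_deriv F * G" "F * q_deriv G"] is_qmf_mult[OF assms(2,3)] is_qmf_mult[OF assms(1,4)]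
  by (simp add: q_deriv_mult add_ac)

lemma is_qmf_q_deriv_power:
  assumes "is_qmf w F" "is_qmf (w + 2) (q_deriv F)"
  shows "is_qmf (w * a) (F ^ a) \<and> is_qmf (w * a + 2) (q_deriv (F ^ a))"
proof (induction a)
  case 0
  have "q_deriv 1 = 0" by (simp add: q_deriv_def)
  then show ?case using is_qmf_const[of 1] by (simp add: is_qmf_0)
next
  case (Suc a)
  then show ?case
    using is_qmf_mult[OF assms(1), of "w * a" "F ^ a"] is_qmf_q_deriv_mult[OF assms, of "w * a" "F ^ a"]
    by (simp add: algebra_simps)
qed

lemma is_qmf_q_deriv: "is_qmf w F \<Longrightarrow> is_qmf (w + 2) (q_deriv F)"
proof (induction F rule: is_qmf_induct)
  case zero
  then show ?case by (simp add: is_qmf_0)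
next
  case (step F c a b d)
  have E2: "is_qmf (2 * a) (E2 ^ a)" "is_qmf (2 * a + 2) (q_deriv (E2 ^ a))"
    using is_qmf_q_deriv_power[OF is_qmf_E2] is_qmf_q_deriv_E by auto
  have E4: "is_qmf (4 * b) (E4 ^ b)" "is_qmf (4 * b + 2) (q_deriv (E4 ^ b))"
    using is_qmf_q_deriv_power[OF is_qmf_E4] is_qmf_q_deriv_E by auto
  have E6: "is_qmf (6 * d) (E6 ^ d)" "is_qmf (6 * d + 2) (q_deriv (E6 ^ d))"
    using is_qmf_q_deriv_power[OF is_qmf_E6] is_qmf_q_deriv_E by auto
  have "is_qmf (2 * a + 4 * b + 6 * d + 2) (q_deriv (E2 ^ a * E4 ^ b * E6 ^ d))"
    by (intro is_qmf_q_deriv_mult is_qmf_mult E2 E4 E6)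
  then have "is_qmf (w + 2) (q_deriv (fps_const c * E2 ^ a * E4 ^ b * E6 ^ d))"
    using step.hyps(2) by (simp add: mult.assoc q_deriv_const_mult is_qmf_scale)
  then show ?case using step.IH by (simp add: q_deriv_add is_qmf_add)
qed

text \<open>Here \<open>Eis_convolution\<close> is solved for the series of highest weight. Weights
  up to 8 come first, since closure under \<open>q_deriv\<close> depends on them.\<close>

lemma is_qmf_Eis: "m \<ge> 1 \<Longrightarrow> is_qmf (2 * m) (Eis (2 * m))"
proof (induction m rule: less_induct)
  case (less m)
  show ?case
  proof (cases "m \<le> 4")
    case True
    then show ?thesis using less.prems is_qmf_Eis_le_4 by blast
  next
    case False
    define n where "n = m - 1"
    with False have n: "m = n + 1" "n \<ge> 1" by auto
    define x where "x = (of_nat (2 * n + 3) / (2 * of_nat (2 * n + 1)) :: rat)"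
    have "of_nat (2 * n + 3) \<noteq> (0 :: rat)" "of_nat (2 * n + 1) \<noteq> (0 :: rat)" unfolding of_nat_eq_0_iff by simp_all
    then have x: "x \<noteq> 0" unfolding x_def by simp
    have "is_qmf (2 * n + 2) ((\<Sum>t<n. fps_const (of_nat (2 * n choose (2 * t + 1))) * (Eis (2 * t + 2) * Eis (2 * (n - t)))) + q_deriv (Eis (2 * n)))"
    proof (intro is_qmf_add is_qmf_sum is_qmf_scale is_qmf_q_deriv less.IH)
      fix t assume "t \<in> {..<n}"
      then show "is_qmf (2 * n + 2) (Eis (2 * t + 2) * Eis (2 * (n - t)))"
        using less.IH[of "t + 1"] less.IH[of "n - t"] n by (intro is_qmf_Eis_mult) auto
    qed (use n in auto)
    then have "is_qmf (2 * n + 2) (fps_const x * Eis (2 * n + 2))"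
      unfolding Eis_convolution[OF n(2)] x_def by simp
    then have "is_qmf (2 * n + 2) (fps_const (1 / x) * (fps_const x * Eis (2 * n + 2)))"
      by (rule is_qmf_scale)
    then show ?thesis using x n by (simp add: mult.assoc[symmetric])
  qed
qed

section \<open>The q-bracket as a specialization\<close>

lemma psize_rect: "m \<noteq> 0 \<Longrightarrow> psize (rect r m) = r * m"
  by (simp add: psize_def)

lemma psize_plus [simp]: "psize (p + q) = psize p + psize q"
  by (simp add: psize_def)

lemma mult_r_le_psize: "mult_r m p * m \<le> psize p"
proof (cases "m = 0")
  case False
  have "parts p = replicate_mset (mult_r m p) m + (parts p - replicate_mset (mult_r m p) m)"
    by (metis mult_r_def count_le_replicate_mset_subset_eq order_refl subset_mset.add_diff_inverse)
  then have "psize p = sum_mset (replicate_mset (mult_r m p) m) + sum_mset (parts p - replicate_mset (mult_r m p) m)"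
    unfolding psize_def by (metis sum_mset.union)
  then show ?thesis by simp
qed simp

text \<open>Every partition of n lies below the multiset containing each of 1, ..., n exactly n
  times.\<close>

lemma finite_psize [simp]: "finite {p. psize p = n}"
proof -
  let ?M = "\<Sum>m\<in>{1..n}. replicate_mset n m"
  have "parts p \<subseteq># ?M" if "psize p = n" for p
    unfolding subseteq_mset_def
  proof
    fix m
    show "count (parts p) m \<le> count ?M m"
    proof (cases "m \<in># parts p")
      case True
      then have m: "m \<ge> 1" "mult_r m p \<ge> 1" by (auto simp: mult_r_def Suc_le_eq intro!: gr0I)
      have le: "mult_r m p * m \<le> n" using mult_r_le_psize[of m p] that by simp
      have "m \<le> mult_r m p * m" "mult_r m p \<le> mult_r m p * m" using m by auto
      with le have "m \<le> n" "mult_r m p \<le> n" by linarith+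
      moreover have "count ?M m = (\<Sum>i\<in>{1..n}. if i = m then n else 0)"
        unfolding count_sum by (rule sum.cong) auto
      ultimately show ?thesis using m by (simp add: mult_r_def)
    qed (simp add: not_in_iff)
  qed
  then have "parts ` {p. psize p = n} \<subseteq> {A. A \<subseteq># ?M}" by auto
  then have "finite (parts ` {p. psize p = n})" by (rule finite_subset) (rule finite_submultisets)
  then show ?thesis by (rule finite_imageD) (simp add: inj_on_def)
qed

text \<open>The substitution of q^m for u_m, under which the monomial of a partition becomes q to
  the power of its size.\<close>

definition q_spec :: "useries \<Rightarrow> rat fps" where
  "q_spec f = Abs_fps (\<lambda>n. \<Sum>p | psize p = n. coeff_u f p)"

lemma q_spec_nth [simp]: "fps_nth (q_spec f) n = (\<Sum>p | psize p = n. coeff_u f p)"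
  by (simp add: q_spec_def)

lemma q_spec_add: "q_spec (f + g) = q_spec f + q_spec g"
  and q_spec_cst_mult: "q_spec (cst c * f) = fps_const c * q_spec f"
  by (rule fps_ext; simp add: sum.distrib sum_distrib_left)+

lemma q_spec_mult: "q_spec (f * g) = q_spec f * q_spec g"
proof (rule fps_ext)
  fix n
  have "fps_nth (q_spec (f * g)) n = (\<Sum>(p, a, b)\<in>Sigma {p. psize p = n} splits. coeff_u f a * coeff_u g b)"
    by (simp add: coeff_u_mult sum.Sigma split_def)
  also have "\<dots> = (\<Sum>(i, a, b)\<in>Sigma {0..n} (\<lambda>i. {p. psize p = i} \<times> {p. psize p = n - i}). coeff_u f a * coeff_u g b)"
    by (rule sum.reindex_bij_witness[of _ "\<lambda>(i, a, b). (a + b, a, b)" "\<lambda>(p, a, b). (psize a, a, b)"])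
       auto
  also have "\<dots> = (\<Sum>i=0..n. \<Sum>(a, b)\<in>{p. psize p = i} \<times> {p. psize p = n - i}. coeff_u f a * coeff_u g b)"
    by (subst sum.Sigma) auto
  also have "\<dots> = fps_nth (q_spec f * q_spec g) n"
    by (simp add: fps_mult_nth sum_product sum.cartesian_product)
  finally show "fps_nth (q_spec (f * g)) n = fps_nth (q_spec f * q_spec g) n" .
qed

lemma psize_eq_0 [simp]: "psize p = 0 \<longleftrightarrow> p = 0"
proof
  assume "psize p = 0"
  then have "\<forall>x\<in>#parts p. x = 0" by (simp add: psize_def)
  then have "parts p = {#}" using zero_notin_parts[of p] by (cases "parts p") auto
  then show "p = 0" by (metis parts_inject parts_zero)
qed (simp add: psize_def)

lemma q_spec_1: "q_spec 1 = 1"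
proof (rule fps_ext)
  fix n
  have "(\<Sum>p | psize p = n. coeff_u 1 p) = (\<Sum>p | psize p = n. if p = 0 then 1 else 0)" by simp
  also have "\<dots> = (if psize 0 = n then 1 else 0)"
    by (subst sum.delta) auto
  finally show "fps_nth (q_spec 1) n = fps_nth 1 n" by (cases n) (simp_all add: psize_def)
qed

text \<open>The substitution is multiplicative and sends \<open>ones\<close> to the generating
  series of partitions, so it turns the u-bracket into the q-bracket.\<close>

lemma qbracket_q_spec: "qbracket f = q_spec (ubracket f)"
proof -
  have nz: "q_spec ones \<noteq> 0"
  proof
    assume "q_spec ones = 0"
    then have "fps_nth (q_spec ones) 0 = 0" by simp
    then show False by simp
  qed
  have "qbracket f = q_spec (useries f) / q_spec ones"
    unfolding qbracket_def q_spec_def by simp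
  also have "q_spec (useries f) = q_spec (ubracket f) * q_spec ones"
    by (simp flip: q_spec_mult add: mult.commute[of _ ones])
  finally show ?thesis using nz by (simp add: fps_divide_times_eq)
qed

text \<open>The sum of m^a r^b q^(m r) over positive m and r, a form in which the symmetry in a and
  b and the action of q d/dq are visible.\<close>

definition sigma2 :: "nat \<Rightarrow> nat \<Rightarrow> rat fps" where
  "sigma2 a b = Abs_fps (\<lambda>n. if n = 0 then 0 else \<Sum>m | m dvd n. of_nat m ^ a * of_nat (n div m) ^ b)"

lemma coeff_tau_singleton: "set_mset (parts p) = {m} \<Longrightarrow> coeff_u (tau k l) p = of_nat m ^ k * of_nat (mult_r m p) ^ (l - 1)"
  by (simp add: tau_def coeff_part_sum coeff_phi)

lemma coeff_tau_not_singleton: "(\<And>m. set_mset (parts p) \<noteq> {m}) \<Longrightarrow> coeff_u (tau k l) p = 0"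
  by (simp add: tau_def coeff_part_sum coeff_phi)

text \<open>Only partitions into r copies of m contribute, and those of size n correspond to the
  divisors m of n.\<close>

lemma q_spec_tau: "q_spec (tau k l) = sigma2 k (l - 1)"
proof (rule fps_ext)
  fix n
  show "fps_nth (q_spec (tau k l)) n = fps_nth (sigma2 k (l - 1)) n"
  proof (cases "n = 0")
    case True
    then show ?thesis by (simp add: sigma2_def coeff_tau_not_singleton)
  next
    case False
    have sing: "\<exists>r m. p = rect r m \<and> m \<noteq> 0 \<and> r \<noteq> 0 \<and> set_mset (parts p) = {m} \<and> mult_r m p = r \<and> psize p = r * m"
      if "\<exists>m. set_mset (parts p) = {m}" for p
    proof -
      obtain m where m: "set_mset (parts p) = {m}" using \<open>\<exists>m. _\<close> by blast
      then have "m \<noteq> 0" using zero_notin_parts[of p] by auto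
      moreover have "mult_r m p \<noteq> 0" using m by (simp add: mult_r_def count_eq_zero_iff)
      ultimately show ?thesis using eq_rect[OF m] m psize_rect by metis
    qed
    have "(\<Sum>p | psize p = n. coeff_u (tau k l) p) = (\<Sum>m | m dvd n. of_nat m ^ k * of_nat (n div m) ^ (l - 1))"
    \<comment> \<open>\<open>Max\<close> extracts the unique element of the set of parts.\<close>
    proof (rule sum_reindex_supported[where P = "\<lambda>p. \<exists>m. set_mset (parts p) = {m}"
          and i = "\<lambda>m. rect (n div m) m" and j = "\<lambda>p. Max (set_mset (parts p))"], goal_cases)
      case (2 p)
      then show ?case by (intro coeff_tau_not_singleton) blast
    next
      case (3 p)
      then show ?case using sing[of p] by auto
    next
      case (4 p)
      then show ?case using sing[of p] by auto
    next
      case (5 p)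
      then show ?case using sing[of p] by (auto simp: coeff_tau_singleton)
    next
      case (6 m)
      then have "m \<noteq> 0" "n div m \<noteq> 0" using False by (auto elim!: dvdE)
      then show ?case by simp
    next
      case (7 m)
      then have "m \<noteq> 0" using False by auto
      with 7 show ?case by (simp add: psize_rect)
    next
      case (8 m)
      then have "m \<noteq> 0" "n div m \<noteq> 0" using False by (auto elim!: dvdE)
      then show ?case by simp
    qed simp
    then show ?thesis using False by (simp add: sigma2_def)
  qed
qed

lemma sigma2_commute: "sigma2 a b = sigma2 b a"
proof (rule fps_ext)
  fix n
  have "(\<Sum>m | m dvd n. of_nat m ^ a * of_nat (n div m) ^ b) = (\<Sum>m | m dvd n. of_nat m ^ b * of_nat (n div m) ^ a :: rat)" if "n > 0"
    by (rule sum.reindex_bij_witness[of _ "\<lambda>m. n div m" "\<lambda>m. n div m"]) (use that in \<open>auto elim!: dvdE\<close>)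
  then show "fps_nth (sigma2 a b) n = fps_nth (sigma2 b a) n" by (simp add: sigma2_def)
qed

lemma sigma2_0: "sigma2 a 0 = sigma_fps a"
  by (rule fps_ext) (simp add: sigma2_def sigma_fps_def divisor_sigma_def)

lemma sigma2_q_deriv: "sigma2 (Suc a) (Suc b) = q_deriv (sigma2 a b)"
proof (rule fps_ext)
  fix n
  have "of_nat m ^ Suc a * of_nat (n div m) ^ Suc b = of_nat n * (of_nat m ^ a * of_nat (n div m) ^ b :: rat)" if "m dvd n" for m
  proof -
    have "of_nat n = (of_nat m * of_nat (n div m) :: rat)" using that by (simp flip: of_nat_mult)
    then show ?thesis by (simp add: mult_ac)
  qed
  then have "(\<Sum>m | m dvd n. of_nat m ^ Suc a * of_nat (n div m) ^ Suc b)
      = (\<Sum>m | m dvd n. of_nat n * (of_nat m ^ a * of_nat (n div m) ^ b) :: rat)"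
    by (intro sum.cong) auto
  then show "fps_nth (sigma2 (Suc a) (Suc b)) n = fps_nth (q_deriv (sigma2 a b)) n"
    by (simp add: sigma2_def q_deriv_nth sum_distrib_left del: power_Suc)
qed

text \<open>This is \<open>q_deriv\<close> applied b + 1 times to \<open>Eis (i + 1)\<close>, whose
  constant term the first derivative removes; each derivative adds 2 to the weight.\<close>

lemma is_qmf_sigma2_Suc: "odd i \<Longrightarrow> is_qmf (i + 2 * b + 3) (sigma2 (i + Suc b) (Suc b))"
proof (induction b)
  case 0
  then obtain j where j: "i = 2 * j + 1" by (elim oddE)
  have "q_deriv (Eis (i + 1)) = sigma2 (i + 1) 1"
    by (simp add: sigma2_q_deriv sigma2_0 Eis_def q_deriv_add) (simp add: q_deriv_def)
  moreover have "is_qmf (2 * (j + 1) + 2) (q_deriv (Eis (2 * (j + 1))))"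
    by (intro is_qmf_q_deriv is_qmf_Eis) simp
  moreover have "i + 2 * 0 + 3 = 2 * (j + 1) + 2" "i + 1 = 2 * (j + 1)" "i + Suc 0 = i + 1" using j by simp_all
  ultimately show ?case by (metis One_nat_def)
next
  case (Suc b)
  then have "is_qmf (i + 2 * b + 3 + 2) (q_deriv (sigma2 (i + Suc b) (Suc b)))" by (intro is_qmf_q_deriv) simp
  then show ?case by (simp add: sigma2_q_deriv[symmetric])
qed

text \<open>By symmetry one may take b < a; equality is excluded by the parity of a + b.\<close>

lemma is_qmf_sigma2:
  assumes "a \<ge> 1" "b \<ge> 1" "odd (a + b)"
  shows "is_qmf (a + b + 1) (sigma2 a b)"
proof -
  have *: "is_qmf (a + b + 1) (sigma2 a b)" if "b < a" "b \<ge> 1" "odd (a + b)" for a b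
  proof -
    have odd: "odd (a - b)" using that by auto
    have "a - b + 2 * (b - 1) + 3 = a + b + 1" "a - b + Suc (b - 1) = a" "Suc (b - 1) = b"
      using that by auto
    then show ?thesis using is_qmf_sigma2_Suc[OF odd, of "b - 1"] by (simp only:)
  qed
  show ?thesis
  proof (cases "b < a")
    case True
    then show ?thesis using * assms by blast
  next
    case False
    then have "a < b" using assms(3) by (cases "a = b") auto
    then have "is_qmf (b + a + 1) (sigma2 b a)" using * assms by (simp add: add.commute)
    then show ?thesis by (simp add: sigma2_commute add.commute)
  qed
qed

text \<open>The Kronecker deltas in \<open>Tmom k l\<close> cover exactly the cases l = 1 and k = 0,
  which parity keeps apart; there the bracket is the full Eisenstein series of weight k + l.
  Otherwise it is an iterated derivative of one and has no constant term.\<close>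

lemma is_qmf_Tmom:
  assumes "l \<ge> 1" "even (k + l)"
  shows "is_qmf (k + l) (qbracket (Tmom k l))"
proof -
  have eq: "qbracket (Tmom k l) = fps_const (Tconst k l) + sigma2 k (l - 1)"
    unfolding qbracket_q_spec Tmom_Pfun ubracket_step ubracket_Pfun ubracket_one_fun q_spec_add q_spec_cst_mult q_spec_1 q_spec_tau
    by simp
  consider "l = 1" | "l \<noteq> 1" "k = 0" | "l \<ge> 2" "k \<ge> 1" using assms(1) by linarith
  then show ?thesis
  proof cases
    case 1
    then have k: "k \<ge> 1" using assms(2) by (cases k) auto
    then have "Tconst k l = eis_const (k + 1)" by (simp add: Tconst_def eis_const_def kdelta_def 1)
    then have "qbracket (Tmom k l) = Eis (k + 1)" unfolding eq by (simp add: 1 sigma2_0 Eis_def)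
    moreover obtain j where j: "k + 1 = 2 * j" using assms(2) 1 by (metis evenE)
    moreover have "j \<ge> 1" using j k by simp
    ultimately show ?thesis using is_qmf_Eis[of j] 1 by simp
  next
    case 2
    then have "Tconst k l = eis_const l" by (simp add: Tconst_def eis_const_def kdelta_def)
    then have "qbracket (Tmom k l) = Eis l" unfolding eq using 2 by (simp add: sigma2_commute[of 0 "l - Suc 0"] sigma2_0 Eis_def)
    moreover obtain j where j: "l = 2 * j" using assms(2) 2 by (auto elim: evenE)
    moreover have "j \<ge> 1" using j assms(1) by simp
    ultimately show ?thesis using is_qmf_Eis[of j] 2 by simp
  next
    case 3
    then have "Tconst k l = 0" by (simp add: Tconst_def kdelta_def)
    then show ?thesis using is_qmf_sigma2[of k "l - 1"] 3 assms(2) by (simp add: eq)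
  qed
qed

lemma is_qmf_T_hom: "f \<in> T_hom w \<Longrightarrow> is_qmf w (qbracket f)"
  unfolding T_hom_def
proof (induction rule: qlin_span_induct)
  case zero
  have "q_spec 0 = 0" by (rule fps_ext) simp
  then show ?case by (simp add: qbracket_q_spec is_qmf_0)
next
  case (step f x c)
  have "is_qmf w (qbracket x)" using step.hyps(2)
  proof (induction rule: odot_monos_induct)
    case one
    then show ?case using is_qmf_const[of 1] by (simp add: qbracket_q_spec q_spec_1)
  next
    case (mult w g w' f)
    then have "is_qmf w (qbracket g)" by (auto simp: T_gens_def intro: is_qmf_Tmom)
    from is_qmf_mult[OF this mult(3)] show ?case by (simp add: qbracket_q_spec ubracket_odot q_spec_mult)
  qed
  then show ?case using step.IH
    by (simp only: qbracket_q_spec ubracket_step q_spec_add q_spec_cst_mult) (intro is_qmf_add is_qmf_scale)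
qed

theorem theorem4p1p4:
  shows "quasimodular_alg S_alg S_hom \<and> quasimodular_alg SymS_alg SymS_hom \<and> quasimodular_alg T_alg T_hom
       \<and> closed_pointwise S_alg \<and> closed_pointwise SymS_alg \<and> closed_pointwise T_alg
       \<and> closed_odot SymS_alg \<and> closed_odot T_alg
       \<and> S_alg \<subset> SymS_alg \<and> SymS_alg \<subset> T_alg"
proof (intro conjI)
  show "quasimodular_alg S_alg S_hom"
    unfolding quasimodular_alg_def
  proof (intro conjI allI impI)
    show "S_hom w \<subseteq> S_alg" for w unfolding S_hom_def S_alg_def by (rule qlin_span_mono) blast
    show "S_alg \<subseteq> qlin_span (\<Union>w. S_hom w)"
      unfolding S_alg_def S_hom_def by (rule qlin_span_mono) (auto intro: qlin_span_base)
    show "is_qmf w (qbracket f)" if "f \<in> S_hom w" for w f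
      using that S_hom_T_hom is_qmf_T_hom by blast
  qed
  show "quasimodular_alg SymS_alg SymS_hom"
    unfolding quasimodular_alg_def
  proof (intro conjI allI impI)
    show "SymS_hom w \<subseteq> SymS_alg" for w unfolding SymS_hom_def SymS_alg_def by (rule qlin_span_mono) blast
    show "SymS_alg \<subseteq> qlin_span (\<Union>w. SymS_hom w)"
      unfolding SymS_alg_def SymS_hom_def by (rule qlin_span_mono) (auto intro: qlin_span_base)
    show "is_qmf w (qbracket f)" if "f \<in> SymS_hom w" for w f
      using that SymS_hom_T_hom is_qmf_T_hom by blast
  qed
  show "quasimodular_alg T_alg T_hom"
    unfolding quasimodular_alg_def using T_hom_subset T_alg_subset is_qmf_T_hom by blast
  show "closed_pointwise S_alg" unfolding S_alg_def by (rule closed_pointwise_span)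
  show "closed_pointwise SymS_alg" unfolding SymS_alg_eq by (rule closed_pointwise_tau_space)
  show "closed_pointwise T_alg" unfolding T_alg_def by (rule closed_pointwise_span)
  show "closed_odot SymS_alg" unfolding SymS_alg_def by (rule closed_odot_span)
  show "closed_odot T_alg" by (simp add: T_alg_eq closed_odot_def tau_space_odot)
  show "S_alg \<subset> SymS_alg" by (rule S_psubset)
  show "SymS_alg \<subset> T_alg" by (rule SymS_psubset)
qed

end
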